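(* Every graph $G$ admits a rooted tree-cut decomposition $(T,\mathcal{V})$ of finite adhesion that displays the set of all undominated edge-ends of $G$ together with their edge-degrees: for each undominated edge-end $\omega$ of $G$, with corresponding ray $R_\omega=t_0t_1t_2\dots$ in $T$ starting at the root $t_0$ (the ray from the root representing the end $\varphi(\omega)$ of $T$), $$\deg(\omega)=\liminf_{n}|\delta(C_{t_n})|.$$
   Context: Graphs are arbitrary (possibly infinite) multigraphs with parallel edges allowed. For $C\subseteq V(G)$, $\delta(C)$ is the set of edges with exactly one endpoint in $C$. Edge-ends. A ray is a one-way infinite path; its tails are its infinite connected subgraphs. Two subgraphs are separated by a finite set $F\subseteq E(G)$ if no path in $G\setminus F$ contains a vertex of both (and similarly for a vertex and a subgraph). Two rays $R,S$ are edge-equivalent if no tail of $S$ can be separated from a tail of $R$ by a finite set of edges. The equivalence classes are the edge-ends of $G$; $\Omega_E(G)$ is the set of edge-ends. A vertex $v$ edge-dominates the edge-end of $R$ if $v$ cannot be separated from any tail of $R$ by a finite set of edges. An edge-end is undominated if no vertex edge-dominates it. An edge-end $\omega$ lives in $C\subseteq V(G)$ if every ray of $\omega$ has a tail in $C$. The edge-degree of $\omega$ is $\deg(\omega)=\sup\{|\mathcal{R}|:\mathcal{R}\subseteq\omega$ a family of edge-disjoint rays$\}\in\mathbb{N}\cup\{\infty\}$. Tree-cut decompositions. A rooted tree-cut decomposition $(T,\mathcal{V})$ of $G$ consists of a rooted tree $T$ and a family $\mathcal{V}=(V_t)_{t\in T}$ of pairwise disjoint, possibly empty sets $V_t\subseteq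 V(G)$ with $\bigsqcup_{t\in T}V_t=V(G)$. Let $\le$ be the tree-order of $T$ (the root is the least element) and $C_t:=\bigcup_{s\ge t}V_s$. For an edge $e\in E(T)$ with $T_1,T_2$ the two components of $T-e$, the adhesion set $F_e$ is the set of edges of $G$ between $\bigcup_{t\in T_1}V_t$ and $\bigcup_{t\in T_2}V_t$. The decomposition has finite adhesion if every $F_e$ is finite. Displaying. Let $(T,\mathcal{V})$ have finite adhesion and let $\Omega(T)$ be the set of ends of $T$. Each $\omega\in\Omega_E(G)$ orients every edge $e$ of $T$ towards the component $T_i$ of $T-e$ such that $\omega$ lives in $\bigcup_{t\in T_i}V_t$; all edges then point towards a unique node or a unique end of $T$, and $\varphi(\omega)\in V(T)\cup\Omega(T)$ denotes this node or end. The decomposition displays a set $\Psi\subseteq\Omega_E(G)$ if $\varphi^{-1}(\Omega(T))=\Psi$ and $\varphi|_\Psi:\Psi\to\Omega(T)$ is a bijection. *)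

theory Defs
  imports "HOL-Library.Extended_Nat" "HOL-Library.Liminf_Limsup"
begin

section \<open>Multigraphs\<close>

record ('v, 'e) mgraph =
  verts :: "'v set"
  edges :: "'e set"
  endpoints :: "'e \<Rightarrow> 'v set"

text \<open>Parallel edges are distinct edges with the same pair of endpoints.  Loops
  (\<open>u = v\<close>) are permitted; they lie in no ray, no path and no cut.\<close>

definition multigraph :: "('v, 'e) mgraph \<Rightarrow> bool" where
  "multigraph G \<longleftrightarrow> (\<forall>e\<in>edges G. \<exists>u\<in>verts G. \<exists>v\<in>verts G. endpoints G e = {u, v})"

text \<open>A subgraph carries the same total incidence function as the ambient graph, so a
  subgraph is determined by its vertex set and its edge set.\<close>

definition subgraph :: "('v, 'e) mgraph \<Rightarrow> ('v, 'e) mgraph \<Rightarrow> bool" where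
  "subgraph H G \<longleftrightarrow>
     multigraph H \<and> verts H \<subseteq> verts G \<and> edges H \<subseteq> edges G \<and> endpoints H = endpoints G"

definition del_edges :: "('v, 'e) mgraph \<Rightarrow> 'e set \<Rightarrow> ('v, 'e) mgraph" where
  "del_edges G F = G\<lparr>edges := edges G - F\<rparr>"

definition del_verts :: "('v, 'e) mgraph \<Rightarrow> 'v set \<Rightarrow> ('v, 'e) mgraph" where
  "del_verts G X =
     G\<lparr>verts := verts G - X, edges := {e \<in> edges G. endpoints G e \<inter> X = {}}\<rparr>"

definition path_between :: "('v, 'e) mgraph \<Rightarrow> 'v \<Rightarrow> 'v \<Rightarrow> bool" where
  "path_between P u v \<longleftrightarrow>
     (\<exists>vs es. vs \<noteq> [] \<and> distinct vs \<and> length vs = Suc (length es) \<and>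
        verts P = set vs \<and> edges P = set es \<and> hd vs = u \<and> last vs = v \<and>
        (\<forall>i<length es. endpoints P (es ! i) = {vs ! i, vs ! Suc i}))"

definition is_path :: "('v, 'e) mgraph \<Rightarrow> bool" where
  "is_path P \<longleftrightarrow> (\<exists>u v. path_between P u v)"

definition connected_graph :: "('v, 'e) mgraph \<Rightarrow> bool" where
  "connected_graph G \<longleftrightarrow>
     verts G \<noteq> {} \<and> (\<forall>u\<in>verts G. \<forall>v\<in>verts G. \<exists>P. subgraph P G \<and> path_between P u v)"

definition component :: "('v, 'e) mgraph \<Rightarrow> ('v, 'e) mgraph \<Rightarrow> bool" where
  "component K G \<longleftrightarrow>
     subgraph K G \<and> connected_graph K \<and>
     (\<forall>H. subgraph H G \<and> connected_graph H \<and> subgraph K H \<longrightarrow> H = K)"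

definition edge_boundary :: "('v, 'e) mgraph \<Rightarrow> 'v set \<Rightarrow> 'e set" where
  "edge_boundary G C = {e \<in> edges G. \<exists>u v. endpoints G e = {u, v} \<and> u \<in> C \<and> v \<notin> C}"

text \<open>Cardinality in \<open>\<nat> \<union> {\<infinity>}\<close>, not distinguishing between infinite cardinals.\<close>

definition ecard :: "'a set \<Rightarrow> enat" where
  "ecard A = (if finite A then enat (card A) else \<infinity>)"

section \<open>Rays and edge-ends\<close>

text \<open>A ray is a graph; \<open>x\<close> enumerates its vertices from its first vertex onwards.\<close>

definition ray_enum :: "('v, 'e) mgraph \<Rightarrow> (nat \<Rightarrow> 'v) \<Rightarrow> bool" where
  "ray_enum R x \<longleftrightarrow>
     inj x \<and> verts R = range x \<and>
     (\<exists>e. edges R = range e \<and> (\<forall>n. endpoints R (e n) = {x n, x (Suc n)}))"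

definition rays :: "('v, 'e) mgraph \<Rightarrow> ('v, 'e) mgraph set" where
  "rays G = {R. subgraph R G \<and> (\<exists>x. ray_enum R x)}"

definition tail_of :: "('v, 'e) mgraph \<Rightarrow> ('v, 'e) mgraph \<Rightarrow> bool" where
  "tail_of S R \<longleftrightarrow> subgraph S R \<and> connected_graph S \<and> infinite (verts S)"

definition edge_separates :: "('v, 'e) mgraph \<Rightarrow> 'e set \<Rightarrow> 'v set \<Rightarrow> 'v set \<Rightarrow> bool" where
  "edge_separates G F A B \<longleftrightarrow>
     \<not> (\<exists>P. subgraph P (del_edges G F) \<and> is_path P \<and>
            verts P \<inter> A \<noteq> {} \<and> verts P \<inter> B \<noteq> {})"

definition finitely_edge_separable :: "('v, 'e) mgraph \<Rightarrow> 'v set \<Rightarrow> 'v set \<Rightarrow> bool" where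
  "finitely_edge_separable G A B \<longleftrightarrow>
     (\<exists>F. finite F \<and> F \<subseteq> edges G \<and> edge_separates G F A B)"

definition edge_equiv :: "('v, 'e) mgraph \<Rightarrow> (('v, 'e) mgraph \<times> ('v, 'e) mgraph) set" where
  "edge_equiv G =
     {(R, S). R \<in> rays G \<and> S \<in> rays G \<and>
        \<not> (\<exists>R' S'. tail_of R' R \<and> tail_of S' S \<and>
              finitely_edge_separable G (verts R') (verts S'))}"

definition edge_ends :: "('v, 'e) mgraph \<Rightarrow> ('v, 'e) mgraph set set" where
  "edge_ends G = rays G // edge_equiv G"

definition edge_dominates_ray :: "('v, 'e) mgraph \<Rightarrow> 'v \<Rightarrow> ('v, 'e) mgraph \<Rightarrow> bool" where
  "edge_dominates_ray G v R \<longleftrightarrow>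
     \<not> (\<exists>R'. tail_of R' R \<and> finitely_edge_separable G {v} (verts R'))"

definition edge_dominates :: "('v, 'e) mgraph \<Rightarrow> 'v \<Rightarrow> ('v, 'e) mgraph set \<Rightarrow> bool" where
  "edge_dominates G v \<omega> \<longleftrightarrow> v \<in> verts G \<and> (\<exists>R\<in>\<omega>. edge_dominates_ray G v R)"

definition undominated_edge_ends :: "('v, 'e) mgraph \<Rightarrow> ('v, 'e) mgraph set set" where
  "undominated_edge_ends G = {\<omega> \<in> edge_ends G. \<not> (\<exists>v. edge_dominates G v \<omega>)}"

definition lives_in :: "('v, 'e) mgraph set \<Rightarrow> 'v set \<Rightarrow> bool" where
  "lives_in \<omega> C \<longleftrightarrow> (\<forall>R\<in>\<omega>. \<exists>R'. tail_of R' R \<and> verts R' \<subseteq> C)"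

definition edge_degree :: "('v, 'e) mgraph set \<Rightarrow> enat" where
  "edge_degree \<omega> =
     Sup {ecard \<R> |\<R>. \<R> \<subseteq> \<omega> \<and> pairwise (\<lambda>R S. disjnt (edges R) (edges S)) \<R>}"

section \<open>Trees and their ends\<close>

text \<open>The case \<open>length vs = 1\<close> is a loop, the case \<open>length vs = 2\<close> a pair of parallel
  edges.\<close>

definition is_cycle :: "('v, 'e) mgraph \<Rightarrow> bool" where
  "is_cycle Z \<longleftrightarrow>
     (\<exists>vs es. vs \<noteq> [] \<and> distinct vs \<and> distinct es \<and> length es = length vs \<and>
        verts Z = set vs \<and> edges Z = set es \<and>
        (\<forall>i<length es. endpoints Z (es ! i) = {vs ! i, vs ! (Suc i mod length vs)}))"

definition tree :: "('t, 'f) mgraph \<Rightarrow> bool" where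
  "tree T \<longleftrightarrow> multigraph T \<and> connected_graph T \<and> \<not> (\<exists>Z. subgraph Z T \<and> is_cycle Z)"

text \<open>The (vertex-)ends of a graph: two rays are equivalent if no finite set of
  vertices separates them.\<close>

definition vertex_equiv :: "('v, 'e) mgraph \<Rightarrow> (('v, 'e) mgraph \<times> ('v, 'e) mgraph) set" where
  "vertex_equiv G =
     {(R, S). R \<in> rays G \<and> S \<in> rays G \<and>
        (\<forall>X. finite X \<and> X \<subseteq> verts G \<longrightarrow>
           (\<exists>R' S' K. tail_of R' R \<and> tail_of S' S \<and> component K (del_verts G X) \<and>
              subgraph R' K \<and> subgraph S' K))}"

definition graph_ends :: "('v, 'e) mgraph \<Rightarrow> ('v, 'e) mgraph set set" where
  "graph_ends G = rays G // vertex_equiv G"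

definition tree_le :: "('t, 'f) mgraph \<Rightarrow> 't \<Rightarrow> 't \<Rightarrow> 't \<Rightarrow> bool" where
  "tree_le T r s t \<longleftrightarrow> (\<exists>P. subgraph P T \<and> path_between P r t \<and> s \<in> verts P)"

section \<open>Tree-cut decompositions\<close>

text \<open>\<open>T\<close> is the tree, \<open>r\<close> its root and \<open>V t\<close> the part at the node \<open>t\<close>.\<close>

definition rooted_tree_cut_decomposition ::
  "('v, 'e) mgraph \<Rightarrow> ('t, 'f) mgraph \<Rightarrow> 't \<Rightarrow> ('t \<Rightarrow> 'v set) \<Rightarrow> bool" where
  "rooted_tree_cut_decomposition G T r V \<longleftrightarrow>
     tree T \<and> r \<in> verts T \<and>
     (\<forall>s\<in>verts T. \<forall>t\<in>verts T. s \<noteq> t \<longrightarrow> V s \<inter> V t = {}) \<and>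
     (\<Union>t\<in>verts T. V t) = verts G"

definition part_above :: "('t, 'f) mgraph \<Rightarrow> 't \<Rightarrow> ('t \<Rightarrow> 'v set) \<Rightarrow> 't \<Rightarrow> 'v set" where
  "part_above T r V t = (\<Union>s\<in>{s \<in> verts T. tree_le T r t s}. V s)"

definition adhesion_set ::
  "('v, 'e) mgraph \<Rightarrow> ('t, 'f) mgraph \<Rightarrow> ('t \<Rightarrow> 'v set) \<Rightarrow> 'f \<Rightarrow> 'e set" where
  "adhesion_set G T V e =
     {f \<in> edges G. \<exists>T\<^sub>1 T\<^sub>2 u v.
        component T\<^sub>1 (del_edges T {e}) \<and> component T\<^sub>2 (del_edges T {e}) \<and> T\<^sub>1 \<noteq> T\<^sub>2 \<and>
        endpoints G f = {u, v} \<and> u \<in> (\<Union>t\<in>verts T\<^sub>1. V t) \<and> v \<in> (\<Union>t\<in>verts T\<^sub>2. V t)}"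

definition finite_adhesion ::
  "('v, 'e) mgraph \<Rightarrow> ('t, 'f) mgraph \<Rightarrow> ('t \<Rightarrow> 'v set) \<Rightarrow> bool" where
  "finite_adhesion G T V \<longleftrightarrow> (\<forall>e\<in>edges T. finite (adhesion_set G T V e))"

text \<open>\<open>\<omega>\<close> orients the edge \<open>e\<close> of \<open>T\<close> towards the component \<open>K\<close> of \<open>T - e\<close>.\<close>

definition orients_towards ::
  "('t, 'f) mgraph \<Rightarrow> ('t \<Rightarrow> 'v set) \<Rightarrow> ('v, 'e) mgraph set \<Rightarrow> 'f \<Rightarrow> ('t, 'f) mgraph \<Rightarrow> bool"
where
  "orients_towards T V \<omega> e K \<longleftrightarrow>
     component K (del_edges T {e}) \<and> lives_in \<omega> (\<Union>t\<in>verts K. V t)"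

definition points_to_node ::
  "('t, 'f) mgraph \<Rightarrow> ('t \<Rightarrow> 'v set) \<Rightarrow> ('v, 'e) mgraph set \<Rightarrow> 't \<Rightarrow> bool" where
  "points_to_node T V \<omega> t \<longleftrightarrow>
     t \<in> verts T \<and> (\<forall>e\<in>edges T. \<exists>K. orients_towards T V \<omega> e K \<and> t \<in> verts K)"

definition points_to_end ::
  "('t, 'f) mgraph \<Rightarrow> ('t \<Rightarrow> 'v set) \<Rightarrow> ('v, 'e) mgraph set \<Rightarrow> ('t, 'f) mgraph set \<Rightarrow> bool"
where
  "points_to_end T V \<omega> \<eta> \<longleftrightarrow>
     \<eta> \<in> graph_ends T \<and> (\<forall>e\<in>edges T. \<exists>K. orients_towards T V \<omega> e K \<and> lives_in \<eta> (verts K))"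

text \<open>The map \<open>\<phi>\<close> into the disjoint union of the nodes (\<open>Inl\<close>) and the ends (\<open>Inr\<close>)
  of \<open>T\<close>; the description is a proper one whenever the adhesion is finite.\<close>

definition phi ::
  "('t, 'f) mgraph \<Rightarrow> ('t \<Rightarrow> 'v set) \<Rightarrow> ('v, 'e) mgraph set \<Rightarrow> 't + ('t, 'f) mgraph set" where
  "phi T V \<omega> =
     (THE z. case z of Inl t \<Rightarrow> points_to_node T V \<omega> t | Inr \<eta> \<Rightarrow> points_to_end T V \<omega> \<eta>)"

definition displays ::
  "('v, 'e) mgraph \<Rightarrow> ('t, 'f) mgraph \<Rightarrow> ('t \<Rightarrow> 'v set) \<Rightarrow> ('v, 'e) mgraph set set \<Rightarrow> bool" where
  "displays G T V \<Psi> \<longleftrightarrow>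
     {\<omega> \<in> edge_ends G. phi T V \<omega> \<in> Inr ` graph_ends T} = \<Psi> \<and>
     bij_betw (phi T V) \<Psi> (Inr ` graph_ends T)"

text \<open>The existence of a decomposition needs a fixed type of nodes.  Nodes are
  taken from \<open>'v set list\<close>, which is no restriction: in a decomposition displaying some set of
  edge-ends one may delete every node \<open>t\<close> with \<open>part_above T r V t = {}\<close> (except the root), as no
  edge-end points to it and no displayed edge-end's ray in \<open>T\<close> passes through it, and what remains
  is a union of finite paths from the root, one for each vertex of \<open>G\<close>.  Edges of a tree are
  determined by their endpoints, so node sets suffice as edges.\<close>

type_synonym 'v decomposition_tree = "('v set list, 'v set list set) mgraph"

end

theory Submission
  imports Defs "HOL-Library.Disjoint_Sets"
begin

text \<open>
  An edge-end behaves like an ultrafilter on the finite cuts \<open>C\<close> (the vertex sets with finite boundary).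
  A decomposition as required is the same as a laminar family of connected finite cuts in which every
  vertex lies in only finitely many members and every undominated edge-end lives in infinitely many:
  edge-ends that live in infinitely many members of a chain then coincide because the members are
  connected, and connectedness also provides an edge-end for every descending chain.

  All edge-ends in a set \<open>D\<close> that are separated by exactly \<open>d\<close> but not fewer edges from the complement
  of \<open>D\<close> are covered by disjoint cuts of size \<open>d\<close>: submodularity makes the largest such cut around an
  end unique, and posimodularity allows to trim crossing cuts. Adding these layers for
  \<open>d = 0, 1, 2, \<dots>\<close> yields a laminar family covering everything that can be separated from the complement
  of \<open>D\<close>, though a vertex may lie in infinitely many of its members. Every increasing sequence
  \<open>U 0 \<subseteq> U 1 \<subseteq> \<dots>\<close> of finite cuts may however be replaced by the differences \<open>U n - U (n - 1)\<close>, which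
  turns the laminar family into a disjoint one. Iterating this inside the cuts that avoid the ball of
  radius \<open>n\<close> around a set of roots reaches every undominated edge-end infinitely often. The first \<open>n\<close>
  layers are retained at the \<open>n\<close>-th step and make the boundaries small for edge-ends of finite degree.

  If every cut around an end in \<open>D\<close> has at least \<open>m\<close> edges, then finite flows of value \<open>m\<close> between
  successive minimum cuts combine to \<open>m\<close> edge-disjoint rays; hence the boundaries cannot exceed the
  edge-degree along the chain, while each family of \<open>m\<close> edge-disjoint rays crosses all late cuts.
\<close>

section \<open>Connectedness\<close>

text \<open>The disjoint covers obtained from differences \<open>U n - U (n - 1)\<close> would
  suffice to display the undominated ends, but such a difference can have a much larger boundary
  than a minimum cut around an end in it, so they say nothing about degrees. The layers do consist
  of minimum cuts, but point-finiteness is guaranteed only for finitely many of them together. Hence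
  both kinds of sets enter the family: the covers move it away from every vertex, and finitely many
  layers per stage supply the small boundaries. This is consistent because minimality is relative to
  the surrounding set \<open>D\<close>: shrinking \<open>D\<close> leaves fewer competing cuts, so a
  retained minimum cut stays one.

  Balls replace an enumeration of the vertices, since \<open>G\<close> may be uncountable. A ball
  can be infinite, yet an undominated end has a cut that avoids it: if a cut \<open>C\<close> misses
  the ball of radius \<open>n\<close>, its vertices in the next ball are end vertices of the
  finitely many edges of its boundary, and finitely many vertices can always be avoided.\<close>

definition adj :: "('v, 'e) mgraph \<Rightarrow> ('v \<times> 'v) set" where
  "adj H = {(u, v). \<exists>e\<in>edges H. endpoints H e = {u, v}}"

definition conn :: "('v, 'e) mgraph \<Rightarrow> 'v set \<Rightarrow> bool" where
  "conn H C \<longleftrightarrow> C \<noteq> {} \<and> (\<forall>u\<in>C. \<forall>v\<in>C. (u, v) \<in> (adj H \<inter> C \<times> C)\<^sup>*)"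

text \<open>For \<open>v\<close> outside \<open>C\<close> this is \<open>{v}\<close>, hence the
  assumption \<open>v \<in> C\<close> in lemmas such as \<open>comp_in_subset\<close>.\<close>

definition comp_in :: "('v, 'e) mgraph \<Rightarrow> 'v set \<Rightarrow> 'v \<Rightarrow> 'v set" where
  "comp_in H C v = {w. (v, w) \<in> (adj H \<inter> C \<times> C)\<^sup>*}"

text \<open>The incidence function stays unrestricted because \<open>subgraph\<close> demands
  equality of \<open>endpoints\<close>.\<close>

definition induced :: "('v, 'e) mgraph \<Rightarrow> 'v set \<Rightarrow> ('v, 'e) mgraph" where
  "induced H C = \<lparr>verts = C, edges = {e \<in> edges H. endpoints H e \<subseteq> C}, endpoints = endpoints H\<rparr>"

lemma induced_simps [simp]:
  "verts (induced H C) = C" "edges (induced H C) = {e \<in> edges H. endpoints H e \<subseteq> C}"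
  "endpoints (induced H C) = endpoints H"
  by (simp_all add: induced_def)

lemma adj_sym: "(u, v) \<in> adj H \<Longrightarrow> (v, u) \<in> adj H"
  by (auto simp: adj_def insert_commute)

lemma sym_adj_on: "sym (adj H \<inter> C \<times> C)"
  by (auto intro!: symI dest: adj_sym)

lemma adj_reach_sym: "(u, v) \<in> (adj H \<inter> C \<times> C)\<^sup>* \<Longrightarrow> (v, u) \<in> (adj H \<inter> C \<times> C)\<^sup>*"
  by (rule symD[OF sym_rtrancl[OF sym_adj_on]])

lemma reach_in: "(u, v) \<in> (adj H \<inter> C \<times> C)\<^sup>* \<Longrightarrow> u \<in> C \<Longrightarrow> v \<in> C"
  by (induction rule: rtrancl_induct) auto

lemma adj_verts: "multigraph H \<Longrightarrow> (u, v) \<in> adj H \<Longrightarrow> u \<in> verts H \<and> v \<in> verts H"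
  unfolding adj_def multigraph_def by (fastforce simp: doubleton_eq_iff)

lemma adj_verts_Int: "multigraph H \<Longrightarrow> adj H \<inter> verts H \<times> verts H = adj H"
  by (auto dest: adj_verts)

lemma endpoints_in: "multigraph H \<Longrightarrow> e \<in> edges H \<Longrightarrow> endpoints H e \<subseteq> verts H"
  unfolding multigraph_def by fastforce

lemma comp_in_subset: "v \<in> C \<Longrightarrow> comp_in H C v \<subseteq> C"
  using reach_in by (fastforce simp: comp_in_def)

lemma comp_in_self [simp]: "v \<in> comp_in H C v"
  by (simp add: comp_in_def)

lemma comp_in_eq:
  assumes "w \<in> comp_in H C v" shows "comp_in H C w = comp_in H C v"
proof -
  let ?r = "adj H \<inter> C \<times> C"
  have "(v, w) \<in> ?r\<^sup>*" "(w, v) \<in> ?r\<^sup>*" using assms adj_reach_sym by (auto simp: comp_in_def)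
  then have "(w, x) \<in> ?r\<^sup>* \<longleftrightarrow> (v, x) \<in> ?r\<^sup>*" for x using rtrancl_trans[of _ _ ?r] by blast
  then show ?thesis by (simp add: comp_in_def)
qed

lemma comp_in_disjoint:
  "comp_in H C v = comp_in H C w \<or> comp_in H C v \<inter> comp_in H C w = {}"
  using comp_in_eq[of _ H C v] comp_in_eq[of _ H C w] by (metis disjoint_iff)

lemma comp_in_closed:
  "u \<in> comp_in H C v \<Longrightarrow> (u, w) \<in> adj H \<Longrightarrow> u \<in> C \<Longrightarrow> w \<in> C \<Longrightarrow> w \<in> comp_in H C v"
  unfolding comp_in_def by (auto intro: rtrancl_into_rtrancl)

lemma reach_mono:
  "(u, v) \<in> (adj H \<inter> C \<times> C)\<^sup>* \<Longrightarrow> C \<subseteq> D \<Longrightarrow> (u, v) \<in> (adj H \<inter> D \<times> D)\<^sup>*"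
  using rtrancl_mono[of "adj H \<inter> C \<times> C" "adj H \<inter> D \<times> D"] by blast

lemma conn_comp_in:
  assumes "v \<in> C" shows "conn H (comp_in H C v)"
proof -
  let ?K = "comp_in H C v"
  have *: "(v, u) \<in> (adj H \<inter> ?K \<times> ?K)\<^sup>*" if "u \<in> ?K" for u
  proof -
    from that have "(v, u) \<in> (adj H \<inter> C \<times> C)\<^sup>*" by (simp add: comp_in_def)
    then show ?thesis
    proof (induction rule: rtrancl_induct)
      case (step y z)
      have "y \<in> ?K" "z \<in> ?K" using step by (auto simp: comp_in_def intro: rtrancl_into_rtrancl)
      with step show ?case by (auto intro: rtrancl_into_rtrancl)
    qed simp
  qed
  have "(u, w) \<in> (adj H \<inter> ?K \<times> ?K)\<^sup>*" if "u \<in> ?K" "w \<in> ?K" for u w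
    using rtrancl_trans[OF adj_reach_sym[OF *[OF that(1)]] *[OF that(2)]] .
  moreover have "?K \<noteq> {}" using comp_in_self[of v H C] by (metis empty_iff)
  ultimately show ?thesis by (simp add: conn_def)
qed

lemma conn_subset_comp_in:
  assumes "conn H D" "D \<subseteq> C" "v \<in> D" shows "D \<subseteq> comp_in H C v"
proof
  fix w assume "w \<in> D"
  then have "(v, w) \<in> (adj H \<inter> D \<times> D)\<^sup>*" using assms by (simp add: conn_def)
  from reach_mono[OF this assms(2)] show "w \<in> comp_in H C v" by (simp add: comp_in_def)
qed

lemma conn_comp_in_cases:
  assumes "conn H D" "D \<subseteq> C" "v \<in> C"
  shows "D \<subseteq> comp_in H C v \<or> D \<inter> comp_in H C v = {}"
  using assms conn_subset_comp_in comp_in_eq by (metis disjoint_iff)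

lemma reach_crosses:
  assumes "(u, v) \<in> r\<^sup>*" "u \<in> B" "v \<notin> B"
  shows "\<exists>a b. (a, b) \<in> r \<and> a \<in> B \<and> b \<notin> B"
  using assms by (induction rule: rtrancl_induct) auto

lemma conn_crosses:
  assumes "conn H Z" "Z \<inter> B \<noteq> {}" "\<not> Z \<subseteq> B"
  shows "\<exists>a b. (a, b) \<in> adj H \<and> a \<in> Z \<and> b \<in> Z \<and> a \<in> B \<and> b \<notin> B"
proof -
  obtain u v where "u \<in> Z" "u \<in> B" "v \<in> Z" "v \<notin> B" using assms by blast
  then have "(u, v) \<in> (adj H \<inter> Z \<times> Z)\<^sup>*" using assms(1) by (auto simp: conn_def)
  from reach_crosses[OF this \<open>u \<in> B\<close> \<open>v \<notin> B\<close>] show ?thesis by blast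
qed

subsection \<open>Paths, connected subgraphs and components\<close>

lemma path_nth_reach:
  assumes "length vs = Suc (length es)" "\<forall>i<length es. endpoints P (es ! i) = {vs ! i, vs ! Suc i}"
    "edges P = set es" "i < length vs"
  shows "(vs ! 0, vs ! i) \<in> (adj P)\<^sup>*"
  using assms(4)
proof (induction i)
  case (Suc i)
  then have "i < length es" using assms by simp
  then have "(vs ! i, vs ! Suc i) \<in> adj P" using assms nth_mem unfolding adj_def by blast
  with Suc show ?case by (auto intro: rtrancl_into_rtrancl)
qed simp

lemma path_reach:
  assumes "path_between P u v" "w \<in> verts P"
  shows "(u, w) \<in> (adj P)\<^sup>*" "u \<in> verts P" "v \<in> verts P"
proof -
  from assms obtain vs es where p: "vs \<noteq> []" "length vs = Suc (length es)" "verts P = set vs"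
    "edges P = set es" "hd vs = u" "last vs = v" "\<forall>i<length es. endpoints P (es ! i) = {vs ! i, vs ! Suc i}"
    unfolding path_between_def by blast
  obtain i where i: "i < length vs" "w = vs ! i" using assms(2) p by (auto simp: in_set_conv_nth)
  show "(u, w) \<in> (adj P)\<^sup>*" using path_nth_reach[of vs es P i] p i by (auto simp: hd_conv_nth)
  show "u \<in> verts P" "v \<in> verts P" using p by auto
qed

lemma subgraph_adj: "subgraph P H \<Longrightarrow> adj P \<subseteq> adj H"
  unfolding subgraph_def adj_def by auto

lemma path_in_subgraph_reach:
  assumes "path_between P u v" "subgraph P H" "w \<in> verts P"
  shows "(u, w) \<in> (adj H)\<^sup>*"
  using path_reach(1)[OF assms(1,3)] rtrancl_mono[OF subgraph_adj[OF assms(2)]] by blast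

text \<open>A walk is turned into a path while it is being built: if the next vertex
  \<open>z\<close> already occurs, the path is cut back to that occurrence, otherwise it is extended
  by one edge.\<close>

lemma path_list_of_reach:
  assumes "(u, v) \<in> (adj H)\<^sup>*"
  shows "\<exists>vs es. vs \<noteq> [] \<and> distinct vs \<and> length vs = Suc (length es) \<and> hd vs = u \<and> last vs = v \<and>
     set es \<subseteq> edges H \<and> (\<forall>i<length es. endpoints H (es ! i) = {vs ! i, vs ! Suc i})"
  using assms
proof (induction rule: rtrancl_induct)
  case base
  show ?case by (rule exI[of _ "[u]"], rule exI[of _ "[]"]) simp
next
  case (step y z)
  then obtain vs es where p: "vs \<noteq> []" "distinct vs" "length vs = Suc (length es)" "hd vs = u" "last vs = y"
    "set es \<subseteq> edges H" "\<forall>i<length es. endpoints H (es ! i) = {vs ! i, vs ! Suc i}" by blast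
  obtain e where e: "e \<in> edges H" "endpoints H e = {y, z}" using step(2) by (auto simp: adj_def)
  show ?case
  proof (cases "z \<in> set vs")
    case True
    then obtain k where k: "k < length vs" "vs ! k = z" by (auto simp: in_set_conv_nth)
    have l: "last (take (Suc k) vs) = z" using k by (simp add: take_Suc_conv_app_nth)
    show ?thesis
      by (rule exI[of _ "take (Suc k) vs"], rule exI[of _ "take k es"])
        (use p k l set_take_subset[of k es] in \<open>auto simp: hd_take\<close>)
  next
    case False
    show ?thesis
    proof (rule exI[of _ "vs @ [z]"], rule exI[of _ "es @ [e]"], intro conjI allI impI)
      fix i assume "i < length (es @ [e])"
      then consider "i < length es" | "i = length es" by fastforce
      then show "endpoints H ((es @ [e]) ! i) = {(vs @ [z]) ! i, (vs @ [z]) ! Suc i}"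
      proof cases
        case 2
        have "vs ! length es = y" using p by (simp add: last_conv_nth)
        then show ?thesis using 2 p e by (simp add: nth_append)
      qed (use p in \<open>simp add: nth_append\<close>)
    qed (use p e False in auto)
  qed
qed

lemma reach_path:
  assumes "multigraph H" "(u, v) \<in> (adj H)\<^sup>*" "u \<in> verts H"
  shows "\<exists>P. subgraph P H \<and> path_between P u v"
proof -
  obtain vs es where p: "vs \<noteq> []" "distinct vs" "length vs = Suc (length es)" "hd vs = u" "last vs = v"
    "set es \<subseteq> edges H" "\<forall>i<length es. endpoints H (es ! i) = {vs ! i, vs ! Suc i}"
    using path_list_of_reach[OF assms(2)] by blast
  let ?P = "\<lparr>verts = set vs, edges = set es, endpoints = endpoints H\<rparr>"
  have "set vs \<subseteq> verts H"
  proof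
    fix w assume "w \<in> set vs"
    then obtain i where i: "i < length vs" "w = vs ! i" by (auto simp: in_set_conv_nth)
    have "(vs ! 0, vs ! i) \<in> (adj ?P)\<^sup>*" using path_nth_reach[of vs es ?P i] p i by auto
    moreover have "adj ?P \<subseteq> adj H" using p by (auto simp: adj_def)
    ultimately have "(u, w) \<in> (adj H)\<^sup>*" using rtrancl_mono[of "adj ?P" "adj H"] p i by (auto simp: hd_conv_nth)
    then show "w \<in> verts H" using assms by (induction rule: rtrancl_induct) (auto dest: adj_verts)
  qed
  moreover have "multigraph ?P" unfolding multigraph_def
  proof
    fix e assume "e \<in> edges ?P"
    then obtain i where i: "i < length es" "e = es ! i" by (auto simp: in_set_conv_nth)
    then have "vs ! i \<in> set vs" "vs ! Suc i \<in> set vs" using p(3) by simp_all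
    moreover have "endpoints ?P e = {vs ! i, vs ! Suc i}" using i p(7) by simp
    ultimately show "\<exists>a\<in>verts ?P. \<exists>b\<in>verts ?P. endpoints ?P e = {a, b}" by auto
  qed
  ultimately have "subgraph ?P H" using p unfolding subgraph_def by auto
  moreover have "path_between ?P u v" unfolding path_between_def using p by auto
  ultimately show ?thesis by blast
qed

lemma connected_graph_iff:
  assumes "multigraph H"
  shows "connected_graph H \<longleftrightarrow> conn H (verts H)"
proof -
  have "(u, v) \<in> (adj H)\<^sup>* \<longleftrightarrow> (\<exists>P. subgraph P H \<and> path_between P u v)" if "u \<in> verts H" for u v
    using reach_path[OF assms _ that] path_in_subgraph_reach path_reach
    by (metis path_between_def empty_iff last_in_set)
  then show ?thesis unfolding connected_graph_def conn_def adj_verts_Int[OF assms] by auto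
qed

lemma multigraph_induced: "multigraph H \<Longrightarrow> multigraph (induced H C)"
  unfolding multigraph_def by (simp; fastforce)

lemma subgraph_induced: "multigraph H \<Longrightarrow> C \<subseteq> verts H \<Longrightarrow> subgraph (induced H C) H"
  using multigraph_induced by (auto simp: subgraph_def)

lemma adj_induced: "adj (induced H C) = adj H \<inter> C \<times> C"
  by (auto simp: adj_def)

lemma conn_induced: "conn (induced H C) C \<longleftrightarrow> conn H C"
  by (simp add: conn_def adj_induced)

lemma connected_graph_induced:
  "multigraph H \<Longrightarrow> connected_graph (induced H C) \<longleftrightarrow> conn H C"
  by (simp add: connected_graph_iff multigraph_induced conn_induced)

lemma subgraph_of_induced:
  "multigraph H \<Longrightarrow> subgraph K H \<Longrightarrow> verts K \<subseteq> C \<Longrightarrow> subgraph K (induced H C)"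
  unfolding subgraph_def using endpoints_in[of K] by fastforce

lemma subgraph_trans: "subgraph A B \<Longrightarrow> subgraph B C \<Longrightarrow> subgraph A C"
  unfolding subgraph_def by auto

lemma conn_subgraph:
  assumes "subgraph K H" "connected_graph K" shows "conn H (verts K)"
proof -
  have K: "multigraph K" using assms by (simp add: subgraph_def)
  have "adj K \<inter> verts K \<times> verts K \<subseteq> adj H \<inter> verts K \<times> verts K" using subgraph_adj[OF assms(1)] by blast
  then show ?thesis using assms(2) rtrancl_mono unfolding connected_graph_iff[OF K] conn_def by blast
qed

text \<open>A connected subgraph lies in one reachability class, hence in the subgraph induced on
  that class, and this induced subgraph is itself connected. So these are exactly the maximal
  connected subgraphs, with respect to vertices and edges at once.\<close>

lemma component_iff:
  assumes H: "multigraph H"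
  shows "component K H \<longleftrightarrow> (\<exists>v\<in>verts H. K = induced H (comp_in H (verts H) v))"
proof
  assume c: "component K H"
  then have K: "subgraph K H" "connected_graph K" by (auto simp: component_def)
  then obtain v where v: "v \<in> verts K" by (auto simp: connected_graph_def)
  let ?C = "comp_in H (verts H) v"
  have vH: "v \<in> verts H" "verts K \<subseteq> verts H" using v K unfolding subgraph_def by blast+
  have sub: "verts K \<subseteq> ?C" by (rule conn_subset_comp_in[OF conn_subgraph[OF K] vH(2) v])
  have "subgraph (induced H ?C) H" by (rule subgraph_induced[OF H comp_in_subset[OF vH(1)]])
  moreover have "connected_graph (induced H ?C)" using connected_graph_induced[OF H] conn_comp_in[OF vH(1)] by simp
  moreover have "subgraph K (induced H ?C)" by (rule subgraph_of_induced[OF H K(1) sub])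
  ultimately have "induced H ?C = K" using c unfolding component_def by blast
  then show "\<exists>v\<in>verts H. K = induced H (comp_in H (verts H) v)" using vH by blast
next
  assume "\<exists>v\<in>verts H. K = induced H (comp_in H (verts H) v)"
  then obtain v where v: "v \<in> verts H" "K = induced H (comp_in H (verts H) v)" by blast
  let ?C = "comp_in H (verts H) v"
  have C: "?C \<subseteq> verts H" using comp_in_subset v by fast
  show "component K H" unfolding component_def
  proof (intro conjI allI impI)
    show "subgraph K H" using v subgraph_induced[OF H C] by simp
    show "connected_graph K" using v connected_graph_induced[OF H] conn_comp_in[OF v(1)] by simp
    fix L assume L: "subgraph L H \<and> connected_graph L \<and> subgraph K L"
    then have 1: "verts L \<subseteq> verts H" "v \<in> verts L" using v by (auto simp: subgraph_def)
    have "verts L \<subseteq> ?C" using conn_subset_comp_in[OF conn_subgraph 1] L by blast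
    then have "subgraph L K" using subgraph_of_induced[OF H] L v by blast
    then show "L = K" using L unfolding subgraph_def by (auto intro!: mgraph.equality)
  qed
qed

section \<open>Finite cuts\<close>

locale multi_graph =
  fixes G :: "('v, 'e) mgraph"
  assumes multigraph_G: "multigraph G"
begin

abbreviation bd :: "'v set \<Rightarrow> 'e set" where "bd \<equiv> edge_boundary G"

definition cut :: "'v set \<Rightarrow> bool" where
  "cut C \<longleftrightarrow> C \<subseteq> verts G \<and> finite (bd C)"

lemma edge_obtain:
  assumes "e \<in> edges G"
  obtains a b where "endpoints G e = {a, b}" "a \<in> verts G" "b \<in> verts G"
  using assms multigraph_G unfolding multigraph_def by blast

lemma bd_iff: "e \<in> edges G \<Longrightarrow> endpoints G e = {a, b} \<Longrightarrow> e \<in> bd C \<longleftrightarrow> (a \<in> C) \<noteq> (b \<in> C)"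
  unfolding edge_boundary_def by (auto simp: doubleton_eq_iff)

lemma bd_edges: "e \<in> bd C \<Longrightarrow> e \<in> edges G"
  by (simp add: edge_boundary_def)

lemma bd_Un: "bd (A \<union> B) \<subseteq> bd A \<union> bd B" and bd_Int: "bd (A \<inter> B) \<subseteq> bd A \<union> bd B"
  and bd_Diff: "bd (A - B) \<subseteq> bd A \<union> bd B"
proof -
  have "e \<in> bd A \<union> bd B" if e: "e \<in> bd (A \<union> B) \<union> bd (A \<inter> B) \<union> bd (A - B)" for e
  proof -
    have E: "e \<in> edges G" using e bd_edges by blast
    then obtain a b where "endpoints G e = {a, b}" using edge_obtain by blast
    with e E show ?thesis by (auto simp: bd_iff)
  qed
  then show "bd (A \<union> B) \<subseteq> bd A \<union> bd B" "bd (A \<inter> B) \<subseteq> bd A \<union> bd B" "bd (A - B) \<subseteq> bd A \<union> bd B"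
    by blast+
qed

lemma bd_empty [simp]: "bd {} = {}"
  by (auto simp: edge_boundary_def)

lemma bd_verts [simp]: "bd (verts G) = {}"
proof -
  have "e \<notin> bd (verts G)" for e
    by (metis bd_edges bd_iff edge_obtain)
  then show ?thesis by blast
qed

lemma bd_compl [simp]: "bd (verts G - C) = bd C"
proof -
  have "e \<in> bd (verts G - C) \<longleftrightarrow> e \<in> bd C" for e
  proof (cases "e \<in> edges G")
    case True
    then obtain a b where "endpoints G e = {a, b}" "a \<in> verts G" "b \<in> verts G" using edge_obtain by blast
    with True show ?thesis by (auto simp: bd_iff)
  qed (auto dest: bd_edges)
  then show ?thesis by blast
qed

lemma cut_Un: "cut A \<Longrightarrow> cut B \<Longrightarrow> cut (A \<union> B)"
  and cut_Int: "cut A \<Longrightarrow> cut B \<Longrightarrow> cut (A \<inter> B)"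
  and cut_Diff: "cut A \<Longrightarrow> cut B \<Longrightarrow> cut (A - B)"
  using finite_subset[OF bd_Un] finite_subset[OF bd_Int] finite_subset[OF bd_Diff]
  unfolding cut_def by (blast intro: finite_UnI)+

lemma cut_empty [simp]: "cut {}" and cut_verts [simp]: "cut (verts G)"
  by (simp_all add: cut_def)

lemma cut_subset: "cut C \<Longrightarrow> C \<subseteq> verts G" and cut_finite: "cut C \<Longrightarrow> finite (bd C)"
  by (simp_all add: cut_def)

lemma cut_Union: "finite X \<Longrightarrow> (\<And>A. A \<in> X \<Longrightarrow> cut A) \<Longrightarrow> cut (\<Union>X)"
  by (induction X rule: finite_induct) (auto intro: cut_Un)

text \<open>Counting with multiplicity: an element counted on the left lies in \<open>A\<close> or
  \<open>B\<close>, and one counted twice lies in both.\<close>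

lemma card_mod_aux:
  assumes "finite A" "finite B" "X \<union> Y \<subseteq> A \<union> B" "X \<inter> Y \<subseteq> A \<inter> B"
  shows "card X + card Y \<le> card A + card B"
proof -
  have "finite (A \<union> B)" "finite X" "finite Y" using assms by (auto intro: finite_subset)
  then show ?thesis
    using card_Un_Int[of X Y] card_Un_Int[OF assms(1,2)] card_mono[OF _ assms(3)] card_mono[OF _ assms(4)] assms
    by (metis add_mono finite_Int)
qed

text \<open>An edge in both boundaries on the left joins \<open>A \<inter> B\<close> to the
  complement of \<open>A \<union> B\<close> and is therefore in both boundaries on the
  right.\<close>

lemma submodular:
  assumes "finite (bd A)" "finite (bd B)"
  shows "card (bd (A \<inter> B)) + card (bd (A \<union> B)) \<le> card (bd A) + card (bd B)"
proof (rule card_mod_aux[OF assms])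
  show "bd (A \<inter> B) \<union> bd (A \<union> B) \<subseteq> bd A \<union> bd B" using bd_Un bd_Int by blast
  show "bd (A \<inter> B) \<inter> bd (A \<union> B) \<subseteq> bd A \<inter> bd B"
  proof
    fix e assume e: "e \<in> bd (A \<inter> B) \<inter> bd (A \<union> B)"
    then have E: "e \<in> edges G" using bd_edges by blast
    then obtain a b where "endpoints G e = {a, b}" using edge_obtain by blast
    with e E show "e \<in> bd A \<inter> bd B" by (auto simp: bd_iff)
  qed
qed

text \<open>An edge in both boundaries on the left joins \<open>A - B\<close> to
  \<open>B - A\<close> and so crosses both \<open>A\<close> and \<open>B\<close>.\<close>

lemma posimodular:
  assumes "finite (bd A)" "finite (bd B)"
  shows "card (bd (A - B)) + card (bd (B - A)) \<le> card (bd A) + card (bd B)"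
proof (rule card_mod_aux[OF assms])
  show "bd (A - B) \<union> bd (B - A) \<subseteq> bd A \<union> bd B" using bd_Diff by blast
  show "bd (A - B) \<inter> bd (B - A) \<subseteq> bd A \<inter> bd B"
  proof
    fix e assume e: "e \<in> bd (A - B) \<inter> bd (B - A)"
    then have E: "e \<in> edges G" using bd_edges by blast
    then obtain a b where "endpoints G e = {a, b}" using edge_obtain by blast
    with e E show "e \<in> bd A \<inter> bd B" by (auto simp: bd_iff)
  qed
qed

text \<open>No edge leaves a component of \<open>C\<close> inside \<open>C\<close>. Passing to a
  component thus adds no boundary edges, which makes connectedness available at no cost when a cut
  is chosen.\<close>

lemma bd_comp_in: assumes "v \<in> C" shows "bd (comp_in G C v) \<subseteq> bd C"
proof
  fix e assume e: "e \<in> bd (comp_in G C v)"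
  then have E: "e \<in> edges G" using bd_edges by blast
  from e obtain a b where ab: "endpoints G e = {a, b}" "a \<in> comp_in G C v" "b \<notin> comp_in G C v"
    unfolding edge_boundary_def by auto
  then have "(a, b) \<in> adj G" using E by (auto simp: adj_def)
  moreover have "a \<in> C" using ab comp_in_subset[OF assms] by blast
  ultimately have "b \<notin> C" using comp_in_closed[OF ab(2)] ab(3) by blast
  with \<open>a \<in> C\<close> ab E show "e \<in> bd C" by (simp add: bd_iff)
qed

lemma cut_comp_in: "cut C \<Longrightarrow> v \<in> C \<Longrightarrow> cut (comp_in G C v)"
  unfolding cut_def using finite_subset[OF bd_comp_in] comp_in_subset[of v C G] by auto

lemma finite_bd_endpoints: "cut C \<Longrightarrow> finite (\<Union>(endpoints G ` bd C))"
proof -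
  assume "cut C"
  moreover have "finite (endpoints G e)" if "e \<in> bd C" for e
    using edge_obtain[OF bd_edges[OF that]] by (metis finite.emptyI finite_insert)
  ultimately show ?thesis by (auto simp: cut_def)
qed

text \<open>An edge of \<open>D\<close> across \<open>C\<close> would be in \<open>bd C\<close>. In
  a point-finite family of connected sets, all but finitely many members therefore lie inside a
  given finite cut or miss it.\<close>

lemma conn_cases:
  assumes "conn G D" "\<Union>(endpoints G ` bd C) \<inter> D = {}"
  shows "D \<subseteq> C \<or> D \<inter> C = {}"
proof (rule ccontr)
  assume "\<not> ?thesis"
  then obtain a b where ab: "(a, b) \<in> adj G" "a \<in> D" "b \<in> D" "a \<in> C" "b \<notin> C"
    using conn_crosses[OF assms(1), of C] by blast
  then obtain e where "e \<in> edges G" "endpoints G e = {a, b}" by (auto simp: adj_def)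
  with ab have "e \<in> bd C" "a \<in> endpoints G e" by (auto simp: bd_iff)
  with ab assms(2) show False by blast
qed

section \<open>Rays and edge-ends in terms of finite cuts\<close>

text \<open>\<open>ray_enum\<close> hides the enumeration of the edges behind an existential
  quantifier; counting how often a ray crosses a cut needs it explicitly.\<close>

definition enum :: "('v, 'e) mgraph \<Rightarrow> (nat \<Rightarrow> 'v) \<Rightarrow> (nat \<Rightarrow> 'e) \<Rightarrow> bool" where
  "enum R x e \<longleftrightarrow> inj x \<and> verts R = range x \<and> edges R = range e \<and>
     (\<forall>n. endpoints R (e n) = {x n, x (Suc n)})"

text \<open>Short for "eventually in": the counterpart of \<open>lives_in\<close> for a single
  ray.\<close>

definition evin :: "('v, 'e) mgraph \<Rightarrow> 'v set \<Rightarrow> bool" where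
  "evin R C \<longleftrightarrow> (\<exists>S. tail_of S R \<and> verts S \<subseteq> C)"

end

lemma doubleton_Suc_eq:
  "inj x \<Longrightarrow> {x n, x (Suc n)} = {x m, x (Suc m)} \<Longrightarrow> n = m"
  by (auto simp: doubleton_eq_iff inj_eq)

definition rtail :: "('v, 'e) mgraph \<Rightarrow> (nat \<Rightarrow> 'v) \<Rightarrow> (nat \<Rightarrow> 'e) \<Rightarrow> nat \<Rightarrow> ('v, 'e) mgraph" where
  "rtail R x e n = \<lparr>verts = x ` {n..}, edges = e ` {n..}, endpoints = endpoints R\<rparr>"

context multi_graph
begin

lemma enum_inj_edges: "enum R x e \<Longrightarrow> inj e"
  unfolding enum_def by (rule injI) (metis doubleton_Suc_eq)

lemma ray_enum_iff: "ray_enum R x \<longleftrightarrow> (\<exists>e. enum R x e)"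
  by (auto simp: ray_enum_def enum_def)

lemma rays_obtain:
  assumes "R \<in> rays G" obtains x e where "enum R x e"
  using assms by (auto simp: rays_def ray_enum_iff)

lemma ray_edges:
  assumes "R \<in> rays G" "enum R x e"
  shows "e n \<in> edges G" "endpoints G (e n) = {x n, x (Suc n)}" "x n \<in> verts G" "endpoints R = endpoints G"
  using assms by (auto simp: rays_def subgraph_def enum_def)

lemma rtail_tail_of:
  assumes "enum R x e" shows "tail_of (rtail R x e n) R"
proof -
  let ?S = "rtail R x e n"
  have mg: "multigraph ?S" unfolding multigraph_def rtail_def using assms by (fastforce simp: enum_def)
  have step: "(x k, x (Suc k)) \<in> adj ?S" if "k \<ge> n" for k
    using that assms by (auto simp: adj_def rtail_def enum_def)
  have "(x n, x (n + k)) \<in> (adj ?S)\<^sup>*" for k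
    by (induction k) (simp_all add: rtrancl_into_rtrancl[OF _ step])
  then have *: "(x n, x k) \<in> (adj ?S)\<^sup>*" if "k \<ge> n" for k using that by (metis le_add_diff_inverse)
  have "sym (adj ?S)" by (auto intro!: symI dest: adj_sym)
  then have **: "(x k, x n) \<in> (adj ?S)\<^sup>*" if "k \<ge> n" for k using * that by (meson symD sym_rtrancl)
  have "(u, v) \<in> (adj ?S)\<^sup>*" if uv: "u \<in> verts ?S" "v \<in> verts ?S" for u v
  proof -
    obtain j where "u = x j" "j \<ge> n" using uv(1) by (auto simp: rtail_def)
    moreover obtain k where "v = x k" "k \<ge> n" using uv(2) by (auto simp: rtail_def)
    ultimately show ?thesis using * ** by (meson rtrancl_trans)
  qed
  moreover have "verts ?S \<noteq> {}" by (auto simp: rtail_def)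
  ultimately have "connected_graph ?S" using connected_graph_iff[OF mg] by (simp add: conn_def adj_verts_Int[OF mg])
  moreover have "infinite (verts ?S)" using assms
    by (auto simp: rtail_def enum_def infinite_Ici dest!: finite_imageD intro: inj_on_subset)
  moreover have "subgraph ?S R" using mg assms by (auto simp: subgraph_def rtail_def enum_def)
  ultimately show ?thesis by (simp add: tail_of_def)
qed

text \<open>Tails are arbitrary infinite connected subgraphs. One that contains \<open>x n\<close>
  and some vertex beyond \<open>x m\<close>, for \<open>m \<ge> n\<close>, must contain
  \<open>x m\<close>, since the only edge of the ray that leaves the initial segment up to
  \<open>x m\<close> starts at \<open>x m\<close>.\<close>

lemma tail_contains:
  assumes "tail_of S R" "enum R x e"
  shows "\<exists>n. x ` {n..} \<subseteq> verts S"
proof -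
  have S: "subgraph S R" "connected_graph S" "infinite (verts S)" using assms(1) by (auto simp: tail_of_def)
  have mS: "multigraph S" using S by (simp add: subgraph_def)
  have sub: "verts S \<subseteq> range x" using S assms(2) by (auto simp: subgraph_def enum_def)
  have inj: "inj x" using assms(2) by (simp add: enum_def)
  obtain n where n: "x n \<in> verts S" using S sub by (metis finite.emptyI imageE subsetD all_not_in_conv)
  have "x m \<in> verts S" if m: "m \<ge> n" for m
  proof (rule ccontr)
    assume nm: "x m \<notin> verts S"
    have "\<exists>k>m. x k \<in> verts S"
    proof (rule ccontr)
      assume "\<not> ?thesis"
      then have "verts S \<subseteq> x ` {..m}" using sub by (fastforce simp: not_le)
      then show False using S(3) finite_subset by blast
    qed
    then obtain k where k: "k > m" "x k \<in> verts S" by blast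
    have "(x n, x k) \<in> (adj S \<inter> verts S \<times> verts S)\<^sup>*"
      using S(2) n k unfolding connected_graph_iff[OF mS] conn_def by blast
    moreover have "x n \<in> x ` {..m}" "x k \<notin> x ` {..m}" using m k inj by (auto simp: inj_eq)
    ultimately obtain a b where ab: "(a, b) \<in> adj S" "a \<in> verts S" "b \<in> verts S" "a \<in> x ` {..m}" "b \<notin> x ` {..m}"
      using reach_crosses[of "x n" "x k" "adj S \<inter> verts S \<times> verts S" "x ` {..m}"] by blast
    have "(a, b) \<in> adj R" using ab(1) subgraph_adj[OF S(1)] by blast
    then obtain j where j: "{a, b} = {x j, x (Suc j)}" using assms(2) by (auto simp: adj_def enum_def)
    obtain i where i: "i \<le> m" "a = x i" using ab by blast
    obtain l where l: "b = x l" using ab sub by blast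
    then have lm: "l > m" using ab by (auto simp: not_le[symmetric])
    have "i = j \<and> l = Suc j \<or> i = Suc j \<and> l = j" using j i l inj by (auto simp: doubleton_eq_iff inj_eq)
    then have "i = m" using i lm by auto
    then show False using nm i ab by simp
  qed
  then show ?thesis by auto
qed

lemma evin_iff:
  assumes "enum R x e" shows "evin R C \<longleftrightarrow> (\<exists>n. \<forall>k\<ge>n. x k \<in> C)"
proof
  assume "evin R C"
  then show "\<exists>n. \<forall>k\<ge>n. x k \<in> C" unfolding evin_def using tail_contains[OF _ assms] by (metis atLeast_iff image_subset_iff subset_trans)
next
  assume "\<exists>n. \<forall>k\<ge>n. x k \<in> C"
  then obtain n where "\<forall>k\<ge>n. x k \<in> C" by blast
  then have "verts (rtail R x e n) \<subseteq> C" by (auto simp: rtail_def)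
  then show "evin R C" unfolding evin_def using rtail_tail_of[OF assms] by blast
qed

lemma evin_not_disjoint:
  assumes "R \<in> rays G" "evin R C" "evin R D" shows "evin R (C \<inter> D)" "C \<inter> D \<noteq> {}"
proof -
  obtain x e where x: "enum R x e" using rays_obtain[OF assms(1)] .
  obtain n where n: "\<forall>k\<ge>n. x k \<in> C" using assms(2) unfolding evin_iff[OF x] ..
  obtain m where m: "\<forall>k\<ge>m. x k \<in> D" using assms(3) unfolding evin_iff[OF x] ..
  have *: "\<forall>k\<ge>max n m. x k \<in> C \<inter> D" using n m by simp
  show "evin R (C \<inter> D)" unfolding evin_iff[OF x] using * by (rule exI)
  have "x (max n m) \<in> C \<inter> D" using *[rule_format, of "max n m"] by simp
  then show "C \<inter> D \<noteq> {}" by (metis empty_iff)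
qed

text \<open>The edges of a ray are distinct, so it crosses the finite boundary only finitely often
  and stays on one side from then on.\<close>

lemma evin_cases:
  assumes "R \<in> rays G" "cut C" shows "evin R C \<or> evin R (verts G - C)"
proof -
  obtain x e where x: "enum R x e" using rays_obtain[OF assms(1)] .
  have "finite (e -` bd C)" using finite_vimageI[OF cut_finite[OF assms(2)] enum_inj_edges[OF x]] .
  then obtain n where n: "\<forall>k\<in>e -` bd C. k < n" using finite_nat_set_iff_bounded by blast
  have step: "x k \<in> C \<longleftrightarrow> x (Suc k) \<in> C" if "k \<ge> n" for k
  proof -
    have "e k \<notin> bd C" using n that by (meson leD vimageI2)
    then show ?thesis using bd_iff[OF ray_edges(1,2)[OF assms(1) x]] by blast
  qed
  have "x (n + k) \<in> C \<longleftrightarrow> x n \<in> C" for k by (induction k) (simp_all add: step[symmetric])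
  then have "x k \<in> C \<longleftrightarrow> x n \<in> C" if "k \<ge> n" for k using that by (metis le_add_diff_inverse)
  then show ?thesis unfolding evin_iff[OF x] using ray_edges(3)[OF assms(1) x] by blast
qed

text \<open>Separators become cuts: what is reachable from \<open>A\<close> after deletion of
  \<open>F\<close> has its boundary in \<open>F\<close>, and conversely \<open>bd C\<close> is a
  separator. Only \<open>A \<inter> verts G\<close> can be asked to lie in \<open>C\<close>, as
  \<open>A\<close> may contain points outside \<open>G\<close>.\<close>

lemma separable_iff:
  "finitely_edge_separable G A B \<longleftrightarrow> (\<exists>C. cut C \<and> A \<inter> verts G \<subseteq> C \<and> B \<inter> C = {})"
proof
  assume "finitely_edge_separable G A B"
  then obtain F where F: "finite F" "F \<subseteq> edges G" "edge_separates G F A B"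
    by (auto simp: finitely_edge_separable_def)
  let ?H = "del_edges G F"
  have H: "multigraph ?H" "verts ?H = verts G" "edges ?H = edges G - F" "endpoints ?H = endpoints G"
    using multigraph_G by (auto simp: del_edges_def multigraph_def)
  let ?C = "{w. \<exists>u\<in>A \<inter> verts G. (u, w) \<in> (adj ?H)\<^sup>*}"
  have CV: "?C \<subseteq> verts G"
  proof
    fix w assume "w \<in> ?C"
    then obtain u where "u \<in> verts G" "(u, w) \<in> (adj ?H)\<^sup>*" by blast
    from this(2,1) show "w \<in> verts G"
      by (induction rule: rtrancl_induct) (use adj_verts[OF H(1)] H(2) in auto)
  qed
  have "bd ?C \<subseteq> F"
  proof
    fix e assume e: "e \<in> bd ?C"
    then obtain a b where ab: "endpoints G e = {a, b}" "a \<in> ?C" "b \<notin> ?C" "e \<in> edges G"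
      by (auto simp: edge_boundary_def)
    show "e \<in> F"
    proof (rule ccontr)
      assume "e \<notin> F"
      then have "(a, b) \<in> adj ?H" using ab H by (auto simp: adj_def)
      then have "b \<in> ?C" using ab(2) by (auto intro: rtrancl_into_rtrancl)
      then show False using ab by blast
    qed
  qed
  then have "cut ?C" using CV F finite_subset by (auto simp: cut_def)
  moreover have "A \<inter> verts G \<subseteq> ?C" by auto
  moreover have "B \<inter> ?C = {}"
  proof (rule ccontr)
    assume "B \<inter> ?C \<noteq> {}"
    then obtain u w where u: "u \<in> A" "u \<in> verts G" "w \<in> B" "(u, w) \<in> (adj ?H)\<^sup>*" by blast
    then obtain P where P: "subgraph P ?H" "path_between P u w" using reach_path[OF H(1)] H(2) by metis
    then have "u \<in> verts P" "w \<in> verts P" by (auto simp: path_between_def)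
    then have "verts P \<inter> A \<noteq> {}" "verts P \<inter> B \<noteq> {}" using u by auto
    then show False using F(3) P unfolding edge_separates_def is_path_def by blast
  qed
  ultimately show "\<exists>C. cut C \<and> A \<inter> verts G \<subseteq> C \<and> B \<inter> C = {}" by blast
next
  assume "\<exists>C. cut C \<and> A \<inter> verts G \<subseteq> C \<and> B \<inter> C = {}"
  then obtain C where C: "cut C" "A \<inter> verts G \<subseteq> C" "B \<inter> C = {}" by blast
  have "edge_separates G (bd C) A B" unfolding edge_separates_def
  proof
    assume "\<exists>P. subgraph P (del_edges G (bd C)) \<and> is_path P \<and> verts P \<inter> A \<noteq> {} \<and> verts P \<inter> B \<noteq> {}"
    then obtain P u v a b where P: "subgraph P (del_edges G (bd C))" "path_between P u v"
      "a \<in> verts P" "a \<in> A" "b \<in> verts P" "b \<in> B" unfolding is_path_def by blast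
    let ?H = "del_edges G (bd C)"
    have "a \<in> verts G" using P by (auto simp: subgraph_def del_edges_def)
    then have aC: "a \<in> C" "b \<notin> C" using C P by auto
    have "(u, a) \<in> (adj ?H)\<^sup>*" "(u, b) \<in> (adj ?H)\<^sup>*" using path_in_subgraph_reach[OF P(2,1)] P by blast+
    moreover have closed: "c \<in> C \<longleftrightarrow> d \<in> C" if "(c, d) \<in> adj ?H" for c d
      using that bd_iff by (auto simp: adj_def del_edges_def)
    have "w \<in> C \<longleftrightarrow> u \<in> C" if "(u, w) \<in> (adj ?H)\<^sup>*" for w
      using that by (induction rule: rtrancl_induct) (auto dest: closed)
    ultimately show False using aC by blast
  qed
  then show "finitely_edge_separable G A B" unfolding finitely_edge_separable_def
    using C(1) by (auto simp: cut_def intro!: exI[of _ "bd C"] dest: bd_edges)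
qed

text \<open>A finite separation of two tails is a cut containing one and missing the other, and
  every finite cut decides every ray.\<close>

lemma edge_equiv_iff:
  assumes "R \<in> rays G" "S \<in> rays G"
  shows "(R, S) \<in> edge_equiv G \<longleftrightarrow> (\<forall>C. cut C \<longrightarrow> (evin R C \<longleftrightarrow> evin S C))"
proof
  assume eq: "(R, S) \<in> edge_equiv G"
  have 1: "evin S C" if C: "cut C" "evin R C" for C
  proof (rule ccontr)
    assume "\<not> evin S C"
    then have "evin S (verts G - C)" using evin_cases[OF assms(2) C(1)] by blast
    then obtain R' S' where t: "tail_of R' R" "tail_of S' S" "verts R' \<subseteq> C" "verts S' \<subseteq> verts G - C"
      using C(2) by (auto simp: evin_def)
    then have "finitely_edge_separable G (verts R') (verts S')"
      unfolding separable_iff using C(1) by (blast intro: exI[of _ C])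
    then show False using eq t unfolding edge_equiv_def by blast
  qed
  have "evin R C" if "cut C" "evin S C" for C
  proof (rule ccontr)
    assume "\<not> evin R C"
    then have "evin R (verts G - C)" using evin_cases[OF assms(1) that(1)] by blast
    then have "evin S (verts G - C)" using 1 cut_Diff[OF cut_verts that(1)] by blast
    then show False using evin_not_disjoint(2)[OF assms(2) that(2)] by blast
  qed
  with 1 show "\<forall>C. cut C \<longrightarrow> (evin R C \<longleftrightarrow> evin S C)" by blast
next
  assume eq: "\<forall>C. cut C \<longrightarrow> (evin R C \<longleftrightarrow> evin S C)"
  have False if t: "tail_of R' R" "tail_of S' S" "finitely_edge_separable G (verts R') (verts S')" for R' S'
  proof -
    obtain C where C: "cut C" "verts R' \<inter> verts G \<subseteq> C" "verts S' \<inter> C = {}"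
      using t(3) separable_iff by blast
    have "verts R' \<subseteq> verts G" using t(1) assms(1) by (auto simp: tail_of_def subgraph_def rays_def)
    then have "evin R C" using t(1) C unfolding evin_def by blast
    then have "evin S C" using eq C by blast
    moreover have "evin S (verts S')" using t(2) by (auto simp: evin_def)
    ultimately show False using evin_not_disjoint(2)[OF assms(2)] C(3) by blast
  qed
  then show "(R, S) \<in> edge_equiv G" using assms unfolding edge_equiv_def by blast
qed

section \<open>Edge-ends and the finite cuts in which they live\<close>

lemma equiv_edge_equiv: "equiv (rays G) (edge_equiv G)"
proof (rule equivI)
  have sub: "edge_equiv G \<subseteq> rays G \<times> rays G" by (auto simp: edge_equiv_def)
  then show "edge_equiv G \<subseteq> rays G \<times> rays G" .
  show "refl_on (rays G) (edge_equiv G)" using edge_equiv_iff by (auto intro!: refl_onI)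
  show "sym (edge_equiv G)" using edge_equiv_iff sub by (intro symI) blast
  show "trans (edge_equiv G)" using edge_equiv_iff sub
    by (intro transI) (metis (no_types, lifting) mem_Sigma_iff subsetD)
qed

lemma end_ray_rays: "\<omega> \<in> edge_ends G \<Longrightarrow> R \<in> \<omega> \<Longrightarrow> R \<in> rays G"
  unfolding edge_ends_def using in_quotient_imp_subset[OF equiv_edge_equiv] by blast

lemma end_nonempty: "\<omega> \<in> edge_ends G \<Longrightarrow> \<exists>R. R \<in> \<omega>"
  unfolding edge_ends_def using in_quotient_imp_non_empty[OF equiv_edge_equiv] by blast

lemma end_equiv: "\<omega> \<in> edge_ends G \<Longrightarrow> R \<in> \<omega> \<Longrightarrow> S \<in> \<omega> \<Longrightarrow> (R, S) \<in> edge_equiv G"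
  unfolding edge_ends_def using quotient_eq_iff[OF equiv_edge_equiv] by blast

lemma lives_in_iff:
  assumes "\<omega> \<in> edge_ends G" "R \<in> \<omega>" "cut C"
  shows "lives_in \<omega> C \<longleftrightarrow> evin R C"
proof -
  have "lives_in \<omega> C \<longleftrightarrow> (\<forall>S\<in>\<omega>. evin S C)" by (simp add: lives_in_def evin_def)
  moreover have "evin S C \<longleftrightarrow> evin R C" if "S \<in> \<omega>" for S
    using edge_equiv_iff end_equiv[OF assms(1,2) that] end_ray_rays[OF assms(1)] assms that by blast
  ultimately show ?thesis using assms by blast
qed

text \<open>The conditions on the end and on the cut are part of the relation, so it is false for
  classes that are not ends; later statements about all \<omega> need no restriction to
  ends.\<close>

definition lv :: "('v, 'e) mgraph set \<Rightarrow> 'v set \<Rightarrow> bool" where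
  "lv \<omega> C \<longleftrightarrow> \<omega> \<in> edge_ends G \<and> cut C \<and> lives_in \<omega> C"

lemma lv_cut: "lv \<omega> C \<Longrightarrow> cut C" and lv_end: "lv \<omega> C \<Longrightarrow> \<omega> \<in> edge_ends G"
  by (simp_all add: lv_def)

lemma lv_ray: "\<omega> \<in> edge_ends G \<Longrightarrow> R \<in> \<omega> \<Longrightarrow> cut C \<Longrightarrow> lv \<omega> C \<longleftrightarrow> evin R C"
  using lives_in_iff by (auto simp: lv_def)

lemma lv_obtain:
  assumes "\<omega> \<in> edge_ends G"
  obtains R where "R \<in> rays G" "R \<in> \<omega>" "\<And>C. cut C \<Longrightarrow> lv \<omega> C \<longleftrightarrow> evin R C"
  using end_nonempty[OF assms] end_ray_rays[OF assms] lv_ray[OF assms] by blast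

lemma lv_Int: assumes "lv \<omega> C" "lv \<omega> D" shows "lv \<omega> (C \<inter> D)" "C \<inter> D \<noteq> {}"
proof -
  obtain R where R: "R \<in> rays G" "\<And>C. cut C \<Longrightarrow> lv \<omega> C \<longleftrightarrow> evin R C" using lv_obtain[OF lv_end[OF assms(1)]] by metis
  have "evin R C" "evin R D" using assms R(2) lv_cut by blast+
  then show "lv \<omega> (C \<inter> D)" "C \<inter> D \<noteq> {}"
    using evin_not_disjoint[OF R(1)] R(2)[OF cut_Int] assms lv_cut by blast+
qed

lemma lv_mono: "lv \<omega> C \<Longrightarrow> C \<subseteq> D \<Longrightarrow> cut D \<Longrightarrow> lv \<omega> D"
  unfolding lv_def lives_in_def by (meson subset_trans)

lemma lv_nonempty: "lv \<omega> C \<Longrightarrow> C \<noteq> {}"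
  using lv_Int(2) by blast

lemma lv_cases: assumes "\<omega> \<in> edge_ends G" "cut C" shows "lv \<omega> C \<or> lv \<omega> (verts G - C)"
proof -
  obtain R where R: "R \<in> rays G" "\<And>C. cut C \<Longrightarrow> lv \<omega> C \<longleftrightarrow> evin R C" using lv_obtain[OF assms(1)] by metis
  then show ?thesis using evin_cases[OF R(1) assms(2)] assms(2) cut_Diff[OF cut_verts] by blast
qed

lemma lv_verts: "\<omega> \<in> edge_ends G \<Longrightarrow> lv \<omega> (verts G)"
  using lv_cases[of \<omega> "verts G"] lv_nonempty[of \<omega> "{}"] by auto

lemma lv_Diff: assumes "lv \<omega> C" "cut D" "\<not> lv \<omega> D" shows "lv \<omega> (C - D)"
proof -
  have "lv \<omega> (verts G - D)" using lv_cases[OF lv_end[OF assms(1)] assms(2)] assms(3) by blast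
  then have "lv \<omega> (C \<inter> (verts G - D))" using lv_Int[OF assms(1)] by blast
  moreover have "C \<inter> (verts G - D) = C - D" using cut_subset[OF lv_cut[OF assms(1)]] by blast
  ultimately show ?thesis by simp
qed

text \<open>Not a consequence of the ultrafilter properties, as \<open>C\<close> may have infinitely
  many components. The tail of a ray inside \<open>C\<close> is connected and selects one.\<close>

lemma lv_comp: assumes "lv \<omega> C" shows "\<exists>v\<in>C. lv \<omega> (comp_in G C v)"
proof -
  obtain R where R: "R \<in> rays G" "\<And>C. cut C \<Longrightarrow> lv \<omega> C \<longleftrightarrow> evin R C" using lv_obtain[OF lv_end[OF assms(1)]] by metis
  obtain x e where x: "enum R x e" using rays_obtain[OF R(1)] .
  have "evin R C" using assms R(2) lv_cut by blast
  then obtain n where n: "\<And>k. k \<ge> n \<Longrightarrow> x k \<in> C" using evin_iff[OF x] by blast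
  have adj: "(x k, x (Suc k)) \<in> adj G" for k using ray_edges(1,2)[OF R(1) x, of k] by (auto simp: adj_def)
  have "x (n + k) \<in> comp_in G C (x n)" for k
  proof (induction k)
    case (Suc k)
    then show ?case using comp_in_closed[OF Suc adj] n[of "n + k"] n[of "n + Suc k"] by simp
  qed simp
  then have "\<forall>k\<ge>n. x k \<in> comp_in G C (x n)" by (metis le_add_diff_inverse)
  then have "evin R (comp_in G C (x n))" using evin_iff[OF x] by blast
  then have "lv \<omega> (comp_in G C (x n))" using R(2) cut_comp_in[OF lv_cut[OF assms]] n by blast
  then show ?thesis using n by blast
qed

text \<open>One inclusion suffices: if \<omega>' lived in a further cut \<open>C\<close>, then
  \<omega>, and with it \<omega>', would live in the complement of \<open>C\<close>.\<close>

lemma lv_unique: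
  assumes "\<omega> \<in> edge_ends G" "\<omega>' \<in> edge_ends G" "\<And>C. lv \<omega> C \<Longrightarrow> lv \<omega>' C"
  shows "\<omega> = \<omega>'"
proof -
  obtain R where R: "R \<in> rays G" "R \<in> \<omega>" "\<And>C. cut C \<Longrightarrow> lv \<omega> C \<longleftrightarrow> evin R C" using lv_obtain[OF assms(1)] by metis
  obtain S where S: "S \<in> rays G" "S \<in> \<omega>'" "\<And>C. cut C \<Longrightarrow> lv \<omega>' C \<longleftrightarrow> evin S C" using lv_obtain[OF assms(2)] by metis
  have "lv \<omega> C \<longleftrightarrow> lv \<omega>' C" if "cut C" for C
  proof
    assume "lv \<omega>' C"
    show "lv \<omega> C"
    proof (rule ccontr)
      assume "\<not> lv \<omega> C"
      then have "lv \<omega>' (verts G - C)" using lv_cases[OF assms(1) that] assms(3) by blast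
      then show False using lv_Int(2)[OF \<open>lv \<omega>' C\<close>] by blast
    qed
  qed (use assms in blast)
  then have "(R, S) \<in> edge_equiv G" using edge_equiv_iff[OF R(1) S(1)] R(3) S(3) by blast
  then show ?thesis using quotient_eqI[OF equiv_edge_equiv] assms R(2) S(2) unfolding edge_ends_def by blast
qed

text \<open>The end of \<open>S\<close> decides cuts as \<open>S\<close> does, so by
  \<open>lv_unique\<close> it is \<omega>. This is how a constructed ray is placed in a given
  end.\<close>

lemma ray_in_end:
  assumes "\<omega> \<in> edge_ends G" "S \<in> rays G" "\<And>C. lv \<omega> C \<Longrightarrow> evin S C"
  shows "S \<in> \<omega>"
proof -
  obtain \<omega>' where w: "\<omega>' \<in> edge_ends G" "S \<in> \<omega>'"
    using assms(2) equiv_class_self[OF equiv_edge_equiv] unfolding edge_ends_def by (blast intro: quotientI)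
  have "\<omega> = \<omega>'" by (rule lv_unique[OF assms(1) w(1)]) (use assms(3) lv_ray[OF w] lv_cut in blast)
  then show ?thesis using w by blast
qed

text \<open>A cut separating \<open>v\<close> from a tail has \<open>v\<close> on one side and the
  tail on the other, and its complement is a cut around \<omega> that avoids \<open>v\<close>.
  Domination by \<open>v\<close> thus means that \<open>v\<close> lies in every cut around
  \<omega>.\<close>

lemma undominated_iff:
  "\<omega> \<in> undominated_edge_ends G \<longleftrightarrow> \<omega> \<in> edge_ends G \<and> (\<forall>v\<in>verts G. \<exists>C. lv \<omega> C \<and> v \<notin> C)"
proof -
  have key: "edge_dominates_ray G v R \<longleftrightarrow> \<not> (\<exists>C. lv \<omega> C \<and> v \<notin> C)"
    if w: "\<omega> \<in> edge_ends G" "R \<in> \<omega>" and v: "v \<in> verts G" for v R \<omega>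
  proof -
    have R: "R \<in> rays G" using end_ray_rays[OF w] .
    have "(\<exists>R'. tail_of R' R \<and> finitely_edge_separable G {v} (verts R')) \<longleftrightarrow> (\<exists>C. lv \<omega> C \<and> v \<notin> C)" (is "?l \<longleftrightarrow> ?r")
    proof
      assume ?l
      then obtain R' C where C: "tail_of R' R" "cut C" "v \<in> C" "verts R' \<inter> C = {}" unfolding separable_iff using v by blast
      have "verts R' \<subseteq> verts G" using C(1) R by (auto simp: tail_of_def subgraph_def rays_def)
      then have "evin R (verts G - C)" using C unfolding evin_def by blast
      then have "lv \<omega> (verts G - C)" using lv_ray[OF w cut_Diff[OF cut_verts C(2)]] by blast
      then show ?r using C by blast
    next
      assume ?r
      then obtain C where C: "lv \<omega> C" "v \<notin> C" by blast
      then have "evin R C" using lv_ray[OF w lv_cut[OF C(1)]] by blast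
      then obtain R' where "tail_of R' R" "verts R' \<subseteq> C" by (auto simp: evin_def)
      moreover have "cut (verts G - C)" using cut_Diff[OF cut_verts lv_cut[OF C(1)]] .
      ultimately show ?l unfolding separable_iff using C(2) by (blast intro: exI[of _ "verts G - C"])
    qed
    then show ?thesis unfolding edge_dominates_ray_def by blast
  qed
  have "edge_dominates G v \<omega> \<longleftrightarrow> v \<in> verts G \<and> \<not> (\<exists>C. lv \<omega> C \<and> v \<notin> C)" if w: "\<omega> \<in> edge_ends G" for v
  proof -
    obtain R where "R \<in> \<omega>" using end_nonempty[OF w] by blast
    then show ?thesis unfolding edge_dominates_def using key[OF w] by (auto simp del: not_ex)
  qed
  then have "\<omega> \<in> edge_ends G \<Longrightarrow> (\<exists>v. edge_dominates G v \<omega>) \<longleftrightarrow> (\<exists>v\<in>verts G. \<not> (\<exists>C. lv \<omega> C \<and> v \<notin> C))"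
    by (simp add: Bex_def)
  then show ?thesis unfolding undominated_edge_ends_def by (simp del: not_ex) blast
qed

end

section \<open>Laminar families of finite cuts\<close>

definition laminar :: "'a set set \<Rightarrow> bool" where
  "laminar N \<longleftrightarrow> (\<forall>A\<in>N. \<forall>B\<in>N. A \<subseteq> B \<or> B \<subseteq> A \<or> A \<inter> B = {})"

definition point_finite :: "'a set set \<Rightarrow> bool" where
  "point_finite N \<longleftrightarrow> (\<forall>v. finite {A \<in> N. v \<in> A})"

lemma laminarD: "laminar N \<Longrightarrow> A \<in> N \<Longrightarrow> B \<in> N \<Longrightarrow> A \<subseteq> B \<or> B \<subseteq> A \<or> A \<inter> B = {}"
  by (simp add: laminar_def)

lemma point_finite_Un: "point_finite A \<Longrightarrow> point_finite B \<Longrightarrow> point_finite (A \<union> B)"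
proof -
  have "{X \<in> A \<union> B. v \<in> X} = {X \<in> A. v \<in> X} \<union> {X \<in> B. v \<in> X}" for v by auto
  then show "point_finite A \<Longrightarrow> point_finite B \<Longrightarrow> point_finite (A \<union> B)" by (simp add: point_finite_def)
qed

lemma point_finite_subset: "point_finite B \<Longrightarrow> A \<subseteq> B \<Longrightarrow> point_finite A"
  unfolding point_finite_def by (auto intro: finite_subset[rotated])

lemma point_finite_disjoint:
  assumes "disjoint K" shows "point_finite K"
proof -
  have "{A \<in> K. v \<in> A} = {} \<or> (\<exists>A. {A \<in> K. v \<in> A} = {A})" for v
    using assms unfolding disjoint_def by blast
  then show ?thesis unfolding point_finite_def by (metis finite.emptyI finite.insertI)
qed

lemma laminar_disjoint: "disjoint K \<Longrightarrow> laminar K"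
  unfolding disjoint_def laminar_def by blast

context multi_graph
begin

text \<open>Only cuts inside \<open>D\<close> are counted, so the bound survives shrinking of
  \<open>D\<close>. It is vacuous if \<omega> lives in no cut inside \<open>D\<close>.\<close>

definition lower :: "'v set \<Rightarrow> ('v, 'e) mgraph set \<Rightarrow> nat \<Rightarrow> bool" where
  "lower D \<omega> k \<longleftrightarrow> (\<forall>C. lv \<omega> C \<longrightarrow> C \<subseteq> D \<longrightarrow> k \<le> card (bd C))"

definition covered :: "'v set set \<Rightarrow> ('v, 'e) mgraph set \<Rightarrow> bool" where
  "covered N \<omega> \<longleftrightarrow> (\<exists>M\<in>N. lv \<omega> M)"

text \<open>Every member is a minimum cut inside \<open>D\<close> around at least one end; this
  witness is what uncrossing needs.\<close>

definition tight :: "'v set \<Rightarrow> 'v set set \<Rightarrow> bool" where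
  "tight D N \<longleftrightarrow> laminar N \<and> point_finite N \<and>
     (\<forall>M\<in>N. cut M \<and> M \<subseteq> D \<and> conn G M \<and> (\<exists>\<omega>. lv \<omega> M \<and> lower D \<omega> (card (bd M))))"

text \<open>In \<open>tight\<close> the witness depends on the member. Here the innermost member
  around each covered end is a minimum cut for that very end, which yields the small boundaries
  needed for the edge-degrees.\<close>

definition innermost_tight :: "'v set \<Rightarrow> 'v set set \<Rightarrow> bool" where
  "innermost_tight D N \<longleftrightarrow> (\<forall>\<omega>. covered N \<omega> \<longrightarrow>
     (\<exists>M\<in>N. lv \<omega> M \<and> (\<forall>M'\<in>N. lv \<omega> M' \<longrightarrow> M \<subseteq> M') \<and> lower D \<omega> (card (bd M))))"

lemma lowerD: "lower D \<omega> k \<Longrightarrow> lv \<omega> C \<Longrightarrow> C \<subseteq> D \<Longrightarrow> k \<le> card (bd C)"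
  by (simp add: lower_def)

text \<open>A connected set that crosses \<open>B\<close> contains an end vertex of an edge of
  \<open>bd B\<close>; there are finitely many such vertices, each in finitely many members.\<close>

lemma cross_finite:
  assumes "cut B" "point_finite N" "\<And>Z. Z \<in> N \<Longrightarrow> conn G Z"
  shows "finite {Z \<in> N. Z \<inter> B \<noteq> {} \<and> \<not> Z \<subseteq> B}"
proof (rule finite_subset)
  show "{Z \<in> N. Z \<inter> B \<noteq> {} \<and> \<not> Z \<subseteq> B} \<subseteq> (\<Union>v\<in>\<Union>(endpoints G ` bd B). {Z \<in> N. v \<in> Z})"
  proof
    fix Z assume Z: "Z \<in> {Z \<in> N. Z \<inter> B \<noteq> {} \<and> \<not> Z \<subseteq> B}"
    then have "\<not> (\<Union>(endpoints G ` bd B) \<inter> Z = {})" using conn_cases[of Z B] assms(3) by blast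
    then show "Z \<in> (\<Union>v\<in>\<Union>(endpoints G ` bd B). {Z \<in> N. v \<in> Z})" using Z by blast
  qed
  show "finite (\<Union>v\<in>\<Union>(endpoints G ` bd B). {Z \<in> N. v \<in> Z})"
    by (rule finite_UN_I[OF finite_bd_endpoints[OF assms(1)]]) (use assms(2) in \<open>simp add: point_finite_def\<close>)
qed

section \<open>Uncrossing of minimum cuts and a single layer\<close>

definition big :: "'v set \<Rightarrow> nat \<Rightarrow> ('v, 'e) mgraph set \<Rightarrow> 'v set" where
  "big D d \<omega> = \<Union>{C. lv \<omega> C \<and> C \<subseteq> D \<and> card (bd C) \<le> d}"

lemma big_upper: "lv \<omega> C \<Longrightarrow> C \<subseteq> D \<Longrightarrow> card (bd C) \<le> d \<Longrightarrow> C \<subseteq> big D d \<omega>"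
  by (auto simp: big_def)

text \<open>Two cuts of size at most \<open>d\<close> around \<omega> intersect in a cut around
  \<omega>, of size at least \<open>d\<close>, so by submodularity their union again has size at
  most \<open>d\<close>. The union of all such cuts may be an infinite one, but any finitely many of
  its boundary edges are boundary edges of a finite subunion, so there are at most \<open>d\<close>
  in total.\<close>

lemma big_props:
  assumes low: "lower D \<omega> d" and ex: "lv \<omega> C0" "C0 \<subseteq> D" "card (bd C0) \<le> d"
  shows "lv \<omega> (big D d \<omega>)" "big D d \<omega> \<subseteq> D" "card (bd (big D d \<omega>)) \<le> d"
proof -
  define S where "S = {C. lv \<omega> C \<and> C \<subseteq> D \<and> card (bd C) \<le> d}"
  have SD: "lv \<omega> C" "C \<subseteq> D" "card (bd C) \<le> d" "cut C" if "C \<in> S" for C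
    using that lv_cut by (auto simp: S_def)
  have big: "big D d \<omega> = \<Union>S" by (simp add: S_def big_def)
  have un: "A \<union> B \<in> S" if A: "A \<in> S" and B: "B \<in> S" for A B
  proof -
    have "d \<le> card (bd (A \<inter> B))" using lowerD[OF low lv_Int(1)] SD[OF A] SD[OF B] by blast
    then have "card (bd (A \<union> B)) \<le> d"
      using submodular[of A B] SD[OF A] SD[OF B] cut_finite by fastforce
    moreover have "lv \<omega> (A \<union> B)" using lv_mono[OF SD(1)[OF A]] cut_Un SD(4)[OF A] SD(4)[OF B] by blast
    ultimately show ?thesis using SD[OF A] SD[OF B] by (simp add: S_def)
  qed
  have fin: "\<Union>X \<in> S" if "finite X" "X \<noteq> {}" "X \<subseteq> S" for X
    using that by (induction X rule: finite_ne_induct) (simp_all add: un)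
  have bnd: "card F \<le> d" if F: "F \<subseteq> bd (big D d \<omega>)" "finite F" for F
  proof -
    \<comment> \<open>A member of \<open>S\<close> containing the inner end vertex of
      \<open>e\<close> keeps \<open>e\<close> in the boundary of every larger set inside
      \<open>big D d \<omega>\<close>.\<close>
    have "\<exists>C. C \<in> S \<and> (\<forall>B. C \<subseteq> B \<longrightarrow> B \<subseteq> big D d \<omega> \<longrightarrow> e \<in> bd B)" if e: "e \<in> F" for e
    proof -
      have "e \<in> bd (big D d \<omega>)" using e F by blast
      then obtain u v where uv: "e \<in> edges G" "endpoints G e = {u, v}" "u \<in> big D d \<omega>" "v \<notin> big D d \<omega>"
        by (auto simp: edge_boundary_def)
      then obtain C where C: "C \<in> S" "u \<in> C" by (auto simp: big)
      have "e \<in> bd B" if "C \<subseteq> B" "B \<subseteq> big D d \<omega>" for B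
        using that uv(3,4) C(2) bd_iff[OF uv(1,2)] by blast
      then show ?thesis using C(1) by blast
    qed
    then have "\<forall>e\<in>F. \<exists>C. C \<in> S \<and> (\<forall>B. C \<subseteq> B \<longrightarrow> B \<subseteq> big D d \<omega> \<longrightarrow> e \<in> bd B)" by (rule ballI)
    from bchoice[OF this] obtain f where
      f: "\<forall>e\<in>F. f e \<in> S \<and> (\<forall>B. f e \<subseteq> B \<longrightarrow> B \<subseteq> big D d \<omega> \<longrightarrow> e \<in> bd B)" ..
    \<comment> \<open>\<open>C0\<close> keeps the family of united sets nonempty when
      \<open>F\<close> is empty.\<close>
    define U where "U = \<Union>(insert C0 (f ` F))"
    have U: "U \<in> S" unfolding U_def
    proof (rule fin)
      show "insert C0 (f ` F) \<subseteq> S" using f ex by (auto simp: S_def)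
    qed (use F(2) in auto)
    have "F \<subseteq> bd U"
    proof
      fix e assume e: "e \<in> F"
      have "f e \<subseteq> U" "U \<subseteq> big D d \<omega>" using e U by (auto simp: U_def big)
      then show "e \<in> bd U" using f e by blast
    qed
    then have "card F \<le> card (bd U)" by (rule card_mono[OF cut_finite[OF SD(4)[OF U]]])
    then show ?thesis using SD(3)[OF U] by simp
  qed
  then have fb: "finite (bd (big D d \<omega>))" "card (bd (big D d \<omega>)) \<le> d"
    using finite_if_finite_subsets_card_bdd[of "bd (big D d \<omega>)" d] by auto
  show sub: "big D d \<omega> \<subseteq> D" by (auto simp: big_def)
  have "big D d \<omega> \<subseteq> verts G" using cut_subset[OF SD(4)] by (auto simp: big)
  then have "cut (big D d \<omega>)" using fb by (simp add: cut_def)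
  then show "lv \<omega> (big D d \<omega>)" using lv_mono[OF ex(1) big_upper[OF ex]] by blast
  show "card (bd (big D d \<omega>)) \<le> d" by (rule fb)
qed

text \<open>Since \<omega>' lives in the largest cut of \<omega>, that cut competes in the union for
  \<omega>'. The resulting inclusion makes \<omega> live in the larger cut, which in turn competes
  in the union for \<omega>.\<close>

lemma big_eq:
  assumes low: "lower D \<omega> d" "lower D \<omega>' d" and ex: "lv \<omega> C0" "C0 \<subseteq> D" "card (bd C0) \<le> d"
    and ex': "lv \<omega>' C1" "C1 \<subseteq> D" "card (bd C1) \<le> d"
    and l: "lv \<omega>' (big D d \<omega>)"
  shows "big D d \<omega>' = big D d \<omega>"
proof
  note b = big_props[OF low(1) ex] and b' = big_props[OF low(2) ex']
  show 1: "big D d \<omega> \<subseteq> big D d \<omega>'" by (rule big_upper[OF l b(2,3)])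
  then have "lv \<omega> (big D d \<omega>')" using lv_mono[OF b(1)] lv_cut[OF b'(1)] by blast
  then show "big D d \<omega>' \<subseteq> big D d \<omega>" by (rule big_upper[OF _ b'(2,3)])
qed

lemma lv_Diff_Union:
  assumes "finite X" "lv \<omega> B" "\<And>Z. Z \<in> X \<Longrightarrow> cut Z" "\<And>Z. Z \<in> X \<Longrightarrow> \<not> lv \<omega> Z"
  shows "lv \<omega> (B - \<Union>X)"
  using assms
proof (induction X rule: finite_induct)
  case (insert Z X)
  have "B - \<Union>(insert Z X) = (B - \<Union>X) - Z" by blast
  then show ?case using lv_Diff[of \<omega> "B - \<Union>X" Z] insert by simp
qed simp

text \<open>By posimodularity, since each \<open>Z\<close> is a minimum cut around an end that does not live in \<open>B\<close>.\<close>

lemma trim: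
  assumes "finite X" "cut B" "card (bd B) \<le> d"
    and Z: "\<And>Z. Z \<in> X \<Longrightarrow> cut Z \<and> Z \<subseteq> D \<and> (\<exists>w. lv w Z \<and> \<not> lv w B \<and> lower D w (card (bd Z)))"
  shows "cut (B - \<Union>X) \<and> card (bd (B - \<Union>X)) \<le> d"
  using assms(1) Z
proof (induction X rule: finite_induct)
  case (insert Z X)
  let ?C = "B - \<Union>X"
  have C: "cut ?C" "card (bd ?C) \<le> d" using insert by auto
  obtain w where w: "cut Z" "Z \<subseteq> D" "lv w Z" "\<not> lv w B" "lower D w (card (bd Z))" using insert.prems[of Z] by auto
  have "\<not> lv w ?C" using w(4) lv_mono[of w ?C B] assms(2) by blast
  then have "card (bd Z) \<le> card (bd (Z - ?C))" using lowerD[OF w(5) lv_Diff[OF w(3) C(1)]] w(2) by blast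
  then have "card (bd (?C - Z)) \<le> card (bd ?C)"
    using posimodular[OF cut_finite[OF C(1)] cut_finite[OF w(1)]] by linarith
  moreover have "B - \<Union>(insert Z X) = ?C - Z" by blast
  ultimately show ?case using C cut_Diff[OF C(1) w(1)] by simp
qed (use assms in simp)

text \<open>A largest cut \<open>B\<close> around an uncovered end may cross members of
  \<open>N\<close> and of the part \<open>K\<close> chosen so far. By \<open>trim\<close>,
  subtracting them keeps the boundary at size at most \<open>d\<close>, provided each is a minimum
  cut around an end outside \<open>B\<close>. For members of \<open>N\<close> this follows from the
  maximality of \<open>B\<close>; for members of \<open>K\<close> a saturation condition, carried
  through Zorn's lemma, enforces it.\<close>

lemma layer:
  assumes N: "tight D N" and low: "\<And>\<omega>. \<not> covered N \<omega> \<Longrightarrow> lower D \<omega> d"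
  obtains K where "disjoint K"
    "\<And>k. k \<in> K \<Longrightarrow> cut k \<and> k \<subseteq> D \<and> conn G k \<and> card (bd k) \<le> d \<and> (\<exists>\<omega>. \<not> covered N \<omega> \<and> lv \<omega> k)"
    "\<And>M k. M \<in> N \<Longrightarrow> k \<in> K \<Longrightarrow> M \<subseteq> k \<or> M \<inter> k = {}"
    "\<And>\<omega> C. \<not> covered N \<omega> \<Longrightarrow> lv \<omega> C \<Longrightarrow> C \<subseteq> D \<Longrightarrow> card (bd C) \<le> d \<Longrightarrow> covered K \<omega>"
proof -
  define R where "R = {\<omega>. \<not> covered N \<omega> \<and> (\<exists>C. lv \<omega> C \<and> C \<subseteq> D \<and> card (bd C) \<le> d)}"
  have R_big: "lv \<omega> (big D d \<omega>)" "big D d \<omega> \<subseteq> D" "card (bd (big D d \<omega>)) \<le> d" if "\<omega> \<in> R" for \<omega>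
    using big_props[of D \<omega> d] low that unfolding R_def by blast+
  have R_eq: "big D d \<omega>' = big D d \<omega>" if "\<omega> \<in> R" "\<omega>' \<in> R" "lv \<omega>' (big D d \<omega>)" for \<omega> \<omega>'
    using big_eq[of D \<omega> d \<omega>'] low that unfolding R_def by blast
  \<comment> \<open>The last condition is saturation: once an end \<omega> of \<open>R\<close> lives
    in a member, all ends of \<open>R\<close> in its largest cut are covered. The largest cut of an
    uncovered end of \<open>R\<close> then contains no end of \<open>R\<close> that lives in a
    member of \<open>K\<close>.\<close>
  define P where "P = {K. disjoint K \<and> (\<forall>k\<in>K. cut k \<and> k \<subseteq> D \<and> conn G k \<and> card (bd k) \<le> d \<and>
           (\<exists>\<omega>\<in>R. lv \<omega> k)) \<and> (\<forall>M\<in>N. \<forall>k\<in>K. M \<subseteq> k \<or> M \<inter> k = {}) \<and>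
           (\<forall>k\<in>K. \<forall>\<omega>\<in>R. lv \<omega> k \<longrightarrow> (\<forall>\<omega>'\<in>R. lv \<omega>' (big D d \<omega>) \<longrightarrow> covered K \<omega>'))}"
  have PD: "disjoint K"
      "\<forall>k\<in>K. cut k \<and> k \<subseteq> D \<and> conn G k \<and> card (bd k) \<le> d \<and> (\<exists>\<omega>\<in>R. lv \<omega> k)"
      "\<forall>M\<in>N. \<forall>k\<in>K. M \<subseteq> k \<or> M \<inter> k = {}"
      "\<forall>k\<in>K. \<forall>\<omega>\<in>R. lv \<omega> k \<longrightarrow> (\<forall>\<omega>'\<in>R. lv \<omega>' (big D d \<omega>) \<longrightarrow> covered K \<omega>')"
    if "K \<in> P" for K using that by (simp_all add: P_def)
  have "\<exists>K\<in>P. \<forall>K'\<in>P. K \<subseteq> K' \<longrightarrow> K' = K"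
  proof (rule subset_Zorn')
    fix c assume c: "subset.chain P c"
    have cP: "c \<subseteq> P" using c by (simp add: subset.chain_def)
    have ch: "\<exists>K\<in>c. k \<in> K \<and> k' \<in> K" if kk: "k \<in> \<Union>c" "k' \<in> \<Union>c" for k k'
    proof -
      obtain A B where "A \<in> c" "B \<in> c" "k \<in> A" "k' \<in> B" using kk by blast
      moreover have "A \<subseteq> B \<or> B \<subseteq> A" using c calculation by (auto simp: subset.chain_def)
      ultimately show ?thesis by blast
    qed
    have "disjoint (\<Union>c)" unfolding disjoint_def
    proof (intro ballI impI)
      fix k k' assume k: "k \<in> \<Union>c" "k' \<in> \<Union>c" "k \<noteq> k'"
      obtain K where K: "K \<in> c" "k \<in> K" "k' \<in> K" using ch[OF k(1,2)] by blast
      have "disjoint K" using PD(1) cP K(1) by blast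
      then show "k \<inter> k' = {}" using k(3) K(2,3) unfolding disjoint_def by blast
    qed
    moreover have "covered (\<Union>c) \<omega>'" if k: "k \<in> \<Union>c" "\<omega> \<in> R" "lv \<omega> k" "\<omega>' \<in> R" "lv \<omega>' (big D d \<omega>)" for k \<omega> \<omega>'
    proof -
      obtain K where K: "K \<in> c" "k \<in> K" using k(1) by blast
      have "K \<in> P" using K(1) cP by blast
      then have "covered K \<omega>'" using PD(4) K(2) k(2-5) by blast
      then show ?thesis using K unfolding covered_def by blast
    qed
    moreover have "\<forall>k\<in>\<Union>c. cut k \<and> k \<subseteq> D \<and> conn G k \<and> card (bd k) \<le> d \<and> (\<exists>\<omega>\<in>R. lv \<omega> k)"
      "\<forall>M\<in>N. \<forall>k\<in>\<Union>c. M \<subseteq> k \<or> M \<inter> k = {}"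
      using cP PD(2,3) by blast+
    ultimately show "\<Union>c \<in> P" unfolding P_def by (simp del: Union_iff)
  qed
  then obtain K where K: "K \<in> P" and maximal: "\<And>K'. K' \<in> P \<Longrightarrow> K \<subseteq> K' \<Longrightarrow> K' = K" by blast
  note Kdis = PD(1)[OF K]
  have Kk: "\<And>k. k \<in> K \<Longrightarrow> cut k \<and> k \<subseteq> D \<and> conn G k \<and> card (bd k) \<le> d \<and> (\<exists>\<omega>\<in>R. lv \<omega> k)"
    and KN: "\<And>M k. M \<in> N \<Longrightarrow> k \<in> K \<Longrightarrow> M \<subseteq> k \<or> M \<inter> k = {}"
    and Ksat: "\<And>k \<omega> \<omega>'. k \<in> K \<Longrightarrow> \<omega> \<in> R \<Longrightarrow> lv \<omega> k \<Longrightarrow> \<omega>' \<in> R \<Longrightarrow> lv \<omega>' (big D d \<omega>) \<Longrightarrow> covered K \<omega>'"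
    using PD(2-4)[OF K] by simp_all
  have Nlam: "laminar N" and Npf: "point_finite N" and NM: "\<And>M. M \<in> N \<Longrightarrow> cut M \<and> M \<subseteq> D \<and> conn G M \<and>
      (\<exists>\<omega>. lv \<omega> M \<and> lower D \<omega> (card (bd M)))" using N unfolding tight_def by simp_all
  have cov: "covered K \<omega>" if wR: "\<omega> \<in> R" for \<omega>
  proof (rule ccontr)
    assume nc: "\<not> covered K \<omega>"
    define B where "B = big D d \<omega>"
    define X where "X = {Z \<in> N \<union> K. Z \<inter> B \<noteq> {} \<and> \<not> Z \<subseteq> B}"
    define M where "M = B - \<Union>X"
    have B: "lv \<omega> B" "B \<subseteq> D" "card (bd B) \<le> d" "cut B" using R_big[OF wR] lv_cut by (auto simp: B_def)
    have finX: "finite X" unfolding X_def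
      using cross_finite[OF B(4) point_finite_Un[OF Npf point_finite_disjoint[OF Kdis]]] NM Kk by blast
    have nwX: "\<not> lv \<omega> Z" if "Z \<in> N \<union> K" for Z using that nc wR unfolding R_def covered_def by blast
    have no: "\<not> lv \<omega>' B" if "k \<in> K" "\<omega>' \<in> R" "lv \<omega>' k" for k \<omega>'
    proof
      assume "lv \<omega>' B"
      then have "big D d \<omega>' = B" using R_eq[OF wR that(2)] unfolding B_def by blast
      then show False using Ksat[OF that wR] B(1) nc by simp
    qed
    \<comment> \<open>For \<open>Z \<in> K\<close> any end of \<open>R\<close> in \<open>Z\<close>
      serves. For \<open>Z \<in> N\<close> the witness of tightness serves: if it lived in
      \<open>B\<close>, submodularity would make \<open>B \<union> Z\<close> a cut of size at most
      \<open>d\<close> around \<omega>, although \<open>B\<close> contains all of these.\<close>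
    have wit: "cut Z \<and> Z \<subseteq> D \<and> (\<exists>w. lv w Z \<and> \<not> lv w B \<and> lower D w (card (bd Z)))" if Z: "Z \<in> X" for Z
    proof (cases "Z \<in> K")
      case True
      then obtain w where w: "w \<in> R" "lv w Z" using Kk by blast
      have "lower D w d" using low w(1) unfolding R_def by blast
      then have "lower D w (card (bd Z))" using Kk[OF True] unfolding lower_def by (meson order_trans)
      then show ?thesis using Kk[OF True] no[OF True w] w(2) by blast
    next
      case False
      then have ZN: "Z \<in> N" using Z by (auto simp: X_def)
      then obtain w where w: "lv w Z" "lower D w (card (bd Z))" using NM by blast
      have "\<not> lv w B"
      proof
        assume wB: "lv w B"
        have "card (bd Z) \<le> card (bd (B \<inter> Z))" using lowerD[OF w(2) lv_Int(1)[OF wB w(1)]] B(2) by blast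
        then have "card (bd (B \<union> Z)) \<le> d"
          using submodular[of B Z] B(3,4) NM[OF ZN] cut_finite by fastforce
        moreover have "lv \<omega> (B \<union> Z)" using lv_mono[OF B(1)] cut_Un[OF B(4)] NM[OF ZN] by blast
        ultimately have "B \<union> Z \<subseteq> B" using big_upper[of \<omega> "B \<union> Z" D d] B(2) NM[OF ZN] unfolding B_def by blast
        then show False using Z unfolding X_def by blast
      qed
      then show ?thesis using NM[OF ZN] w by blast
    qed
    have M: "cut M" "card (bd M) \<le> d" using trim[OF finX B(4,3) wit] unfolding M_def by blast+
    have MB: "M \<subseteq> B" "M \<subseteq> D" using B(2) unfolding M_def by blast+
    have wM: "lv \<omega> M" unfolding M_def
      using lv_Diff_Union[OF finX B(1)] wit nwX unfolding X_def by blast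
    \<comment> \<open>\<open>M\<close> may have infinitely many components; those without an end of
      \<open>R\<close> are dropped, since every member of \<open>K\<close> must have one.\<close>
    define K1 where "K1 = {comp_in G M v | v. v \<in> M \<and> (\<exists>\<omega>'\<in>R. lv \<omega>' (comp_in G M v))}"
    have K1sub: "k \<subseteq> M" if "k \<in> K1" for k using that comp_in_subset[of _ M G] unfolding K1_def by blast
    \<comment> \<open>A member of \<open>K\<close> inside \<open>B\<close> would have its ends in
      \<open>B\<close>. So it misses \<open>B\<close>, or it crosses \<open>B\<close> and has been
      subtracted.\<close>
    have KM: "k \<inter> M = {}" if k: "k \<in> K" for k
    proof -
      obtain w where w: "w \<in> R" "lv w k" using Kk[OF k] by blast
      have "\<not> k \<subseteq> B" using no[OF k w] lv_mono[OF w(2) _ B(4)] by blast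
      then show ?thesis using k unfolding M_def X_def by blast
    qed
    \<comment> \<open>A member of \<open>N\<close> inside \<open>B\<close> contains no subtracted
      set, as those leave \<open>B\<close>; by nestedness it is contained in or disjoint from each
      of them.\<close>
    have NMM: "Z \<subseteq> M \<or> Z \<inter> M = {}" if Z: "Z \<in> N" for Z
    proof (cases "Z \<subseteq> B")
      case True
      have "Z \<subseteq> Y \<or> Z \<inter> Y = {}" if Y: "Y \<in> X" for Y
      proof (cases "Y \<in> K")
        case True then show ?thesis using KN Z by blast
      next
        case False
        then have "Y \<in> N" using Y by (auto simp: X_def)
        moreover have "\<not> Y \<subseteq> Z" using Y True unfolding X_def by blast
        ultimately show ?thesis using laminarD[OF Nlam] Z by blast
      qed
      then show ?thesis using True unfolding M_def by blast
    next
      case False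
      then show ?thesis using Z unfolding M_def X_def by blast
    qed
    have "K \<union> K1 \<in> P" unfolding P_def
    proof (rule CollectI, intro conjI ballI impI)
      show "disjoint (K \<union> K1)" unfolding disjoint_def
      proof (intro ballI impI)
        fix a b assume ab: "a \<in> K \<union> K1" "b \<in> K \<union> K1" "a \<noteq> b"
        have "a \<inter> b = {}" if k: "a \<in> K1" "b \<in> K1"
        proof -
          obtain v w where "a = comp_in G M v" "b = comp_in G M w" using k unfolding K1_def by blast
          then show ?thesis using comp_in_disjoint[of G M v w] ab(3) by blast
        qed
        moreover have "a \<inter> b = {}" if "a \<in> K" "b \<in> K1" using KM[OF that(1)] K1sub[OF that(2)] by blast
        moreover have "a \<inter> b = {}" if "a \<in> K1" "b \<in> K" using KM[OF that(2)] K1sub[OF that(1)] by blast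
        moreover have "a \<inter> b = {}" if "a \<in> K" "b \<in> K" using Kdis ab(3) that unfolding disjoint_def by blast
        ultimately show "a \<inter> b = {}" using ab by blast
      qed
    next
      fix k assume k: "k \<in> K \<union> K1"
      have K1k: "cut k \<and> k \<subseteq> D \<and> conn G k \<and> card (bd k) \<le> d \<and> (\<exists>\<omega>\<in>R. lv \<omega> k)" if k1: "k \<in> K1"
      proof -
        obtain v where v: "v \<in> M" "k = comp_in G M v" "\<exists>\<omega>'\<in>R. lv \<omega>' k" using k1 unfolding K1_def by blast
        have "card (bd k) \<le> card (bd M)" using bd_comp_in[OF v(1)] v(2) M(1) by (simp add: card_mono cut_finite)
        then show ?thesis using v cut_comp_in[OF M(1) v(1)] conn_comp_in[OF v(1)] K1sub[OF k1] MB M(2) by auto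
      qed
      have all: "cut k \<and> k \<subseteq> D \<and> conn G k \<and> card (bd k) \<le> d \<and> (\<exists>\<omega>\<in>R. lv \<omega> k)" using k Kk K1k by blast
      then show "cut k" "k \<subseteq> D" "conn G k" "card (bd k) \<le> d" "\<exists>\<omega>\<in>R. lv \<omega> k" by blast+
      fix w w' assume w: "w \<in> R" "lv w k" "w' \<in> R" "lv w' (big D d w)"
      show "covered (K \<union> K1) w'"
      proof (cases "k \<in> K")
        case True
        then show ?thesis using Ksat w unfolding covered_def by blast
      next
        case False
        then have "k \<subseteq> B" using k K1sub MB by blast
        then have "lv w B" using lv_mono[OF w(2) _ B(4)] by blast
        then have "big D d w = B" using R_eq[OF wR w(1)] unfolding B_def by blast
        then have w'B: "lv w' B" using w(4) by simp
        \<comment> \<open>An end of \<open>R\<close> that was trimmed off with some \<open>Z\<close>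
          has \<open>Z \<in> K\<close>, since \<open>N\<close> does not cover it. Any other lives in
          \<open>M\<close>, hence in a component that belongs to \<open>K1\<close>.\<close>
        show ?thesis
        proof (cases "\<exists>Z\<in>X. lv w' Z")
          case True
          then show ?thesis using w(3) unfolding X_def R_def covered_def by blast
        next
          case False
          then have "lv w' M" unfolding M_def using lv_Diff_Union[OF finX w'B] wit by blast
          then obtain v where v: "v \<in> M" "lv w' (comp_in G M v)" using lv_comp by blast
          then have "comp_in G M v \<in> K1" using w(3) unfolding K1_def by blast
          then show ?thesis using v(2) unfolding covered_def by blast
        qed
      qed
    next
      fix Z k assume Z: "Z \<in> N" and k: "k \<in> K \<union> K1"
      show "Z \<subseteq> k \<or> Z \<inter> k = {}"
      proof (cases "k \<in> K")
        case True then show ?thesis using KN Z by blast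
      next
        case False
        then obtain v where v: "v \<in> M" "k = comp_in G M v" using k unfolding K1_def by blast
        show ?thesis
        proof (cases "Z \<subseteq> M")
          case True
          then show ?thesis using conn_comp_in_cases[of G Z M v] v NM[OF Z] by blast
        next
          case F: False
          then show ?thesis using NMM[OF Z] K1sub[of k] k False by blast
        qed
      qed
    qed
    then have "K \<union> K1 = K" using maximal by blast
    moreover obtain v where v: "v \<in> M" "lv \<omega> (comp_in G M v)" using lv_comp[OF wM] by blast
    ultimately have "comp_in G M v \<in> K" using wR unfolding K1_def by blast
    then show False using nc v(2) unfolding covered_def by blast
  qed
  show thesis
  proof (rule that[OF Kdis])
    fix k assume k: "k \<in> K"
    have "\<exists>\<omega>. \<not> covered N \<omega> \<and> lv \<omega> k" using Kk[OF k] unfolding R_def by blast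
    then show "cut k \<and> k \<subseteq> D \<and> conn G k \<and> card (bd k) \<le> d \<and> (\<exists>\<omega>. \<not> covered N \<omega> \<and> lv \<omega> k)"
      using Kk[OF k] by simp
  next
    fix M k assume "M \<in> N" "k \<in> K" then show "M \<subseteq> k \<or> M \<inter> k = {}" by (rule KN)
  next
    fix \<omega> C assume "\<not> covered N \<omega>" "lv \<omega> C" "C \<subseteq> D" "card (bd C) \<le> d"
    then show "covered K \<omega>" by (intro cov) (auto simp: R_def)
  qed
qed

text \<open>New members contain or avoid the old ones, so an end covered before keeps its innermost
  member. A newly covered end has the lower bound \<open>d\<close>, which its layer member
  attains.\<close>

lemma add_layer:
  assumes N: "tight D N" "innermost_tight D N" and low: "\<And>\<omega>. \<not> covered N \<omega> \<Longrightarrow> lower D \<omega> d"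
  shows "\<exists>N'. N \<subseteq> N' \<and> tight D N' \<and> innermost_tight D N' \<and> (\<forall>\<omega>. \<not> covered N' \<omega> \<longrightarrow> lower D \<omega> (Suc d))"
proof (rule layer[OF N(1) low])
  fix K assume K: "disjoint K"
    and Kk: "\<And>k. k \<in> K \<Longrightarrow> cut k \<and> k \<subseteq> D \<and> conn G k \<and> card (bd k) \<le> d \<and> (\<exists>\<omega>. \<not> covered N \<omega> \<and> lv \<omega> k)"
    and KN: "\<And>M k. M \<in> N \<Longrightarrow> k \<in> K \<Longrightarrow> M \<subseteq> k \<or> M \<inter> k = {}"
    and cov: "\<And>\<omega> C. \<not> covered N \<omega> \<Longrightarrow> lv \<omega> C \<Longrightarrow> C \<subseteq> D \<Longrightarrow> card (bd C) \<le> d \<Longrightarrow> covered K \<omega>"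
  have lowk: "lower D \<omega> (card (bd k))" if "\<not> covered N \<omega>" "k \<in> K" for \<omega> k
    using low[OF that(1)] Kk[OF that(2)] unfolding lower_def by (meson order_trans)
  have lam: "laminar (N \<union> K)" unfolding laminar_def
  proof (intro ballI)
    fix A B assume "A \<in> N \<union> K" "B \<in> N \<union> K"
    moreover have "laminar N" using N(1) by (simp add: tight_def)
    ultimately show "A \<subseteq> B \<or> B \<subseteq> A \<or> A \<inter> B = {}"
      using laminarD[OF laminar_disjoint[OF K]] laminarD KN by (metis Int_commute Un_iff)
  qed
  have "tight D (N \<union> K)" unfolding tight_def
  proof (intro conjI ballI lam)
    show "point_finite (N \<union> K)" using point_finite_Un[OF _ point_finite_disjoint[OF K]] N(1) by (simp add: tight_def)
    fix M assume M: "M \<in> N \<union> K"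
    have "cut M \<and> M \<subseteq> D \<and> conn G M \<and> (\<exists>\<omega>. lv \<omega> M \<and> lower D \<omega> (card (bd M)))"
    proof (cases "M \<in> N")
      case True then show ?thesis using N(1) unfolding tight_def by blast
    next
      case False
      then have "M \<in> K" using M by blast
      then show ?thesis using Kk lowk by blast
    qed
    then show "cut M" "M \<subseteq> D" "conn G M" "\<exists>\<omega>. lv \<omega> M \<and> lower D \<omega> (card (bd M))" by blast+
  qed
  moreover have "innermost_tight D (N \<union> K)" unfolding innermost_tight_def
  proof (intro allI impI)
    fix \<omega> assume c: "covered (N \<union> K) \<omega>"
    show "\<exists>M\<in>N \<union> K. lv \<omega> M \<and> (\<forall>M'\<in>N \<union> K. lv \<omega> M' \<longrightarrow> M \<subseteq> M') \<and> lower D \<omega> (card (bd M))"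
    proof (cases "covered N \<omega>")
      case True
      then obtain M where M: "M \<in> N" "lv \<omega> M" "\<forall>M'\<in>N. lv \<omega> M' \<longrightarrow> M \<subseteq> M'" "lower D \<omega> (card (bd M))"
        using N(2) unfolding innermost_tight_def by blast
      have "M \<subseteq> k" if "k \<in> K" "lv \<omega> k" for k using KN[OF M(1) that(1)] lv_Int(2)[OF M(2) that(2)] by blast
      then show ?thesis using M by blast
    next
      case False
      then obtain k where k: "k \<in> K" "lv \<omega> k" using c unfolding covered_def by blast
      have "k \<subseteq> k'" if k': "k' \<in> N \<union> K" "lv \<omega> k'" for k'
      proof -
        have "k' \<in> K" using k' False unfolding covered_def by blast
        then show ?thesis using K k(1) lv_Int(2)[OF k(2) k'(2)] unfolding disjoint_def by blast
      qed
      then show ?thesis using k lowk[OF False k(1)] by blast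
    qed
  qed
  moreover have "lower D \<omega> (Suc d)" if w: "\<not> covered (N \<union> K) \<omega>" for \<omega>
  proof -
    have n: "\<not> covered N \<omega>" "\<not> covered K \<omega>" using w unfolding covered_def by blast+
    show ?thesis unfolding lower_def
    proof (intro allI impI)
      fix C assume "lv \<omega> C" "C \<subseteq> D"
      then show "Suc d \<le> card (bd C)" using cov[OF n(1)] n(2) by (metis not_less_eq_eq)
    qed
  qed
  ultimately show ?thesis by (intro exI[of _ "N \<union> K"]) blast
qed

lemma layers:
  assumes N: "tight D N" "innermost_tight D N"
  shows "\<exists>f. f 0 = N \<and> (\<forall>d::nat. f d \<subseteq> f (Suc d) \<and> tight D (f d) \<and> innermost_tight D (f d) \<and>
           (\<forall>\<omega>. \<not> covered (f d) \<omega> \<longrightarrow> lower D \<omega> d))"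
proof -
  \<comment> \<open>The clause for \<open>d = 0\<close> fixes the start, as the choice principle
    only asks for the existence of an initial value.\<close>
  define P where "P = (\<lambda>d N'. (d = 0 \<longrightarrow> N' = N) \<and> tight D N' \<and> innermost_tight D N' \<and>
     (\<forall>\<omega>. \<not> covered N' \<omega> \<longrightarrow> lower D \<omega> d))"
  have "\<exists>f. \<forall>d. P d (f d) \<and> f d \<subseteq> f (Suc d)"
  proof (rule dependent_nat_choice)
    show "\<exists>x. P 0 x" using N by (auto simp: P_def lower_def)
    fix x d assume "P d x"
    then show "\<exists>y. P (Suc d) y \<and> x \<subseteq> y" using add_layer[of D x d] unfolding P_def by blast
  qed
  then show ?thesis unfolding P_def by blast
qed

lemma tight_empty [simp]: "tight D {}" and innermost_tight_empty [simp]: "innermost_tight D {}"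
  by (simp_all add: tight_def innermost_tight_def laminar_def point_finite_def covered_def)

section \<open>Disjoint covers by finite cuts\<close>

lemma conn_nonempty: "conn H C \<Longrightarrow> C \<noteq> {}"
  by (simp add: conn_def)

text \<open>In the union \<open>KK\<close> of all layers a vertex may lie in infinitely many
  members. Members are grouped by whether a common member contains them; within a group the sets
  \<open>U \<rho> d\<close> increase with \<open>d\<close> and exhaust the union of the group, and
  their successive differences are disjoint cuts. Connectedness is lost here and restored by
  \<open>pieces\<close>.\<close>

lemma disjoint_cover:
  obtains P where "disjoint P" "\<And>C. C \<in> P \<Longrightarrow> cut C \<and> C \<subseteq> Q"
    "\<And>\<omega> C. lv \<omega> C \<Longrightarrow> C \<subseteq> Q \<Longrightarrow> covered P \<omega>"
proof -
  obtain f where f: "\<And>d. f d \<subseteq> f (Suc d)" "\<And>d. tight Q (f d)"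
    "\<And>d \<omega>. \<not> covered (f d) \<omega> \<Longrightarrow> lower Q \<omega> d"
    using layers[OF tight_empty innermost_tight_empty, of Q] by blast
  have fmono: "f i \<subseteq> f j" if "i \<le> j" for i j using that f(1) by (rule lift_Suc_mono_le[rotated])
  define KK where "KK = (\<Union>d. f d)"
  have fKK: "f d \<subseteq> KK" for d by (auto simp: KK_def)
  have fD: "cut K \<and> K \<subseteq> Q \<and> K \<noteq> {}" if "K \<in> f d" for K d
    using that f(2)[of d] conn_nonempty unfolding tight_def by blast
  have lam: "A \<subseteq> B \<or> B \<subseteq> A \<or> A \<inter> B = {}" if AB: "A \<in> KK" "B \<in> KK" for A B
  proof -
    obtain i j where "A \<in> f i" "B \<in> f j" using AB by (auto simp: KK_def)
    then have "A \<in> f (max i j)" "B \<in> f (max i j)" using fmono[of i "max i j"] fmono[of j "max i j"] by auto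
    then show ?thesis using f(2)[of "max i j"] laminarD unfolding tight_def by blast
  qed
  define r where "r = (\<lambda>A B. A \<in> KK \<and> B \<in> KK \<and> (\<exists>C\<in>KK. A \<subseteq> C \<and> B \<subseteq> C))"
  have r_sym: "r A B \<Longrightarrow> r B A" for A B by (auto simp: r_def)
  \<comment> \<open>Both witnesses contain the nonempty set \<open>B\<close> and are therefore
    nested.\<close>
  have r_trans: "r A C" if "r A B" "r B C" for A B C
  proof -
    obtain X Y where XY: "X \<in> KK" "Y \<in> KK" "A \<subseteq> X" "B \<subseteq> X" "B \<subseteq> Y" "C \<subseteq> Y"
      using \<open>r A B\<close> \<open>r B C\<close> unfolding r_def by blast
    have "B \<in> KK" using \<open>r A B\<close> by (simp add: r_def)
    then have "B \<noteq> {}" using fD by (auto simp: KK_def)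
    then have "X \<subseteq> Y \<or> Y \<subseteq> X" using lam[OF XY(1,2)] XY(4,5) by blast
    then have "\<exists>Z\<in>KK. A \<subseteq> Z \<and> C \<subseteq> Z" using XY(1-3,6) by (metis subset_trans)
    moreover have "A \<in> KK" "C \<in> KK" using \<open>r A B\<close> \<open>r B C\<close> by (simp_all add: r_def)
    ultimately show ?thesis by (simp add: r_def)
  qed
  define rep where "rep = (\<lambda>A. SOME B. r A B)"
  have rep: "r A (rep A)" if "A \<in> KK" for A
    unfolding rep_def by (rule someI[of _ A]) (use that in \<open>auto simp: r_def\<close>)
  \<comment> \<open>Equivalent members have equal predicates \<open>r A = r B\<close>, so the choice
    operator picks the same representative for a whole class.\<close>
  have rep_eq: "rep A = rep B" if "r A B" for A B
  proof -
    have "r A X \<longleftrightarrow> r B X" for X using r_trans[OF \<open>r A B\<close>] r_trans[OF r_sym[OF \<open>r A B\<close>]] by blast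
    then have "r A = r B" by blast
    then show ?thesis by (simp add: rep_def)
  qed
  \<comment> \<open>By point-finiteness of \<open>f d\<close> this is a finite union of cuts; it is
    empty until some member of \<open>f d\<close> contains \<rho>.\<close>
  define U where "U = (\<lambda>\<rho> d. \<Union>{K \<in> f d. \<rho> \<subseteq> K})"
  define piece where "piece = (\<lambda>\<rho> d. U \<rho> d - \<Union>(U \<rho> ` {..<d}))"
  define P where "P = {piece (rep A) d | A d. A \<in> KK}"
  have repKK: "rep A \<in> KK" if "A \<in> KK" for A using rep[OF that] by (simp add: r_def)
  have Ucut: "cut (U \<rho> d)" if "\<rho> \<in> KK" for \<rho> d unfolding U_def
  proof (rule cut_Union)
    have "\<rho> \<noteq> {}" using that fD by (auto simp: KK_def)
    then obtain v where "v \<in> \<rho>" by blast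
    then have "{K \<in> f d. \<rho> \<subseteq> K} \<subseteq> {K \<in> f d. v \<in> K}" by blast
    moreover have "finite {K \<in> f d. v \<in> K}" using f(2)[of d] unfolding tight_def point_finite_def by simp
    ultimately show "finite {K \<in> f d. \<rho> \<subseteq> K}" by (rule finite_subset)
  qed (use fD in blast)
  show thesis
  proof (rule that[of P])
    show "disjoint P" unfolding disjoint_def
    proof (intro ballI impI)
      fix X Y assume XY: "X \<in> P" "Y \<in> P" "X \<noteq> Y"
      obtain A i where A: "A \<in> KK" "X = piece (rep A) i" using XY(1) unfolding P_def by blast
      obtain B j where B: "B \<in> KK" "Y = piece (rep B) j" using XY(2) unfolding P_def by blast
      show "X \<inter> Y = {}"
      proof (rule ccontr)
        assume "X \<inter> Y \<noteq> {}"
        then obtain x where x: "x \<in> X" "x \<in> Y" by blast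
        have x1: "x \<in> U (rep A) i" using x(1) unfolding A piece_def by blast
        have x2: "x \<in> U (rep B) j" using x(2) unfolding B piece_def by blast
        obtain K1 where K1: "K1 \<in> KK" "x \<in> K1" "rep A \<subseteq> K1" using x1 fKK[of i] unfolding U_def by blast
        obtain K2 where K2: "K2 \<in> KK" "x \<in> K2" "rep B \<subseteq> K2" using x2 fKK[of j] unfolding U_def by blast
        have "K1 \<subseteq> K2 \<or> K2 \<subseteq> K1" using lam[OF K1(1) K2(1)] K1(2) K2(2) by blast
        then have "\<exists>Z\<in>KK. rep A \<subseteq> Z \<and> rep B \<subseteq> Z" using K1(1,3) K2(1,3) by (metis subset_trans)
        then have "r (rep A) (rep B)" using repKK[OF A(1)] repKK[OF B(1)] by (simp add: r_def)
        then have "r A B" using r_trans[OF r_trans[OF rep[OF A(1)]] r_sym[OF rep[OF B(1)]]] by blast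
        then have eq: "rep A = rep B" by (rule rep_eq)
        have "\<not> i < j" using x(2) x1 unfolding B piece_def eq by blast
        moreover have "\<not> j < i" using x(1) x2 unfolding A piece_def eq by blast
        ultimately have "i = j" by simp
        then show False using XY(3) A(2) B(2) eq by simp
      qed
    qed
    fix C assume "C \<in> P"
    then obtain A i where A: "A \<in> KK" "C = piece (rep A) i" unfolding P_def by blast
    have "cut C" unfolding A piece_def
      by (rule cut_Diff[OF Ucut cut_Union]) (use Ucut repKK A in auto)
    moreover have "C \<subseteq> Q" using fD unfolding A piece_def U_def by blast
    ultimately show "cut C \<and> C \<subseteq> Q" ..
  next
    fix \<omega> C assume C: "lv \<omega> C" "C \<subseteq> Q"
    \<comment> \<open>The successor makes the lower bound for uncovered ends exceed the size of
      \<open>C\<close>.\<close>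
    define d where "d = Suc (card (bd C))"
    have "covered (f d) \<omega>"
    proof (rule ccontr)
      assume "\<not> covered (f d) \<omega>"
      then have "d \<le> card (bd C)" using f(3) lowerD C by blast
      then show False by (simp add: d_def)
    qed
    then obtain K where K: "K \<in> f d" "lv \<omega> K" unfolding covered_def by blast
    then have KKK: "K \<in> KK" using fKK by blast
    obtain L where L: "L \<in> KK" "K \<subseteq> L" "rep K \<subseteq> L" using rep[OF KKK] unfolding r_def by blast
    then obtain i where i: "L \<in> f i" by (auto simp: KK_def)
    have "K \<subseteq> U (rep K) i" using L i unfolding U_def by blast
    then have "lv \<omega> (U (rep K) i)" using lv_mono[OF K(2)] Ucut[OF repKK[OF KKK]] by blast
    then have ex: "\<exists>i. lv \<omega> (U (rep K) i)" ..
    \<comment> \<open>With the least index, \<omega> lives in none of the earlier sets and therefore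
      in their difference.\<close>
    define j where "j = (LEAST i. lv \<omega> (U (rep K) i))"
    have j: "lv \<omega> (U (rep K) j)" unfolding j_def using ex by (rule LeastI_ex)
    have "\<not> lv \<omega> (U (rep K) i)" if "i < j" for i using not_less_Least that unfolding j_def by blast
    then have "lv \<omega> (piece (rep K) j)" unfolding piece_def
      by (intro lv_Diff_Union[OF _ j]) (use Ucut[OF repKK[OF KKK]] in auto)
    then show "covered P \<omega>" using KKK unfolding P_def covered_def by blast
  qed
qed

section \<open>Refining a cut so that it is nested with a laminar family\<close>

definition atom :: "'v set set \<Rightarrow> 'v set \<Rightarrow> 'v \<Rightarrow> 'v set" where
  "atom N C v = {w \<in> C. \<forall>L\<in>N. \<not> L \<subseteq> C \<longrightarrow> (w \<in> L \<longleftrightarrow> v \<in> L)}"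

text \<open>Atoms are separated only by members of \<open>N\<close> that leave \<open>C\<close>.
  Members inside \<open>C\<close> are deliberately ignored, as they are to survive inside a
  piece.\<close>

definition pieces :: "'v set set \<Rightarrow> 'v set \<Rightarrow> 'v set set" where
  "pieces N C = {comp_in G (atom N C v) v | v. v \<in> C}"

lemma atom_eq: "w \<in> atom N C v \<Longrightarrow> atom N C w = atom N C v"
  by (auto simp: atom_def)

lemma atom_self: "v \<in> C \<Longrightarrow> v \<in> atom N C v"
  by (simp add: atom_def)

text \<open>Only members crossing \<open>C\<close> distinguish vertices of \<open>C\<close>. With
  \<open>S\<close> those that contain \<open>v\<close>, the atom arises by subtracting
  \<open>C - L\<close> for each \<open>L\<close> in \<open>S\<close> and \<open>L\<close> for the
  other crossing members. As finitely many members cross, this shows that atoms are finite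
  cuts.\<close>

lemma atom_alt:
  assumes "cut C" "S \<subseteq> X" "X = {L \<in> N. L \<inter> C \<noteq> {} \<and> \<not> L \<subseteq> C}"
    and v: "v \<in> C - \<Union>((\<lambda>L. C - L) ` S \<union> (X - S))"
  shows "atom N C v = C - \<Union>((\<lambda>L. C - L) ` S \<union> (X - S))"
proof -
  have vL: "v \<in> L \<longleftrightarrow> L \<in> S" if "L \<in> X" for L using v that by blast
  have "w \<in> atom N C v \<longleftrightarrow> w \<in> C - \<Union>((\<lambda>L. C - L) ` S \<union> (X - S))" if w: "w \<in> C" for w
  proof -
    have "w \<in> atom N C v \<longleftrightarrow> (\<forall>L\<in>X. w \<in> L \<longleftrightarrow> v \<in> L)"
      using w v unfolding atom_def assms(3) by blast
    also have "\<dots> \<longleftrightarrow> (\<forall>L\<in>X. w \<in> L \<longleftrightarrow> L \<in> S)" using vL by blast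
    also have "\<dots> \<longleftrightarrow> w \<in> C - \<Union>((\<lambda>L. C - L) ` S \<union> (X - S))" using w assms(2) by blast
    finally show ?thesis .
  qed
  moreover have "atom N C v \<subseteq> C" by (auto simp: atom_def)
  ultimately show ?thesis by blast
qed

text \<open>A member \<open>L\<close> inside \<open>C\<close> is contained in or disjoint from every
  member that leaves \<open>C\<close>, hence lies in one atom or, being connected, in one component
  of it. A member not inside \<open>C\<close> contains or misses each atom by definition. An end
  selects its atom by the crossing members in which it lives.\<close>

lemma pieces_props:
  assumes C: "cut C" and N: "laminar N" "point_finite N" "\<forall>L\<in>N. cut L \<and> conn G L"
  shows "p \<in> pieces N C \<Longrightarrow> cut p \<and> p \<subseteq> C \<and> conn G p"
    and "disjoint (pieces N C)"
    and "p \<in> pieces N C \<Longrightarrow> L \<in> N \<Longrightarrow> L \<subseteq> p \<or> p \<subseteq> L \<or> L \<inter> p = {}"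
    and "lv \<omega> C \<Longrightarrow> covered (pieces N C) \<omega>"
proof -
  define X where "X = {L \<in> N. L \<inter> C \<noteq> {} \<and> \<not> L \<subseteq> C}"
  have finX: "finite X" unfolding X_def using cross_finite[OF C N(2)] N(3) by blast
  have Xcut: "cut L" if "L \<in> X" for L using that N(3) by (auto simp: X_def)
  have cuts: "cut L" if "S \<subseteq> X" "L \<in> (\<lambda>L. C - L) ` S \<union> (X - S)" for S L
    using \<open>S \<subseteq> X\<close> \<open>L \<in> _\<close> Xcut cut_Diff[OF C] by blast
  have fin: "finite ((\<lambda>L. C - L) ` S \<union> (X - S))" if "S \<subseteq> X" for S
    using finX finite_subset[OF that finX] by simp
  have cut_atom: "cut (atom N C v)" if v: "v \<in> C" for v
  proof -
    let ?S = "{L \<in> X. v \<in> L}"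
    have S: "?S \<subseteq> X" by blast
    have "v \<in> C - \<Union>((\<lambda>L. C - L) ` ?S \<union> (X - ?S))" using v by blast
    from atom_alt[OF C S X_def this] show ?thesis
      using cut_Diff[OF C cut_Union[OF fin[OF S] cuts[OF S]]] by simp
  qed
  have atomC: "atom N C v \<subseteq> C" for v by (auto simp: atom_def)
  have compsub: "comp_in G (atom N C v) v \<subseteq> atom N C v" if "v \<in> C" for v
    by (rule comp_in_subset[OF atom_self[OF that]])
  show "cut p \<and> p \<subseteq> C \<and> conn G p" if p: "p \<in> pieces N C"
  proof -
    obtain v where v: "v \<in> C" "p = comp_in G (atom N C v) v" using p unfolding pieces_def by blast
    then show ?thesis using cut_comp_in[OF cut_atom[OF v(1)] atom_self[OF v(1)]] compsub[OF v(1)] atomC[of v]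
        conn_comp_in[OF atom_self[OF v(1)]] by auto
  qed
  show "disjoint (pieces N C)" unfolding disjoint_def
  proof (intro ballI impI)
    fix p q assume pq: "p \<in> pieces N C" "q \<in> pieces N C" "p \<noteq> q"
    obtain v where v: "v \<in> C" "p = comp_in G (atom N C v) v" using pq(1) unfolding pieces_def by blast
    obtain w where w: "w \<in> C" "q = comp_in G (atom N C w) w" using pq(2) unfolding pieces_def by blast
    show "p \<inter> q = {}"
    proof (rule ccontr)
      assume "p \<inter> q \<noteq> {}"
      then obtain x where x: "x \<in> p" "x \<in> q" by blast
      then have "x \<in> atom N C v" "x \<in> atom N C w" using compsub v w by auto
      then have "atom N C v = atom N C w" using atom_eq by metis
      then have "p = q" using x comp_in_eq v(2) w(2) by metis
      then show False using pq(3) by blast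
    qed
  qed
  show "L \<subseteq> p \<or> p \<subseteq> L \<or> L \<inter> p = {}" if p: "p \<in> pieces N C" and L: "L \<in> N"
  proof -
    obtain v where v: "v \<in> C" "p = comp_in G (atom N C v) v" using p unfolding pieces_def by blast
    have psub: "p \<subseteq> atom N C v" using compsub v by simp
    show ?thesis
    proof (cases "L \<subseteq> C")
      case False
      then have "atom N C v \<subseteq> L \<or> L \<inter> atom N C v = {}" using L unfolding atom_def by blast
      then show ?thesis using psub by blast
    next
      case True
      have "L \<subseteq> atom N C v \<or> L \<inter> atom N C v = {}"
      proof (rule ccontr)
        assume "\<not> ?thesis"
        then obtain u x where ux: "u \<in> L" "u \<in> atom N C v" "x \<in> L" "x \<notin> atom N C v" by blast
        then obtain L' where L': "L' \<in> N" "\<not> L' \<subseteq> C" "(x \<in> L') \<noteq> (v \<in> L')" using True unfolding atom_def by blast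
        then have "(u \<in> L') = (v \<in> L')" using ux(2) unfolding atom_def by blast
        then have "(x \<in> L') \<noteq> (u \<in> L')" using L'(3) by blast
        moreover have "L \<subseteq> L' \<or> L \<inter> L' = {}" using laminarD[OF N(1) L L'(1)] True L'(2) by blast
        ultimately show False using ux by blast
      qed
      then show ?thesis
        using conn_comp_in_cases[of G L "atom N C v" v] bspec[OF N(3) L] atom_self[OF v(1)] v(2) psub by blast
    qed
  qed
  show "covered (pieces N C) \<omega>" if w: "lv \<omega> C"
  proof -
    let ?S = "{L \<in> X. lv \<omega> L}"
    let ?A = "C - \<Union>((\<lambda>L. C - L) ` ?S \<union> (X - ?S))"
    have S: "?S \<subseteq> X" by blast
    have "\<not> lv \<omega> (C - L)" if "lv \<omega> L" for L using lv_Int(2)[OF that, of "C - L"] by blast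
    then have "lv \<omega> ?A" by (intro lv_Diff_Union[OF fin[OF S] w cuts[OF S]]) auto
    then obtain v where v: "v \<in> ?A" "lv \<omega> (comp_in G ?A v)" using lv_comp by blast
    have "atom N C v = ?A" by (rule atom_alt[OF C S X_def v(1)])
    then have "lv \<omega> (comp_in G (atom N C v) v)" using v(2) by simp
    moreover have "comp_in G (atom N C v) v \<in> pieces N C" unfolding pieces_def
      by (intro CollectI exI[of _ v] conjI refl DiffD1[OF v(1)])
    ultimately show ?thesis unfolding covered_def by (rule bexI)
  qed
qed

lemma nested_cover:
  assumes N: "laminar N" "point_finite N" "\<forall>L\<in>N. cut L \<and> conn G L"
  obtains P where "disjoint P" "\<And>C. C \<in> P \<Longrightarrow> cut C \<and> C \<subseteq> Q \<and> conn G C"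
    "\<And>C L. C \<in> P \<Longrightarrow> L \<in> N \<Longrightarrow> L \<subseteq> C \<or> C \<subseteq> L \<or> L \<inter> C = {}"
    "\<And>\<omega> C. lv \<omega> C \<Longrightarrow> C \<subseteq> Q \<Longrightarrow> covered P \<omega>"
proof (rule disjoint_cover[of Q])
  fix P0 assume P0: "disjoint P0" "\<And>C. C \<in> P0 \<Longrightarrow> cut C \<and> C \<subseteq> Q"
    "\<And>\<omega> C. lv \<omega> C \<Longrightarrow> C \<subseteq> Q \<Longrightarrow> covered P0 \<omega>"
  note pp = pieces_props[OF conjunct1[OF P0(2)] N]
  show thesis
  proof (rule that[of "\<Union>(pieces N ` P0)"])
    show "disjoint (\<Union>(pieces N ` P0))" unfolding disjoint_def
    proof (intro ballI impI)
      fix p q assume pq: "p \<in> \<Union>(pieces N ` P0)" "q \<in> \<Union>(pieces N ` P0)" "p \<noteq> q"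
      obtain A where A: "A \<in> P0" "p \<in> pieces N A" using pq(1) by blast
      obtain B where B: "B \<in> P0" "q \<in> pieces N B" using pq(2) by blast
      show "p \<inter> q = {}"
      proof (cases "A = B")
        case True
        then show ?thesis using pp(2)[OF A(1)] A(2) B(2) pq(3) unfolding disjoint_def by blast
      next
        case False
        then have "A \<inter> B = {}" using P0(1) A(1) B(1) unfolding disjoint_def by blast
        then show ?thesis using pp(1)[OF A] pp(1)[OF B] by blast
      qed
    qed
  next
    fix C assume "C \<in> \<Union>(pieces N ` P0)"
    then obtain A where A: "A \<in> P0" "C \<in> pieces N A" by blast
    then show "cut C \<and> C \<subseteq> Q \<and> conn G C" using pp(1)[OF A] P0(2)[OF A(1)] by blast
    fix L assume "L \<in> N"
    then show "L \<subseteq> C \<or> C \<subseteq> L \<or> L \<inter> C = {}" by (rule pp(3)[OF A])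
  next
    fix \<omega> C assume "lv \<omega> C" "C \<subseteq> Q"
    then obtain A where A: "A \<in> P0" "lv \<omega> A" using P0(3) unfolding covered_def by blast
    then show "covered (\<Union>(pieces N ` P0)) \<omega>" using pp(4)[OF A(1,2)] unfolding covered_def by blast
  qed
qed

subsection \<open>Balls around a set of roots\<close>

text \<open>The choice depends on the component as a set only, so each component of \<open>G\<close>
  receives one root.\<close>

definition root :: "'v \<Rightarrow> 'v" where
  "root v = (SOME w. w \<in> comp_in G (verts G) v)"

primrec ball :: "nat \<Rightarrow> 'v set" where
  "ball 0 = root ` verts G"
| "ball (Suc n) = ball n \<union> {w. \<exists>u\<in>ball n. (u, w) \<in> adj G}"

lemma root_in: "root v \<in> comp_in G (verts G) v"
  unfolding root_def by (rule someI[of _ v]) simp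

lemma ball_mono: "i \<le> j \<Longrightarrow> ball i \<subseteq> ball j"
  by (rule lift_Suc_mono_le) auto

lemma ball_exhausts: assumes "v \<in> verts G" shows "\<exists>n. v \<in> ball n"
proof -
  have "(v, root v) \<in> (adj G \<inter> verts G \<times> verts G)\<^sup>*" using root_in[of v] by (simp add: comp_in_def)
  then have "(root v, v) \<in> (adj G \<inter> verts G \<times> verts G)\<^sup>*" by (rule adj_reach_sym)
  then show ?thesis
  proof (induction rule: rtrancl_induct)
    case base
    then show ?case using assms by (intro exI[of _ 0]) simp
  next
    case (step y z)
    then obtain n where "y \<in> ball n" by blast
    then have "z \<in> ball (Suc n)" using step(2) by auto
    then show ?case ..
  qed
qed

lemma avoid_finite:
  assumes w: "\<omega> \<in> undominated_edge_ends G" and "finite Y" "lv \<omega> C"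
  shows "\<exists>C'. lv \<omega> C' \<and> C' \<subseteq> C \<and> C' \<inter> Y = {}"
  using assms(2)
proof (induction Y rule: finite_induct)
  case empty
  then show ?case using assms(3) by blast
next
  case (insert y Y)
  then obtain C' where C': "lv \<omega> C'" "C' \<subseteq> C" "C' \<inter> Y = {}" by blast
  show ?case
  proof (cases "y \<in> verts G")
    case True
    then obtain D where "lv \<omega> D" "y \<notin> D" using w unfolding undominated_iff by blast
    then show ?thesis using lv_Int(1)[OF C'(1), of D] C' by (intro exI[of _ "C' \<inter> D"]) auto
  next
    case False
    then have "y \<notin> C'" using cut_subset[OF lv_cut[OF C'(1)]] by blast
    then show ?thesis using C' by (intro exI[of _ C']) auto
  qed
qed

text \<open>The start uses that an end lives in one component, which contains a single root; the
  step, that a cut avoiding one ball meets the next only in end vertices of its boundary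
  edges.\<close>

lemma avoid_ball:
  assumes w: "\<omega> \<in> undominated_edge_ends G"
  shows "\<exists>C. lv \<omega> C \<and> C \<inter> ball n = {}"
proof (induction n)
  case 0
  have wE: "\<omega> \<in> edge_ends G" using w by (simp add: undominated_iff)
  obtain v where v: "v \<in> verts G" "lv \<omega> (comp_in G (verts G) v)" using lv_comp[OF lv_verts[OF wE]] by blast
  let ?K = "comp_in G (verts G) v"
  obtain C where C: "lv \<omega> C" "C \<subseteq> ?K" "C \<inter> {root v} = {}" using avoid_finite[OF w _ v(2), of "{root v}"] by auto
  have "u \<notin> C" if u: "u \<in> ball 0" for u
  proof
    assume uC: "u \<in> C"
    obtain x where x: "x \<in> verts G" "u = root x" using u by auto
    have "comp_in G (verts G) x = comp_in G (verts G) u" using comp_in_eq[OF root_in[of x]] x(2) by simp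
    also have "\<dots> = ?K" using comp_in_eq[of u G "verts G" v] uC C(2) by blast
    finally have "root x = root v" by (simp add: root_def)
    then show False using uC x C(3) by blast
  qed
  then show ?case using C(1) by blast
next
  case (Suc n)
  then obtain C where C: "lv \<omega> C" "C \<inter> ball n = {}" by blast
  obtain C' where C': "lv \<omega> C'" "C' \<subseteq> C" "C' \<inter> \<Union>(endpoints G ` bd C) = {}"
    using avoid_finite[OF w finite_bd_endpoints[OF lv_cut[OF C(1)]] C(1)] by blast
  have "z \<notin> C'" if z: "z \<in> ball (Suc n)" for z
  proof
    assume zC: "z \<in> C'"
    then have "z \<in> C" "z \<notin> ball n" using C C' by blast+
    then obtain u where u: "u \<in> ball n" "(u, z) \<in> adj G" using z by auto
    then obtain e where e: "e \<in> edges G" "endpoints G e = {u, z}" by (auto simp: adj_def)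
    have "e \<in> bd C" using bd_iff[OF e] \<open>z \<in> C\<close> u(1) C(2) by blast
    then show False using C'(3) e(2) zC by blast
  qed
  then show ?case using C'(1) by blast
qed

text \<open>\<open>DD\<close> is the current cover of the undominated edge-ends and \<open>MM\<close> consists of the layers inside its
  members. A set in \<open>MM\<close> is retained for as long as it lies inside a member of the current cover.\<close>

definition below :: "'v set set \<Rightarrow> 'v set \<Rightarrow> 'v set set" where
  "below MM D = {M \<in> MM. M \<subseteq> D}"

definition stage :: "nat \<Rightarrow> 'v set set \<times> 'v set set \<Rightarrow> bool" where
  "stage n s \<longleftrightarrow> (case s of (DD, MM) \<Rightarrow>
     disjoint DD \<and> (\<forall>D\<in>DD. cut D \<and> conn G D) \<and> (\<forall>M\<in>MM. \<exists>D\<in>DD. M \<subseteq> D) \<and>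
     (\<forall>D\<in>DD. tight D (below MM D) \<and> innermost_tight D (below MM D) \<and>
        (\<forall>\<omega>. \<not> covered (below MM D) \<omega> \<longrightarrow> lower D \<omega> n)) \<and>
     (\<forall>\<omega>\<in>undominated_edge_ends G. covered DD \<omega>))"

text \<open>Avoiding the balls will make the final family point-finite, the second clause makes it
  laminar, and the third keeps old layers alive inside the new cover.\<close>

definition refines :: "nat \<Rightarrow> 'v set set \<times> 'v set set \<Rightarrow> 'v set set \<times> 'v set set \<Rightarrow> bool" where
  "refines n s s' \<longleftrightarrow> (case s of (DD, MM) \<Rightarrow> case s' of (DD', MM') \<Rightarrow>
     (\<forall>D'\<in>DD'. \<exists>D\<in>DD. D' \<subseteq> D - ball n) \<and>
     (\<forall>M\<in>MM. \<forall>D'\<in>DD'. M \<subseteq> D' \<or> D' \<subseteq> M \<or> M \<inter> D' = {}) \<and>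
     (\<forall>M\<in>MM. \<forall>D'\<in>DD'. M \<subseteq> D' \<longrightarrow> M \<in> MM'))"

section \<open>The recursion over the stages\<close>

lemma lower_subset: "lower D \<omega> k \<Longrightarrow> D' \<subseteq> D \<Longrightarrow> lower D' \<omega> k"
  by (auto simp: lower_def)

text \<open>Fewer cuts compete inside \<open>D'\<close>, so minimum cuts remain minimum. The
  innermost member around an end is contained in every other member around it, so it survives if any
  of them does.\<close>

lemma tight_subset:
  assumes "tight D N" "innermost_tight D N" "D' \<subseteq> D"
  shows "tight D' (below N D')" "innermost_tight D' (below N D')"
proof -
  have N: "laminar N" "point_finite N" "\<And>M. M \<in> N \<Longrightarrow> cut M \<and> M \<subseteq> D \<and> conn G M \<and> (\<exists>\<omega>. lv \<omega> M \<and> lower D \<omega> (card (bd M)))"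
    using assms(1) unfolding tight_def by simp_all
  have "laminar (below N D')" using N(1) unfolding laminar_def below_def by blast
  moreover have "point_finite (below N D')" by (rule point_finite_subset[OF N(2)]) (auto simp: below_def)
  moreover have "cut M \<and> M \<subseteq> D' \<and> conn G M \<and> (\<exists>\<omega>. lv \<omega> M \<and> lower D' \<omega> (card (bd M)))" if "M \<in> below N D'" for M
    using N(3)[of M] lower_subset[OF _ assms(3)] that unfolding below_def by blast
  ultimately show "tight D' (below N D')" unfolding tight_def by simp
  show "innermost_tight D' (below N D')" unfolding innermost_tight_def
  proof (intro allI impI)
    fix \<omega> assume "covered (below N D') \<omega>"
    then obtain M0 where M0: "M0 \<in> N" "M0 \<subseteq> D'" "lv \<omega> M0" unfolding covered_def below_def by blast
    then have "covered N \<omega>" unfolding covered_def by blast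
    then obtain M where M: "M \<in> N" "lv \<omega> M" "\<forall>M'\<in>N. lv \<omega> M' \<longrightarrow> M \<subseteq> M'" "lower D \<omega> (card (bd M))"
      using assms(2) unfolding innermost_tight_def by blast
    have "M \<subseteq> D'" using M(3) M0 by blast
    then have "M \<in> below N D'" using M(1) by (simp add: below_def)
    moreover have "\<forall>M'\<in>below N D'. lv \<omega> M' \<longrightarrow> M \<subseteq> M'" using M(3) by (simp add: below_def)
    ultimately show "\<exists>M\<in>below N D'. lv \<omega> M \<and> (\<forall>M'\<in>below N D'. lv \<omega> M' \<longrightarrow> M \<subseteq> M') \<and> lower D' \<omega> (card (bd M))"
      using M(2) lower_subset[OF M(4) assms(3)] by blast
  qed
qed

lemma below_below: "D' \<subseteq> D \<Longrightarrow> below (below N D) D' = below N D'"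
  by (auto simp: below_def)

lemma stage_init: "\<exists>s. stage 0 s"
proof -
  let ?DD = "{comp_in G (verts G) v | v. v \<in> verts G}"
  have "stage 0 (?DD, {})" unfolding stage_def prod.case
  proof (intro conjI ballI)
    show "disjoint ?DD" unfolding disjoint_def using comp_in_disjoint[of G "verts G"] by blast
    fix D assume "D \<in> ?DD"
    then obtain v where v: "v \<in> verts G" "D = comp_in G (verts G) v" by blast
    show "cut D" "conn G D" using cut_comp_in[OF cut_verts v(1)] conn_comp_in[OF v(1)] v(2) by auto
    show "\<forall>\<omega>. \<not> covered (below {} D) \<omega> \<longrightarrow> lower D \<omega> 0" by (simp add: lower_def)
    have "below {} D = {}" by (simp add: below_def)
    then show "tight D (below {} D)" "innermost_tight D (below {} D)" by simp_all
  next
    fix \<omega> assume "\<omega> \<in> undominated_edge_ends G"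
    then have "\<omega> \<in> edge_ends G" by (simp add: undominated_iff)
    then show "covered ?DD \<omega>" using lv_comp[OF lv_verts] unfolding covered_def by blast
  qed simp
  then show ?thesis ..
qed

text \<open>Inside each \<open>D\<close> the part outside the ball is covered disjointly by sets
  nested with the present layers; inside each new set the retained layers are completed up to size
  \<open>n\<close>. Completing them, instead of restarting, lets a layer set persist as required by
  \<open>refines\<close>.\<close>

lemma stage_step:
  assumes s: "stage n s"
  shows "\<exists>s'. stage (Suc n) s' \<and> refines n s s'"
proof -
  obtain DD MM where sD: "s = (DD, MM)" by (cases s)
  have DD: "disjoint DD" "\<And>D. D \<in> DD \<Longrightarrow> cut D \<and> conn G D" "\<And>M. M \<in> MM \<Longrightarrow> \<exists>D\<in>DD. M \<subseteq> D"
    "\<And>D. D \<in> DD \<Longrightarrow> tight D (below MM D)" "\<And>D. D \<in> DD \<Longrightarrow> innermost_tight D (below MM D)"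
    "\<And>\<omega>. \<omega> \<in> undominated_edge_ends G \<Longrightarrow> covered DD \<omega>"
    using s unfolding stage_def sD by simp_all
  have "\<exists>P. disjoint P \<and> (\<forall>C\<in>P. cut C \<and> C \<subseteq> D - ball n \<and> conn G C) \<and>
    (\<forall>C\<in>P. \<forall>L\<in>below MM D. L \<subseteq> C \<or> C \<subseteq> L \<or> L \<inter> C = {}) \<and>
    (\<forall>\<omega> C. lv \<omega> C \<longrightarrow> C \<subseteq> D - ball n \<longrightarrow> covered P \<omega>)" if D: "D \<in> DD" for D
  proof -
    have N: "laminar (below MM D)" "point_finite (below MM D)" "\<forall>L\<in>below MM D. cut L \<and> conn G L"
      using DD(4)[OF D] unfolding tight_def by simp_all
    show ?thesis by (rule nested_cover[OF N, of "D - ball n"]) (rule exI, intro conjI, assumption, simp_all)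
  qed
  then have "\<forall>D\<in>DD. \<exists>P. disjoint P \<and> (\<forall>C\<in>P. cut C \<and> C \<subseteq> D - ball n \<and> conn G C) \<and>
    (\<forall>C\<in>P. \<forall>L\<in>below MM D. L \<subseteq> C \<or> C \<subseteq> L \<or> L \<inter> C = {}) \<and>
    (\<forall>\<omega> C. lv \<omega> C \<longrightarrow> C \<subseteq> D - ball n \<longrightarrow> covered P \<omega>)" by (rule ballI)
  from bchoice[OF this] obtain P where P: "\<forall>D\<in>DD. disjoint (P D) \<and> (\<forall>C\<in>P D. cut C \<and> C \<subseteq> D - ball n \<and> conn G C) \<and>
    (\<forall>C\<in>P D. \<forall>L\<in>below MM D. L \<subseteq> C \<or> C \<subseteq> L \<or> L \<inter> C = {}) \<and>
    (\<forall>\<omega> C. lv \<omega> C \<longrightarrow> C \<subseteq> D - ball n \<longrightarrow> covered (P D) \<omega>)" ..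
  have P1: "cut C \<and> C \<subseteq> D - ball n \<and> conn G C" if "D \<in> DD" "C \<in> P D" for C D using P that by simp
  define DD' where "DD' = \<Union>(P ` DD)"
  have DD'_obt: "\<exists>D\<in>DD. C \<in> P D" if "C \<in> DD'" for C using that by (simp add: DD'_def)
  have DD'_sub: "\<exists>D\<in>DD. C \<subseteq> D - ball n" if C: "C \<in> DD'" for C using DD'_obt[OF C] P1 by blast
  have DD'_dis: "disjoint DD'" unfolding disjoint_def
  proof (intro ballI impI)
    fix p q assume pq: "p \<in> DD'" "q \<in> DD'" "p \<noteq> q"
    obtain A where A: "A \<in> DD" "p \<in> P A" using DD'_obt[OF pq(1)] by blast
    obtain B where B: "B \<in> DD" "q \<in> P B" using DD'_obt[OF pq(2)] by blast
    show "p \<inter> q = {}"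
    proof (cases "A = B")
      case True
      have "disjoint (P A)" using P A(1) by simp
      then show ?thesis using True A(2) B(2) pq(3) unfolding disjoint_def by blast
    next
      case False
      then have "A \<inter> B = {}" using DD(1) A(1) B(1) unfolding disjoint_def by blast
      then show ?thesis using P1[OF A] P1[OF B] by blast
    qed
  qed
  have "\<exists>N. below MM C \<subseteq> N \<and> tight C N \<and> innermost_tight C N \<and> (\<forall>\<omega>. \<not> covered N \<omega> \<longrightarrow> lower C \<omega> (Suc n))"
    if C: "C \<in> DD'" for C
  proof -
    obtain D where D: "D \<in> DD" "C \<in> P D" using DD'_obt[OF C] by blast
    have CD: "C \<subseteq> D" using P1[OF D] by blast
    have t: "tight C (below MM C)" "innermost_tight C (below MM C)"
      using tight_subset[OF DD(4,5)[OF D(1)] CD] by (simp_all add: below_below[OF CD])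
    obtain f where f: "f 0 = below MM C" "\<And>d. f d \<subseteq> f (Suc d)" "\<And>d. tight C (f d)" "\<And>d. innermost_tight C (f d)"
      "\<And>d \<omega>. \<not> covered (f d) \<omega> \<Longrightarrow> lower C \<omega> d" using layers[OF t] by blast
    have "f 0 \<subseteq> f (Suc n)" by (rule lift_Suc_mono_le[of f, OF f(2)]) simp
    then show ?thesis using f(1,3-5) by (intro exI[of _ "f (Suc n)"]) simp
  qed
  then have "\<forall>C\<in>DD'. \<exists>N. below MM C \<subseteq> N \<and> tight C N \<and> innermost_tight C N \<and> (\<forall>\<omega>. \<not> covered N \<omega> \<longrightarrow> lower C \<omega> (Suc n))"
    by (rule ballI)
  from bchoice[OF this] obtain N where N: "\<forall>C\<in>DD'. below MM C \<subseteq> N C \<and> tight C (N C) \<and> innermost_tight C (N C) \<and>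
    (\<forall>\<omega>. \<not> covered (N C) \<omega> \<longrightarrow> lower C \<omega> (Suc n))" ..
  have NC: "M \<subseteq> C \<and> M \<noteq> {}" if "C \<in> DD'" "M \<in> N C" for C M
  proof -
    have "tight C (N C)" using N that(1) by blast
    then have "M \<subseteq> C" "conn G M" using that(2) unfolding tight_def by blast+
    then show ?thesis using conn_nonempty by blast
  qed
  define MM' where "MM' = \<Union>(N ` DD')"
  have below': "below MM' C = N C" if C: "C \<in> DD'" for C
  proof
    show "N C \<subseteq> below MM' C" using C NC unfolding below_def MM'_def by blast
    show "below MM' C \<subseteq> N C"
    proof
      fix M assume "M \<in> below MM' C"
      then obtain C' where C': "C' \<in> DD'" "M \<in> N C'" "M \<subseteq> C" unfolding below_def MM'_def by blast
      have "C' = C" using NC[OF C'(1,2)] C'(3) DD'_dis C C'(1) unfolding disjoint_def by blast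
      then show "M \<in> N C" using C' by simp
    qed
  qed
  have "stage (Suc n) (DD', MM')" unfolding stage_def prod.case
  proof (intro conjI ballI)
    show "disjoint DD'" by (rule DD'_dis)
    fix C assume C: "C \<in> DD'"
    show "cut C" "conn G C" using DD'_obt[OF C] P1 by blast+
    show "tight C (below MM' C)" "innermost_tight C (below MM' C)"
      "\<forall>\<omega>. \<not> covered (below MM' C) \<omega> \<longrightarrow> lower C \<omega> (Suc n)"
      using N C unfolding below'[OF C] by simp_all
  next
    fix M assume "M \<in> MM'"
    then show "\<exists>C\<in>DD'. M \<subseteq> C" using NC unfolding MM'_def by blast
  next
    fix \<omega> assume w: "\<omega> \<in> undominated_edge_ends G"
    obtain D where D: "D \<in> DD" "lv \<omega> D" using DD(6)[OF w] unfolding covered_def by blast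
    obtain C where C: "lv \<omega> C" "C \<inter> ball n = {}" using avoid_ball[OF w] by blast
    have "lv \<omega> (D \<inter> C)" by (rule lv_Int(1)[OF D(2) C(1)])
    moreover have "D \<inter> C \<subseteq> D - ball n" using C(2) by blast
    ultimately have "covered (P D) \<omega>" using P D(1) by simp
    then show "covered DD' \<omega>" using D(1) unfolding DD'_def covered_def by blast
  qed
  moreover have "refines n s (DD', MM')" unfolding refines_def sD prod.case
  proof (intro conjI ballI impI)
    fix C assume "C \<in> DD'" then show "\<exists>D\<in>DD. C \<subseteq> D - ball n" by (rule DD'_sub)
  next
    fix M C assume M: "M \<in> MM" and C: "C \<in> DD'"
    obtain D where D: "D \<in> DD" "C \<in> P D" using DD'_obt[OF C] by blast
    obtain D1 where D1: "D1 \<in> DD" "M \<subseteq> D1" using DD(3)[OF M] by blast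
    show "M \<subseteq> C \<or> C \<subseteq> M \<or> M \<inter> C = {}"
    proof (cases "D1 = D")
      case True
      then have "M \<in> below MM D" using M D1(2) by (simp add: below_def)
      then show ?thesis using P D by simp
    next
      case False
      then have "D1 \<inter> D = {}" using DD(1) D(1) D1(1) unfolding disjoint_def by blast
      then show ?thesis using D1(2) P1[OF D] by blast
    qed
  next
    fix M C assume M: "M \<in> MM" and C: "C \<in> DD'" and "M \<subseteq> C"
    then have "M \<in> below MM C" by (simp add: below_def)
    then show "M \<in> MM'" using N C unfolding MM'_def by blast
  qed
  ultimately show ?thesis by blast
qed

text \<open>A vertex in \<open>ball m\<close> is in no set of a stage beyond \<open>m\<close>, and
  each stage is point-finite, so the union is. By the same fact, sets from arbitrarily late stages
  are infinitely many, although one set may occur in several stages.\<close>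

lemma laminar_family:
  obtains LL where "laminar LL" "point_finite LL" "\<And>L. L \<in> LL \<Longrightarrow> cut L \<and> conn G L"
    "\<And>\<omega>. \<omega> \<in> undominated_edge_ends G \<Longrightarrow> infinite {L \<in> LL. lv \<omega> L}"
    "\<And>\<omega> e. \<omega> \<in> undominated_edge_ends G \<Longrightarrow> (\<And>D. lv \<omega> D \<Longrightarrow> \<exists>C. lv \<omega> C \<and> C \<subseteq> D \<and> card (bd C) \<le> e) \<Longrightarrow>
       infinite {L \<in> LL. lv \<omega> L \<and> card (bd L) \<le> e}"
proof -
  have "\<exists>s. \<forall>n. stage n (s n) \<and> refines n (s n) (s (Suc n))"
    by (rule dependent_nat_choice) (use stage_init stage_step in auto)
  then obtain s where s: "\<And>n. stage n (s n)" "\<And>n. refines n (s n) (s (Suc n))" by blast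
  define DD where "DD n = fst (s n)" for n
  define MM where "MM n = snd (s n)" for n
  have sn: "s n = (DD n, MM n)" for n by (simp add: DD_def MM_def)
  have D_dis: "disjoint (DD n)" and D_cut: "D \<in> DD n \<Longrightarrow> cut D \<and> conn G D"
    and M_sub: "M \<in> MM n \<Longrightarrow> \<exists>D\<in>DD n. M \<subseteq> D" and D_tight: "D \<in> DD n \<Longrightarrow> tight D (below (MM n) D)"
    and D_inner: "D \<in> DD n \<Longrightarrow> innermost_tight D (below (MM n) D)"
    and D_low: "D \<in> DD n \<Longrightarrow> \<not> covered (below (MM n) D) \<omega> \<Longrightarrow> lower D \<omega> n"
    and D_cov: "\<omega> \<in> undominated_edge_ends G \<Longrightarrow> covered (DD n) \<omega>" for n D M \<omega>
    using s(1)[of n] unfolding stage_def sn by simp_all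
  have r_sub: "D' \<in> DD (Suc n) \<Longrightarrow> \<exists>D\<in>DD n. D' \<subseteq> D - ball n"
    and r_nest: "M \<in> MM n \<Longrightarrow> D' \<in> DD (Suc n) \<Longrightarrow> M \<subseteq> D' \<or> D' \<subseteq> M \<or> M \<inter> D' = {}"
    and r_keep: "M \<in> MM n \<Longrightarrow> D' \<in> DD (Suc n) \<Longrightarrow> M \<subseteq> D' \<Longrightarrow> M \<in> MM (Suc n)" for n M D'
    using s(2)[of n] unfolding refines_def sn by (simp_all, blast)
  have D_eq: "D = D'" if "D \<in> DD n" "D' \<in> DD n" "D \<inter> D' \<noteq> {}" for D D' n
    using D_dis[of n] that unfolding disjoint_def by blast
  have M_prop: "cut M \<and> conn G M" if M: "M \<in> MM n" for M n
  proof -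
    obtain D where D: "D \<in> DD n" "M \<subseteq> D" using M_sub[OF M] by blast
    then have "M \<in> below (MM n) D" using M by (simp add: below_def)
    then show ?thesis using D_tight[OF D(1)] unfolding tight_def by blast
  qed
  have D_desc: "\<exists>D\<in>DD i. Y \<subseteq> D" if "i \<le> j" "Y \<in> DD j" for i j Y
    using that
  proof (induction j arbitrary: Y rule: dec_induct)
    case (step j)
    obtain D where D: "D \<in> DD j" "Y \<subseteq> D" using r_sub[OF step.prems] by blast
    then show ?case using step.IH[OF D(1)] by blast
  qed blast
  have Y_desc: "\<exists>D\<in>DD i. Y \<subseteq> D" if ij: "i \<le> j" "Y \<in> DD j \<union> MM j" for i j Y
  proof (cases "Y \<in> DD j")
    case True then show ?thesis using D_desc[OF that(1)] by blast
  next
    case False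
    then obtain D where D: "D \<in> DD j" "Y \<subseteq> D" using M_sub ij(2) by blast
    then show ?thesis using D_desc[OF that(1) D(1)] by blast
  qed
  have nest_DY: "Y \<subseteq> D \<or> D \<inter> Y = {}" if Y: "D \<in> DD i" "i \<le> j" "Y \<in> DD j \<union> MM j" for D i j Y
  proof -
    obtain D' where D': "D' \<in> DD i" "Y \<subseteq> D'" using Y_desc[OF Y(2,3)] by blast
    then show ?thesis using D_eq[OF D'(1) Y(1)] by blast
  qed
  \<comment> \<open>Downward induction from \<open>j\<close>, where both sets belong to one stage.
    Let \<open>D'\<close> be the set of the next stage that contains \<open>Y\<close>. If
    \<open>M\<close> lies in \<open>D'\<close>, it is retained and the induction hypothesis applies;
    otherwise \<open>M\<close> contains or misses \<open>D'\<close>, and with it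
    \<open>Y\<close>.\<close>
  have nest_MY: "M \<subseteq> Y \<or> Y \<subseteq> M \<or> M \<inter> Y = {}" if "i \<le> j" "M \<in> MM i" "Y \<in> DD j \<union> MM j" for M i j Y
    using that
  proof (induction i rule: inc_induct)
    case base
    obtain D where D: "D \<in> DD j" "M \<subseteq> D" using M_sub[OF base(1)] by blast
    show ?case
    proof (cases "Y \<subseteq> D")
      case False
      then show ?thesis using nest_DY[OF D(1) order_refl base(2)] D(2) by blast
    next
      case True
      show ?thesis
      proof (cases "Y \<in> MM j")
        case True
        then have "M \<in> below (MM j) D" "Y \<in> below (MM j) D" using \<open>Y \<subseteq> D\<close> D(2) base(1) by (simp_all add: below_def)
        then show ?thesis using D_tight[OF D(1)] laminarD unfolding tight_def by blast
      next
        case False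
        then have Y: "Y \<in> DD j" using base(2) by blast
        then have "Y \<noteq> {}" using D_cut conn_nonempty by blast
        then have "Y = D" using D_eq[OF Y D(1)] True by blast
        then show ?thesis using D(2) by blast
      qed
    qed
  next
    case (step i)
    obtain D' where D': "D' \<in> DD (Suc i)" "Y \<subseteq> D'" using Y_desc[of "Suc i" j Y] step by auto
    show ?case
    proof (cases "M \<subseteq> D'")
      case True
      then show ?thesis using step.IH[OF r_keep[OF step.prems(1) D'(1)] step.prems(2)] by blast
    next
      case False
      then show ?thesis using r_nest[OF step.prems(1) D'(1)] D'(2) by blast
    qed
  qed
  define LL where "LL = (\<Union>n. DD n \<union> MM n)"
  have L_prop: "cut L \<and> conn G L" if "L \<in> LL" for L
    using that D_cut M_prop unfolding LL_def by blast
  have nest: "X \<subseteq> Y \<or> Y \<subseteq> X \<or> X \<inter> Y = {}" if X: "X \<in> DD i \<union> MM i" and ij: "i \<le> j" and Y: "Y \<in> DD j \<union> MM j" for X Y i j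
  proof (cases "X \<in> MM i")
    case True then show ?thesis using nest_MY[OF ij True Y] by blast
  next
    case False
    then have "X \<in> DD i" using X by blast
    then show ?thesis using nest_DY[OF _ ij Y] by blast
  qed
  have lam: "laminar LL" unfolding laminar_def
  proof (intro ballI)
    fix X Y assume "X \<in> LL" "Y \<in> LL"
    then obtain i j where ij: "X \<in> DD i \<union> MM i" "Y \<in> DD j \<union> MM j" unfolding LL_def by blast
    show "X \<subseteq> Y \<or> Y \<subseteq> X \<or> X \<inter> Y = {}"
    proof (cases "i \<le> j")
      case True then show ?thesis by (rule nest[OF ij(1) _ ij(2)])
    next
      case False
      then show ?thesis using nest[OF ij(2) _ ij(1)] by (simp add: Int_commute) blast
    qed
  qed
  have avoid: "v \<notin> Y" if v: "v \<in> ball m" and mn: "m < n" and Y: "Y \<in> DD n \<union> MM n" for v m n Y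
  proof -
    obtain k where k: "n = Suc k" using mn by (cases n) auto
    obtain D where D: "D \<in> DD n" "Y \<subseteq> D" using Y_desc[OF order_refl Y] by blast
    have "D \<inter> ball k = {}" using r_sub D(1) k by blast
    moreover have "v \<in> ball k" using ball_mono[of m k] v mn k by auto
    ultimately show ?thesis using D(2) by blast
  qed
  have pf: "point_finite LL" unfolding point_finite_def
  proof
    fix v
    show "finite {L \<in> LL. v \<in> L}"
    proof (cases "v \<in> verts G")
      case False
      have "{L \<in> LL. v \<in> L} = {}" using False L_prop cut_subset by blast
      then show ?thesis by (metis finite.emptyI)
    next
      case True
      then obtain m where m: "v \<in> ball m" using ball_exhausts by blast
      have "{L \<in> LL. v \<in> L} \<subseteq> (\<Union>n\<le>m. {L \<in> DD n \<union> MM n. v \<in> L})"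
      proof
        fix L assume "L \<in> {L \<in> LL. v \<in> L}"
        then obtain n where n: "L \<in> DD n \<union> MM n" "v \<in> L" unfolding LL_def by blast
        have "n \<le> m" using avoid[OF m _ n(1)] n(2) by (meson not_le)
        then show "L \<in> (\<Union>n\<le>m. {L \<in> DD n \<union> MM n. v \<in> L})" using n by blast
      qed
      moreover have "finite {L \<in> DD n \<union> MM n. v \<in> L}" for n
      proof -
        have "finite {L \<in> MM n. v \<in> L}"
        proof (cases "\<exists>D\<in>DD n. v \<in> D")
          case False
          then have "{L \<in> MM n. v \<in> L} = {}" using M_sub by blast
          then show ?thesis by (metis finite.emptyI)
        next
          case True
          then obtain D where D: "D \<in> DD n" "v \<in> D" by blast
          have "{L \<in> MM n. v \<in> L} \<subseteq> {L \<in> below (MM n) D. v \<in> L}"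
          proof
            fix L assume L: "L \<in> {L \<in> MM n. v \<in> L}"
            then obtain D' where "D' \<in> DD n" "L \<subseteq> D'" using M_sub by blast
            then have "L \<subseteq> D" using D_eq[of D' n D] D L by blast
            then show "L \<in> {L \<in> below (MM n) D. v \<in> L}" using L by (simp add: below_def)
          qed
          moreover have "finite {L \<in> below (MM n) D. v \<in> L}"
            using D_tight[OF D(1)] unfolding tight_def point_finite_def by blast
          ultimately show ?thesis by (rule finite_subset)
        qed
        moreover have "finite {L \<in> DD n. v \<in> L}"
          using point_finite_disjoint[OF D_dis[of n]] unfolding point_finite_def by blast
        moreover have "{L \<in> DD n \<union> MM n. v \<in> L} = {L \<in> DD n. v \<in> L} \<union> {L \<in> MM n. v \<in> L}" by blast
        ultimately show ?thesis by simp
      qed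
      ultimately show ?thesis by (meson finite_UN_I finite_atMost finite_subset)
    qed
  qed
  \<comment> \<open>Each member meets some ball. A finite family would have a uniform bound on these
    radii, and beyond that stage none of its members could occur.\<close>
  have inf: "infinite A" if AL: "A \<subseteq> LL" and ex: "\<And>n. \<exists>L\<in>A. \<exists>k>n. L \<in> DD k \<union> MM k" for A
  proof
    assume fin: "finite A"
    have "\<exists>m. \<exists>v\<in>L. v \<in> ball m" if L: "L \<in> A" for L
    proof -
      obtain v where "v \<in> L" "v \<in> verts G" using L_prop[of L] AL L conn_nonempty cut_subset by blast
      then show ?thesis using ball_exhausts by blast
    qed
    then have "\<forall>L\<in>A. \<exists>m. \<exists>v\<in>L. v \<in> ball m" by blast
    from bchoice[OF this] obtain m where m: "\<forall>L\<in>A. \<exists>v\<in>L. v \<in> ball (m L)" ..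
    obtain L k where L: "L \<in> A" "k > Max (m ` A)" "L \<in> DD k \<union> MM k" using ex by blast
    have "m L \<le> Max (m ` A)" using fin L(1) by simp
    then have "m L < k" using L(2) by simp
    then show False using m L(1) avoid[OF _ _ L(3)] by blast
  qed
  show thesis
  proof (rule that[of LL])
    show "laminar LL" "point_finite LL" by (rule lam pf)+
    fix L assume "L \<in> LL" then show "cut L \<and> conn G L" by (rule L_prop)
  next
    fix \<omega> assume w: "\<omega> \<in> undominated_edge_ends G"
    show "infinite {L \<in> LL. lv \<omega> L}"
    proof (rule inf)
      fix n
      obtain D where D: "D \<in> DD (Suc n)" "lv \<omega> D" using D_cov[OF w] unfolding covered_def by blast
      then have "D \<in> {L \<in> LL. lv \<omega> L}" by (auto simp: LL_def)
      then show "\<exists>L\<in>{L \<in> LL. lv \<omega> L}. \<exists>k>n. L \<in> DD k \<union> MM k" using D(1) by blast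
    qed blast
  next
    fix \<omega> and e :: nat assume w: "\<omega> \<in> undominated_edge_ends G"
      and small: "\<And>D. lv \<omega> D \<Longrightarrow> \<exists>C. lv \<omega> C \<and> C \<subseteq> D \<and> card (bd C) \<le> e"
    show "infinite {L \<in> LL. lv \<omega> L \<and> card (bd L) \<le> e}"
    proof (rule inf)
      fix n
      \<comment> \<open>Later than \<open>n\<close>, and larger than \<open>e\<close> so that the
        layers of this stage cannot miss an end with a cut of size at most \<open>e\<close> inside
        \<open>D\<close>.\<close>
      define k where "k = Suc (max n e)"
      obtain D where D: "D \<in> DD k" "lv \<omega> D" using D_cov[OF w] unfolding covered_def by blast
      obtain C where C: "lv \<omega> C" "C \<subseteq> D" "card (bd C) \<le> e" using small[OF D(2)] by blast
      have "covered (below (MM k) D) \<omega>"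
      proof (rule ccontr)
        assume "\<not> covered (below (MM k) D) \<omega>"
        then have "k \<le> card (bd C)" using lowerD[OF D_low[OF D(1)] C(1,2)] by blast
        then show False using C(3) by (simp add: k_def)
      qed
      then obtain M where M: "M \<in> below (MM k) D" "lv \<omega> M" "lower D \<omega> (card (bd M))"
        using D_inner[OF D(1)] unfolding innermost_tight_def by blast
      have "card (bd M) \<le> e" using lowerD[OF M(3) C(1,2)] C(3) by simp
      moreover have "M \<in> MM k" using M(1) by (simp add: below_def)
      moreover have "k > n" by (simp add: k_def)
      ultimately show "\<exists>L\<in>{L \<in> LL. lv \<omega> L \<and> card (bd L) \<le> e}. \<exists>k>n. L \<in> DD k \<union> MM k"
        using M(2) unfolding LL_def by blast
    qed blast
  qed
qed

end

section \<open>Integral flows\<close>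

text \<open>An oriented edge; the edge itself is recorded to tell parallel edges apart.\<close>

type_synonym ('v, 'e) arc = "'e \<times> 'v \<times> 'v"

abbreviation arc_edge :: "('v, 'e) arc \<Rightarrow> 'e" where "arc_edge a \<equiv> fst a"
abbreviation tl_of :: "('v, 'e) arc \<Rightarrow> 'v" where "tl_of a \<equiv> fst (snd a)"
abbreviation hd_of :: "('v, 'e) arc \<Rightarrow> 'v" where "hd_of a \<equiv> snd (snd a)"
definition rev_arc :: "('v, 'e) arc \<Rightarrow> ('v, 'e) arc" where "rev_arc a = (arc_edge a, hd_of a, tl_of a)"

lemma rev_arc_simps [simp]: "arc_edge (rev_arc a) = arc_edge a" "tl_of (rev_arc a) = hd_of a"
  "hd_of (rev_arc a) = tl_of a" "rev_arc (rev_arc a) = a" "rev_arc (e, u, v) = (e, v, u)"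
  by (simp_all add: rev_arc_def)

lemma in_rev_image: "b \<in> rev_arc ` X \<longleftrightarrow> rev_arc b \<in> X"
  by (metis image_iff rev_arc_simps(4))

lemma inj_rev_arc: "inj_on rev_arc A" by (rule inj_onI) (metis rev_arc_simps(4))

lemma card_fibres:
  assumes "finite F" "finite T" "\<And>a. a \<in> F \<Longrightarrow> g a \<in> S \<Longrightarrow> g a \<in> T" "T \<subseteq> S"
  shows "card {a \<in> F. g a \<in> S} = (\<Sum>v\<in>T. card {a \<in> F. g a = v})"
proof -
  have "{a \<in> F. g a \<in> S} = (\<Union>v\<in>T. {a \<in> F. g a = v})" using assms(3,4) by blast
  moreover have "card (\<Union>v\<in>T. {a \<in> F. g a = v}) = (\<Sum>v\<in>T. card {a \<in> F. g a = v})"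
    by (rule card_UN_disjoint) (use assms in auto)
  ultimately show ?thesis by simp
qed

lemma card_split: "finite F \<Longrightarrow> F = X \<union> Y \<Longrightarrow> X \<inter> Y = {} \<Longrightarrow> card F = card X + card Y"
  using card_Un_disjoint[of X Y] by simp

text \<open>Conservation summed over \<open>S\<close>: only the finitely many vertices met by
  \<open>F\<close> contribute, so \<open>S\<close> may be infinite.\<close>

lemma card_balanced:
  assumes "finite F" "\<And>v. v \<in> S \<Longrightarrow> card {a \<in> F. g a = v} = card {a \<in> F. h a = v}"
  shows "card {a \<in> F. g a \<in> S} = card {a \<in> F. h a \<in> S}"
proof -
  let ?T = "S \<inter> (g ` F \<union> h ` F)"
  have "card {a \<in> F. g a \<in> S} = (\<Sum>v\<in>?T. card {a \<in> F. g a = v})"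
    by (rule card_fibres) (use assms(1) in auto)
  also have "\<dots> = (\<Sum>v\<in>?T. card {a \<in> F. h a = v})" by (rule sum.cong) (use assms(2) in auto)
  also have "\<dots> = card {a \<in> F. h a \<in> S}"
    by (rule card_fibres[symmetric]) (use assms(1) in auto)
  finally show ?thesis .
qed

context multi_graph
begin

text \<open>The inflow enters \<open>K\<close> through the edges in \<open>A\<close> and the sink is \<open>K'\<close>. Arcs leaving the sink are excluded
  so that the flows of successive regions fit together.\<close>

definition arcs :: "'v set \<Rightarrow> 'v set \<Rightarrow> 'e set \<Rightarrow> ('v, 'e) arc set" where
  "arcs K K' A = {(e, u, v). e \<in> A \<union> {e \<in> edges G. endpoints G e \<subseteq> K} \<and>
     endpoints G e = {u, v} \<and> u \<noteq> v \<and> u \<notin> K' \<and> v \<in> K}"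

text \<open>A flow with unit capacities, given by the set of arcs that carry it. Without opposite
  arcs every edge is used at most once. The value is the number of arcs in
  \<open>inflow\<close>.\<close>

definition flow :: "'v set \<Rightarrow> 'v set \<Rightarrow> 'e set \<Rightarrow> ('v, 'e) arc set \<Rightarrow> bool" where
  "flow K K' A F \<longleftrightarrow> finite F \<and> F \<subseteq> arcs K K' A \<and> (\<forall>a\<in>F. rev_arc a \<notin> F) \<and>
     (\<forall>v\<in>K - K'. card {a \<in> F. tl_of a = v} = card {a \<in> F. hd_of a = v})"

abbreviation inflow :: "'v set \<Rightarrow> ('v, 'e) arc set \<Rightarrow> ('v, 'e) arc set" where
  "inflow K F \<equiv> {a \<in> F. tl_of a \<notin> K}"

lemma arcsD:
  assumes "a \<in> arcs K K' A"
  shows "endpoints G (arc_edge a) = {tl_of a, hd_of a}" "tl_of a \<noteq> hd_of a" "tl_of a \<notin> K'" "hd_of a \<in> K"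
    "arc_edge a \<in> A \<or> (arc_edge a \<in> edges G \<and> tl_of a \<in> K)"
  using assms unfolding arcs_def by auto

definition residual :: "'v set \<Rightarrow> 'v set \<Rightarrow> 'e set \<Rightarrow> ('v, 'e) arc set \<Rightarrow> ('v, 'e) arc set" where
  "residual K K' A F = (arcs K K' A \<union> rev_arc ` F) - F"

text \<open>If the sink is not reachable in the residual graph, then the complement of the reachable set is a
  cut all of whose edges carry flow.\<close>

lemma residual_cut:
  assumes F: "flow K K' A F" and K': "K' \<subseteq> K" "K \<subseteq> verts G" and A: "A \<subseteq> bd K"
    and R: "R = {w. \<exists>s. s \<notin> K \<and> (s, w) \<in> ((\<lambda>a. (tl_of a, hd_of a)) ` residual K K' A F)\<^sup>*}"
    and RK: "R \<inter> K' = {}"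
  shows "finite (bd (K - R) \<inter> (A \<union> {e \<in> edges G. endpoints G e \<subseteq> K})) \<and>
    card (bd (K - R) \<inter> (A \<union> {e \<in> edges G. endpoints G e \<subseteq> K})) \<le> card (inflow K F)"
proof -
  let ?H = "A \<union> {e \<in> edges G. endpoints G e \<subseteq> K}"
  have fin: "finite F" and Fa: "\<And>a. a \<in> F \<Longrightarrow> a \<in> arcs K K' A" and no: "\<And>a. a \<in> F \<Longrightarrow> rev_arc a \<notin> F"
    and bal: "\<And>v. v \<in> K - K' \<Longrightarrow> card {a \<in> F. tl_of a = v} = card {a \<in> F. hd_of a = v}"
    using F unfolding flow_def by blast+
  have outR: "v \<in> R" if "v \<notin> K" for v using that unfolding R by blast
  have stepR: "hd_of a \<in> R" if aR: "a \<in> residual K K' A F" "tl_of a \<in> R" for a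
  proof -
    obtain s where "s \<notin> K" "(s, tl_of a) \<in> ((\<lambda>a. (tl_of a, hd_of a)) ` residual K K' A F)\<^sup>*" using aR(2) unfolding R by blast
    moreover have "(tl_of a, hd_of a) \<in> (\<lambda>a. (tl_of a, hd_of a)) ` residual K K' A F" using aR(1) by blast
    ultimately show ?thesis unfolding R using rtrancl_into_rtrancl by fast
  qed
  have noenter: "tl_of a \<in> R" if a: "a \<in> F" "hd_of a \<in> R" for a
  proof -
    have "rev_arc a \<in> residual K K' A F" using a(1) no unfolding residual_def by blast
    then show ?thesis using stepR[of "rev_arc a"] a(2) by simp
  qed
  let ?X = "{a \<in> F. tl_of a \<in> R \<and> hd_of a \<notin> R}"
  have sub: "bd (K - R) \<inter> ?H \<subseteq> arc_edge ` ?X"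
  proof
    fix e assume e: "e \<in> bd (K - R) \<inter> ?H"
    then obtain u v where uv: "e \<in> edges G" "endpoints G e = {v, u}" "v \<in> K - R" "u \<notin> K - R"
      unfolding edge_boundary_def by blast
    have uR: "u \<in> R" using uv(4) outR by blast
    then have "(e, u, v) \<in> arcs K K' A" using e uv RK unfolding arcs_def by (auto simp: insert_commute)
    moreover have "(e, u, v) \<notin> residual K K' A F" using stepR[of "(e, u, v)"] uR uv(3) by auto
    ultimately have "(e, u, v) \<in> F" unfolding residual_def by blast
    then have "(e, u, v) \<in> ?X" using uR uv(3) by simp
    then show "e \<in> arc_edge ` ?X" by (rule image_eqI[rotated]) simp
  qed
  have finX: "finite ?X" using fin by simp
  \<comment> \<open>Arcs of \<open>F\<close> with head in \<open>R\<close> also start in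
    \<open>R\<close>, so conservation on \<open>R \<inter> K\<close> equates the flow leaving
    \<open>R\<close> with the inflow.\<close>
  have "card {a \<in> F. tl_of a \<in> R \<inter> K} = card {a \<in> F. hd_of a \<in> R \<inter> K}"
    by (rule card_balanced[OF fin]) (use bal RK in blast)
  also have "{a \<in> F. hd_of a \<in> R \<inter> K} = {a \<in> F. tl_of a \<in> R \<and> hd_of a \<in> R}"
    using noenter arcsD(4)[OF Fa] by blast
  finally have 1: "card {a \<in> F. tl_of a \<in> R \<inter> K} = card {a \<in> F. tl_of a \<in> R \<and> hd_of a \<in> R}" .
  have "{a \<in> F. tl_of a \<in> R} = inflow K F \<union> {a \<in> F. tl_of a \<in> R \<inter> K}" using outR by blast
  then have 2: "card {a \<in> F. tl_of a \<in> R} = card (inflow K F) + card {a \<in> F. tl_of a \<in> R \<inter> K}"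
    using fin by (simp add: card_Un_disjoint disjoint_iff)
  have "{a \<in> F. tl_of a \<in> R} = ?X \<union> {a \<in> F. tl_of a \<in> R \<and> hd_of a \<in> R}" by blast
  then have "card {a \<in> F. tl_of a \<in> R} = card ?X + card {a \<in> F. tl_of a \<in> R \<and> hd_of a \<in> R}"
    using fin by (simp add: card_Un_disjoint disjoint_iff)
  then have "card ?X = card (inflow K F)" using 1 2 by simp
  moreover have "card (bd (K - R) \<inter> ?H) \<le> card ?X"
    using card_mono[OF finite_imageI[OF finX] sub] card_image_le[OF finX, of arc_edge] by linarith
  moreover have "finite (bd (K - R) \<inter> ?H)" using finite_subset[OF sub finite_imageI[OF finX]] .
  ultimately show ?thesis by simp
qed

text \<open>A shortest augmenting path repeats no vertex, lies in \<open>K\<close> after its start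
  and meets \<open>K'\<close> only at its end. Hence the new flow is balanced on
  \<open>K - K'\<close> and gains exactly one arc of inflow.\<close>

lemma augment:
  assumes F: "flow K K' A F" and K': "K' \<subseteq> K" and A: "A \<subseteq> bd K"
    and s: "s \<notin> K" and t: "t \<in> K'" and st: "(s, t) \<in> ((\<lambda>a. (tl_of a, hd_of a)) ` residual K K' A F)\<^sup>*"
  shows "\<exists>F'. flow K K' A F' \<and> card (inflow K F') = Suc (card (inflow K F))"
proof -
  have fin: "finite F" and Fa: "\<And>a. a \<in> F \<Longrightarrow> a \<in> arcs K K' A" and no: "\<And>a. a \<in> F \<Longrightarrow> rev_arc a \<notin> F"
    and bal: "\<And>v. v \<in> K - K' \<Longrightarrow> card {a \<in> F. tl_of a = v} = card {a \<in> F. hd_of a = v}"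
    using F unfolding flow_def by blast+
  define r where "r = (\<lambda>a. (tl_of a, hd_of a)) ` residual K K' A F"
  define good where "good = (\<lambda>n. \<exists>s t. s \<notin> K \<and> t \<in> K' \<and> (s, t) \<in> r ^^ n)"
  define n where "n = (LEAST n. good n)"
  have "\<exists>n. good n" using s t rtrancl_imp_relpow[OF st] unfolding good_def r_def by blast
  then have "good n" unfolding n_def by (rule LeastI_ex)
  then obtain p where p: "p 0 \<notin> K" "p n \<in> K'" "\<And>i. i < n \<Longrightarrow> (p i, p (Suc i)) \<in> r"
    unfolding good_def relpow_fun_conv by blast
  have least: "n \<le> k" if "u \<notin> K" "w \<in> K'" "(u, w) \<in> r ^^ k" for u w k
    unfolding n_def by (rule Least_le) (use that in \<open>auto simp: good_def\<close>)
  have seg: "(p i, p j) \<in> r ^^ (j - i)" if ij: "i \<le> j" "j \<le> n" for i j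
    unfolding relpow_fun_conv
    by (rule exI[of _ "\<lambda>k. p (i + k)"]) (use p(3) ij in auto)
  have inj: "i = j" if ij: "p i = p j" "i \<le> j" "j \<le> n" for i j
  proof -
    have "(p 0, p i) \<in> r ^^ i" using seg[of 0 i] ij by simp
    moreover have "(p i, p n) \<in> r ^^ (n - j)" using seg[of j n] ij by simp
    ultimately have "(p 0, p n) \<in> r ^^ (i + (n - j))" by (auto simp: relpow_add)
    then show ?thesis using least[OF p(1,2)] ij by fastforce
  qed
  have inj': "k = l" if kl: "p k = p l" "k \<le> n" "l \<le> n" for k l
  proof (cases "k \<le> l")
    case True
    then show ?thesis using inj[OF kl(1) _ kl(3)] by blast
  next
    case False
    then have "l \<le> k" by simp
    then show ?thesis using inj[OF kl(1)[symmetric] _ kl(2)] by blast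
  qed
  have inK: "p i \<in> K" if i: "0 < i" "i \<le> n" for i
  proof (rule ccontr)
    assume "p i \<notin> K"
    then have "n \<le> n - i" using least[OF _ p(2) seg[of i n]] i by simp
    then show False using i by simp
  qed
  have notK': "p i \<notin> K'" if i: "i < n" for i
  proof
    assume "p i \<in> K'"
    then have "n \<le> i" using least[OF p(1) _ seg[of 0 i]] i by simp
    then show False using i by simp
  qed
  have n0: "0 < n" using p(1,2) K' by (metis gr0I subsetD)
  have "\<exists>e. (e, p i, p (Suc i)) \<in> residual K K' A F" if "i < n" for i
    using p(3)[OF that] unfolding r_def by force
  then obtain \<epsilon> where \<epsilon>: "\<And>i. i < n \<Longrightarrow> (\<epsilon> i, p i, p (Suc i)) \<in> residual K K' A F" by metis
  define q where "q = (\<lambda>i. (\<epsilon> i, p i, p (Suc i)))"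
  define Q where "Q = q ` {..<n}"
  have qinj: "inj_on q {..<n}"
  proof (rule inj_onI)
    fix i j assume ij: "i \<in> {..<n}" "j \<in> {..<n}" "q i = q j"
    have "p i = p j" using ij(3) unfolding q_def by blast
    then show "i = j" by (rule inj') (use ij(1,2) in auto)
  qed
  have finQ: "finite Q" by (simp add: Q_def)
  have Qres: "a \<in> residual K K' A F" if "a \<in> Q" for a using that \<epsilon> unfolding Q_def q_def by auto
  have Qno: "rev_arc a \<notin> Q" if aQ: "a \<in> Q" for a
  proof
    assume "rev_arc a \<in> Q"
    then obtain i j where ij: "i < n" "j < n" "a = q i" "rev_arc a = q j" using aQ unfolding Q_def by blast
    then have "p (Suc i) = p j" "p i = p (Suc j)" by (auto simp: q_def)
    have "Suc i = j" by (rule inj') (use ij \<open>p (Suc i) = p j\<close> in auto)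
    moreover have "i = Suc j" by (rule inj') (use ij \<open>p i = p (Suc j)\<close> in auto)
    ultimately show False by simp
  qed
  \<comment> \<open>Arcs of the path that run against the flow cancel their reverses; the others are
    added.\<close>
  define F' where "F' = (F - rev_arc ` Q) \<union> (Q - rev_arc ` F)"
  have QF: "Q \<inter> F = {}" using Qres unfolding residual_def by blast
  have Qarc: "a \<in> arcs K K' A" if "a \<in> Q - rev_arc ` F" for a
    using Qres that unfolding residual_def by blast
  have split: "card {a \<in> Q. h a = v} = card {a \<in> Q - rev_arc ` F. h a = v} + card {a \<in> Q \<inter> rev_arc ` F. h a = v}"
    for h :: "('v, 'e) arc \<Rightarrow> 'v" and v
  proof -
    have "{a \<in> Q. h a = v} = {a \<in> Q - rev_arc ` F. h a = v} \<union> {a \<in> Q \<inter> rev_arc ` F. h a = v}" by blast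
    then show ?thesis using finQ by (simp add: card_Un_disjoint disjoint_iff)
  qed
  \<comment> \<open>One count for tails and heads alike, with \<open>g'\<close> as the opposite end
    map. The terms are arranged so that no subtraction of natural numbers occurs.\<close>
  have cnt: "card {a \<in> F'. g a = v} + card {a \<in> Q. g' a = v} + card {a \<in> Q \<inter> rev_arc ` F. g a = v} =
     card {a \<in> F. g a = v} + card {a \<in> Q. g a = v} + card {a \<in> Q - rev_arc ` F. g' a = v}"
    if gg: "\<And>a. g (rev_arc a) = g' a" for g g' :: "('v, 'e) arc \<Rightarrow> 'v" and v
  proof -
    have e1: "card {a \<in> F'. g a = v} = card {a \<in> F - rev_arc ` Q. g a = v} + card {a \<in> Q - rev_arc ` F. g a = v}"
    proof -
      have "{a \<in> F'. g a = v} = {a \<in> F - rev_arc ` Q. g a = v} \<union> {a \<in> Q - rev_arc ` F. g a = v}" unfolding F'_def by blast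
      moreover have "{a \<in> F - rev_arc ` Q. g a = v} \<inter> {a \<in> Q - rev_arc ` F. g a = v} = {}" using QF by blast
      ultimately show ?thesis by (intro card_split) (use fin finQ in \<open>simp add: F'_def\<close>)
    qed
    have e2: "card {a \<in> F. g a = v} = card {a \<in> F - rev_arc ` Q. g a = v} + card {a \<in> F \<inter> rev_arc ` Q. g a = v}"
    proof -
      have "{a \<in> F. g a = v} = {a \<in> F - rev_arc ` Q. g a = v} \<union> {a \<in> F \<inter> rev_arc ` Q. g a = v}" by blast
      then show ?thesis using fin by (simp add: card_Un_disjoint disjoint_iff)
    qed
    have "{a \<in> F \<inter> rev_arc ` Q. g a = v} = rev_arc ` {a \<in> Q \<inter> rev_arc ` F. g' a = v}"
    proof
      show "{a \<in> F \<inter> rev_arc ` Q. g a = v} \<subseteq> rev_arc ` {a \<in> Q \<inter> rev_arc ` F. g' a = v}"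
      proof
        fix a assume a: "a \<in> {a \<in> F \<inter> rev_arc ` Q. g a = v}"
        then obtain b where b: "b \<in> Q" "a = rev_arc b" by blast
        then have "b = rev_arc a" by simp
        then have "b \<in> rev_arc ` F" using a by blast
        moreover have "g' b = v" using a b(2) gg by auto
        ultimately show "a \<in> rev_arc ` {a \<in> Q \<inter> rev_arc ` F. g' a = v}" using b by blast
      qed
      show "rev_arc ` {a \<in> Q \<inter> rev_arc ` F. g' a = v} \<subseteq> {a \<in> F \<inter> rev_arc ` Q. g a = v}"
      proof
        fix a assume "a \<in> rev_arc ` {a \<in> Q \<inter> rev_arc ` F. g' a = v}"
        then obtain b c where b: "b \<in> Q" "a = rev_arc b" "g' b = v" "c \<in> F" "b = rev_arc c" by blast
        have "a \<in> F" using b(2,4,5) by simp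
        moreover have "a \<in> rev_arc ` Q" using b(1,2) by blast
        moreover have "g a = v" using b(2,3) gg[of b] by simp
        ultimately show "a \<in> {a \<in> F \<inter> rev_arc ` Q. g a = v}" by blast
      qed
    qed
    then have e3: "card {a \<in> F \<inter> rev_arc ` Q. g a = v} = card {a \<in> Q \<inter> rev_arc ` F. g' a = v}"
      by (simp add: card_image inj_rev_arc)
    show ?thesis using e1 e2 e3 split[of g v] split[of g' v] by linarith
  qed
  have Qbal: "card {a \<in> Q. tl_of a = v} = card {a \<in> Q. hd_of a = v}" if v: "v \<in> K - K'" for v
  proof -
    have 1: "{a \<in> Q. tl_of a = v} = q ` {i. i < n \<and> p i = v}" by (auto simp: Q_def q_def)
    have 2: "{a \<in> Q. hd_of a = v} = q ` {i. i < n \<and> p (Suc i) = v}" by (auto simp: Q_def q_def)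
    have "Suc ` {i. i < n \<and> p (Suc i) = v} = {i. i < n \<and> p i = v}"
    proof
      show "Suc ` {i. i < n \<and> p (Suc i) = v} \<subseteq> {i. i < n \<and> p i = v}"
        using v p(2) by (auto simp: less_Suc_eq_le order_le_less dest: Suc_leI)
      show "{i. i < n \<and> p i = v} \<subseteq> Suc ` {i. i < n \<and> p (Suc i) = v}"
      proof
        fix i assume i: "i \<in> {i. i < n \<and> p i = v}"
        then have "p i \<in> K" using v by blast
        then have "i \<noteq> 0" using p(1) by (cases i) simp_all
        then obtain k where "i = Suc k" by (cases i) auto
        then show "i \<in> Suc ` {i. i < n \<and> p (Suc i) = v}" using i by auto
      qed
    qed
    then have "card {i. i < n \<and> p i = v} = card {i. i < n \<and> p (Suc i) = v}" using card_image[OF inj_Suc, of "{i. i < n \<and> p (Suc i) = v}"] by simp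
    moreover have "inj_on q {i. i < n \<and> p i = v}" "inj_on q {i. i < n \<and> p (Suc i) = v}"
      by (rule inj_on_subset[OF qinj]; auto)+
    ultimately show ?thesis unfolding 1 2 by (simp add: card_image)
  qed
  have "flow K K' A F'" unfolding flow_def
  proof (intro conjI ballI)
    show "finite F'" using fin finQ by (simp add: F'_def)
    show "F' \<subseteq> arcs K K' A" using Fa Qarc unfolding F'_def by blast
    fix a assume "a \<in> F'"
    then show "rev_arc a \<notin> F'" using no[of a] Qno[of a] unfolding F'_def Un_iff Diff_iff in_rev_image rev_arc_simps(4) by blast
  next
    fix v assume v: "v \<in> K - K'"
    have c1: "card {a \<in> F'. tl_of a = v} + card {a \<in> Q. hd_of a = v} + card {a \<in> Q \<inter> rev_arc ` F. tl_of a = v} =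
     card {a \<in> F. tl_of a = v} + card {a \<in> Q. tl_of a = v} + card {a \<in> Q - rev_arc ` F. hd_of a = v}"
      by (rule cnt) simp
    have c2: "card {a \<in> F'. hd_of a = v} + card {a \<in> Q. tl_of a = v} + card {a \<in> Q \<inter> rev_arc ` F. hd_of a = v} =
     card {a \<in> F. hd_of a = v} + card {a \<in> Q. hd_of a = v} + card {a \<in> Q - rev_arc ` F. tl_of a = v}"
      by (rule cnt) simp
    show "card {a \<in> F'. tl_of a = v} = card {a \<in> F'. hd_of a = v}"
      using c1 c2 Qbal[OF v] bal[OF v] split[of tl_of v] split[of hd_of v] by linarith
  qed
  moreover have "inflow K F' = insert (q 0) (inflow K F)"
  proof -
    have hK: "hd_of a \<in> K" if "a \<in> Q" for a using that inK unfolding Q_def q_def by auto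
    have "q 0 \<in> Q" using n0 by (simp add: Q_def)
    moreover have "q 0 \<notin> rev_arc ` F"
    proof
      assume "q 0 \<in> rev_arc ` F"
      then obtain a where a: "a \<in> F" "q 0 = rev_arc a" by blast
      then have "hd_of a = p 0" by (metis q_def fst_conv rev_arc_simps(2) snd_conv)
      then show False using arcsD(4)[OF Fa[OF a(1)]] p(1) by simp
    qed
    moreover have "tl_of (q 0) \<notin> K" using p(1) by (simp add: q_def)
    moreover have "a = q 0" if a: "a \<in> Q" "tl_of a \<notin> K" for a
    proof -
      obtain i where i: "i < n" "a = q i" using a(1) unfolding Q_def by blast
      then have "p i \<notin> K" using a(2) by (simp add: q_def)
      then have "i = 0" using inK[of i] i(1) by auto
      then show ?thesis using i by simp
    qed
    moreover have "a \<notin> rev_arc ` Q" if "a \<in> F" "tl_of a \<notin> K" for a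
    proof
      assume "a \<in> rev_arc ` Q"
      then obtain b where "b \<in> Q" "a = rev_arc b" by blast
      then show False using hK that(2) by simp
    qed
    ultimately have "(a \<in> F' \<and> tl_of a \<notin> K) \<longleftrightarrow> a = q 0 \<or> (a \<in> F \<and> tl_of a \<notin> K)" for a
      unfolding F'_def Un_iff Diff_iff by metis
    then show ?thesis by blast
  qed
  moreover have "q 0 \<notin> inflow K F" using QF n0 unfolding Q_def by auto
  ultimately show ?thesis using fin by (intro exI[of _ F']) simp
qed

text \<open>Augmenting a bounded number of times avoids limits in an infinite graph. If it failed at
  a value below \<open>m\<close>, then \<open>residual_cut\<close> would yield a set
  \<open>K - R\<close> with fewer than \<open>m\<close> edges in the network.\<close>

lemma max_flow:
  assumes K': "K' \<subseteq> K" "K \<subseteq> verts G" and A: "A \<subseteq> bd K"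
    and m: "\<And>L. K' \<subseteq> L \<Longrightarrow> L \<subseteq> K \<Longrightarrow> finite (bd L \<inter> (A \<union> {e \<in> edges G. endpoints G e \<subseteq> K})) \<Longrightarrow>
       m \<le> card (bd L \<inter> (A \<union> {e \<in> edges G. endpoints G e \<subseteq> K}))"
    and "j \<le> m"
  shows "\<exists>F. flow K K' A F \<and> card (inflow K F) = j"
  using \<open>j \<le> m\<close>
proof (induction j)
  case 0
  then show ?case by (intro exI[of _ "{}"]) (simp add: flow_def)
next
  case (Suc j)
  then obtain F where F: "flow K K' A F" "card (inflow K F) = j" by auto
  define R where "R = {w. \<exists>s. s \<notin> K \<and> (s, w) \<in> ((\<lambda>a. (tl_of a, hd_of a)) ` residual K K' A F)\<^sup>*}"
  have "R \<inter> K' \<noteq> {}"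
  proof
    assume RK: "R \<inter> K' = {}"
    note rc = residual_cut[OF F(1) K' A R_def RK]
    have "m \<le> j" using m[of "K - R"] rc RK K'(1) F(2) by fastforce
    then show False using Suc.prems by simp
  qed
  then obtain s t where "s \<notin> K" "t \<in> K'" "(s, t) \<in> ((\<lambda>a. (tl_of a, hd_of a)) ` residual K K' A F)\<^sup>*"
    unfolding R_def by blast
  from augment[OF F(1) K'(1) A this] show ?case using F(2) by simp
qed

section \<open>From linked minimum cuts to edge-disjoint rays\<close>

lemma min_cut:
  assumes "lv \<omega> Q"
  obtains K where "lv \<omega> K" "K \<subseteq> Q" "conn G K" "lower Q \<omega> (card (bd K))"
proof -
  define good where "good = (\<lambda>n. \<exists>C. lv \<omega> C \<and> C \<subseteq> Q \<and> card (bd C) = n)"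
  define n where "n = (LEAST n. good n)"
  have "good n" unfolding n_def by (rule LeastI_ex) (use assms in \<open>auto simp: good_def\<close>)
  then obtain C where C: "lv \<omega> C" "C \<subseteq> Q" "card (bd C) = n" unfolding good_def by blast
  have low: "lower Q \<omega> n" unfolding lower_def
  proof (intro allI impI)
    fix C assume "lv \<omega> C" "C \<subseteq> Q"
    then show "n \<le> card (bd C)" unfolding n_def by (intro Least_le) (auto simp: good_def)
  qed
  obtain v where v: "v \<in> C" "lv \<omega> (comp_in G C v)" using lv_comp[OF C(1)] by blast
  have "card (bd (comp_in G C v)) \<le> n"
    using card_mono[OF cut_finite[OF lv_cut[OF C(1)]] bd_comp_in[OF v(1)]] C(3) by simp
  then have "lower Q \<omega> (card (bd (comp_in G C v)))" using low unfolding lower_def by (meson order_trans)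
  moreover have "comp_in G C v \<subseteq> Q" using comp_in_subset[OF v(1)] C(2) by blast
  ultimately show thesis using that[OF v(2) _ conn_comp_in[OF v(1)]] by blast
qed

text \<open>Since \<open>K\<close> is a minimum cut, prescribing an arbitrary set \<open>A\<close> of \<open>m\<close> of its boundary edges as the
  inflow does not push any later cut below \<open>m\<close>.\<close>

lemma link:
  assumes K: "lv \<omega> K" "lower K \<omega> (card (bd K))" and K': "lv \<omega> K'" "K' \<subseteq> K"
    and A: "A \<subseteq> bd K" "card A = m"
    and far: "\<Union>(endpoints G ` bd K) \<inter> K' = {}"
  shows "\<exists>F. flow K K' A F \<and> arc_edge ` inflow K F = A \<and>
     arc_edge ` {a \<in> F. hd_of a \<in> K'} \<subseteq> bd K' \<and> card (arc_edge ` {a \<in> F. hd_of a \<in> K'}) = m"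
proof -
  let ?E = "{e \<in> edges G. endpoints G e \<subseteq> K}"
  have cK: "cut K" using K(1) lv_cut by blast
  have finA: "finite A" using A(1) cut_finite[OF cK] finite_subset by blast
  have "m \<le> card (bd L \<inter> (A \<union> ?E))" if L: "K' \<subseteq> L" "L \<subseteq> K" "finite (bd L \<inter> (A \<union> ?E))" for L
  proof -
    \<comment> \<open>An edge of \<open>bd L\<close> that is not inside \<open>K\<close> is a
      boundary edge of \<open>K\<close>; of these the network lacks only the
      \<open>card (bd K) - m\<close> edges outside \<open>A\<close>.\<close>
    have sub: "bd L \<subseteq> (bd L \<inter> (A \<union> ?E)) \<union> (bd K - A)"
    proof
      fix e assume e: "e \<in> bd L"
      then obtain u v where uv: "e \<in> edges G" "endpoints G e = {u, v}" "u \<in> L" "v \<notin> L" unfolding edge_boundary_def by blast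
      show "e \<in> (bd L \<inter> (A \<union> ?E)) \<union> (bd K - A)"
        using e uv L(2) bd_iff[OF uv(1,2), of K] by (cases "v \<in> K") auto
    qed
    then have "finite (bd L)" using L(3) cut_finite[OF cK] finite_subset by (metis finite_Diff finite_UnI)
    then have cL: "cut L" using L(2) cut_subset[OF cK] by (auto simp: cut_def)
    then have "lv \<omega> L" using lv_mono[OF K'(1) L(1)] by blast
    then have "card (bd K) \<le> card (bd L)" using lowerD[OF K(2) _ L(2)] by blast
    also have "\<dots> \<le> card ((bd L \<inter> (A \<union> ?E)) \<union> (bd K - A))"
      by (rule card_mono[OF _ sub]) (use L(3) cut_finite[OF cK] in auto)
    also have "\<dots> \<le> card (bd L \<inter> (A \<union> ?E)) + card (bd K - A)" by (rule card_Un_le)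
    also have "card (bd K - A) = card (bd K) - m" using card_Diff_subset[OF finA A(1)] A(2) by simp
    finally show ?thesis using card_mono[OF cut_finite[OF cK] A(1)] A(2) by simp
  qed
  from max_flow[OF K'(2) cut_subset[OF cK] A(1) this order_refl] obtain F where
    F: "flow K K' A F" "card (inflow K F) = m" by blast
  have fin: "finite F" and Fa: "\<And>a. a \<in> F \<Longrightarrow> a \<in> arcs K K' A" and no: "\<And>a. a \<in> F \<Longrightarrow> rev_arc a \<notin> F"
    and bal: "\<And>v. v \<in> K - K' \<Longrightarrow> card {a \<in> F. tl_of a = v} = card {a \<in> F. hd_of a = v}"
    using F(1) unfolding flow_def by blast+
  have edge_inj: "a = b" if ab: "a \<in> F" "b \<in> F" "arc_edge a = arc_edge b" for a b
  proof -
    have "{tl_of a, hd_of a} = {tl_of b, hd_of b}" using arcsD(1)[OF Fa] ab by metis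
    then have "a = b \<or> a = rev_arc b" using ab(3) unfolding rev_arc_def
      by (auto simp: doubleton_eq_iff prod_eq_iff)
    then show ?thesis using no ab by blast
  qed
  have inA: "arc_edge ` inflow K F \<subseteq> A"
  proof
    fix e assume "e \<in> arc_edge ` inflow K F"
    then obtain a where "a \<in> F" "tl_of a \<notin> K" "e = arc_edge a" by blast
    then show "e \<in> A" using arcsD(5)[OF Fa] by blast
  qed
  have inj: "inj_on arc_edge X" if "X \<subseteq> F" for X by (rule inj_onI) (use edge_inj that in blast)
  have "card (arc_edge ` inflow K F) = m" using F(2) by (subst card_image[OF inj]) auto
  then have 1: "arc_edge ` inflow K F = A" using card_subset_eq[OF finA inA] A(2) by simp
  let ?O = "{a \<in> F. hd_of a \<in> K'}"
  have no_direct: "tl_of a \<in> K" if a: "a \<in> ?O" for a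
  proof (rule ccontr)
    assume "tl_of a \<notin> K"
    then have "arc_edge a \<in> bd K" using a inA A(1) by blast
    moreover have "hd_of a \<in> endpoints G (arc_edge a)" using arcsD(1)[OF Fa[of a]] a by simp
    ultimately show False using far a by blast
  qed
  \<comment> \<open>Counting \<open>F\<close> by tails and by heads gives the same contribution from
    \<open>K - K'\<close>; what remains is the inflow on one side and the arcs into
    \<open>K'\<close> on the other.\<close>
  have "card {a \<in> F. tl_of a \<in> K - K'} = card {a \<in> F. hd_of a \<in> K - K'}"
    by (rule card_balanced[OF fin bal])
  moreover have "F = inflow K F \<union> {a \<in> F. tl_of a \<in> K - K'}" using arcsD(3)[OF Fa] by blast
  then have "card F = card (inflow K F) + card {a \<in> F. tl_of a \<in> K - K'}"
    by (rule card_split[OF fin]) blast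
  moreover have "F = ?O \<union> {a \<in> F. hd_of a \<in> K - K'}" using arcsD(4)[OF Fa] by blast
  then have "card F = card ?O + card {a \<in> F. hd_of a \<in> K - K'}"
    by (rule card_split[OF fin]) blast
  ultimately have "card ?O = m" using F(2) by simp
  then have 2: "card (arc_edge ` ?O) = m" by (subst card_image[OF inj]) auto
  have "arc_edge ` ?O \<subseteq> bd K'"
  proof
    fix e assume "e \<in> arc_edge ` ?O"
    then obtain a where a: "a \<in> F" "hd_of a \<in> K'" "e = arc_edge a" by blast
    have E: "e \<in> edges G" using arcsD(5)[OF Fa[OF a(1)]] A(1) a(3) bd_edges by blast
    show "e \<in> bd K'" using bd_iff[OF E arcsD(1)[OF Fa[OF a(1)], folded a(3)]] arcsD(3)[OF Fa[OF a(1)]] a(2) by blast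
  qed
  then show ?thesis using F(1) 1 2 by blast
qed

text \<open>From each vertex proceed along the arc that follows its last visit.\<close>

lemma ray_of_trail:
  fixes a :: "nat \<Rightarrow> ('v, 'e) arc"
  assumes edge: "\<And>n. arc_edge (a n) \<in> edges G" "\<And>n. endpoints G (arc_edge (a n)) = {tl_of (a n), hd_of (a n)}"
    and walk: "\<And>n. tl_of (a (Suc n)) = hd_of (a n)"
    and fin: "\<And>v. finite {n. hd_of (a n) = v}"
  shows "\<exists>S x e. S \<in> rays G \<and> enum S x e \<and> edges S \<subseteq> range (arc_edge \<circ> a) \<and> (\<forall>k. \<exists>n\<ge>k. x k = hd_of (a n))"
proof -
  define w where "w = (\<lambda>n. hd_of (a n))"
  define last where "last = (\<lambda>v. Max {n. w n = v})"
  have last: "w (last (w n)) = w n" "n \<le> last (w n)" for n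
  proof -
    have f: "finite {k. w k = w n}" using fin by (simp add: w_def)
    show "w (last (w n)) = w n" using Max_in[OF f] unfolding last_def by blast
    show "n \<le> last (w n)" unfolding last_def by (rule Max_ge[OF f]) simp
  qed
  define pos where "pos = rec_nat (last (w 0)) (\<lambda>_ p. last (w (Suc p)))"
  have pos0: "pos 0 = last (w 0)" and posS: "pos (Suc k) = last (w (Suc (pos k)))" for k by (simp_all add: pos_def)
  have pos_last: "pos k = last (w (pos k))" for k
    by (cases k) (simp_all add: pos0 posS last)
  have "pos k < pos (Suc k)" for k using last(2)[of "Suc (pos k)"] posS[of k] by simp
  then have mono: "strict_mono pos" by (rule strict_mono_Suc_iff[THEN iffD2, rule_format])
  define x where "x = (\<lambda>k. w (pos k))"
  define e where "e = (\<lambda>k. arc_edge (a (Suc (pos k))))"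
  have "inj x"
  proof (rule injI)
    fix i j assume "x i = x j"
    then have "pos i = pos j" using pos_last[of i] pos_last[of j] by (simp add: x_def)
    then show "i = j" using mono strict_mono_eq by blast
  qed
  have ends: "endpoints G (e k) = {x k, x (Suc k)}" for k
  proof -
    have "x (Suc k) = hd_of (a (Suc (pos k)))" unfolding x_def posS last(1) by (simp add: w_def)
    moreover have "x k = tl_of (a (Suc (pos k)))" using walk by (simp add: x_def w_def)
    ultimately show ?thesis using edge(2) by (simp add: e_def)
  qed
  define S where "S = \<lparr>verts = range x, edges = range e, endpoints = endpoints G\<rparr>"
  have enum: "enum S x e" unfolding enum_def S_def using \<open>inj x\<close> ends by simp
  have "multigraph S" unfolding multigraph_def S_def using ends by auto
  moreover have "x k \<in> verts G" for k
    using endpoints_in[OF multigraph_G, of "e k"] edge(1) ends[of k] unfolding e_def by blast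
  ultimately have "subgraph S G" unfolding subgraph_def S_def using edge(1) by (auto simp: e_def)
  then have "S \<in> rays G" unfolding rays_def using enum ray_enum_iff by blast
  moreover have "edges S \<subseteq> range (arc_edge \<circ> a)" by (auto simp: S_def e_def)
  moreover have "\<exists>n\<ge>k. x k = hd_of (a n)" for k
    using strict_mono_imp_increasing[OF mono, of k] by (intro exI[of _ "pos k"]) (simp add: x_def w_def)
  ultimately show ?thesis using enum by blast
qed

text \<open>Each cut is chosen minimum inside a cut that avoids a further ball and all end vertices
  of the previous boundary. Minimality inside \<open>K i\<close> itself is what \<open>link\<close>
  asks for; avoiding balls makes the chain converge to \<omega>.\<close>

lemma cut_chain:
  assumes w: "\<omega> \<in> undominated_edge_ends G" and D: "lv \<omega> D"
  shows "\<exists>K. K (0::nat) \<subseteq> D \<and> (\<forall>i. lv \<omega> (K i) \<and> conn G (K i) \<and> lower (K i) \<omega> (card (bd (K i))) \<and>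
     K (Suc i) \<subseteq> K i \<and> K (Suc i) \<inter> ball i = {} \<and> \<Union>(endpoints G ` bd (K i)) \<inter> K (Suc i) = {})"
proof -
  define P where "P = (\<lambda>(i::nat) K. (i = 0 \<longrightarrow> K \<subseteq> D) \<and> lv \<omega> K \<and> conn G K \<and> lower K \<omega> (card (bd K)))"
  have "\<exists>K. \<forall>i. P i (K i) \<and> (K (Suc i) \<subseteq> K i \<and> K (Suc i) \<inter> ball i = {} \<and> \<Union>(endpoints G ` bd (K i)) \<inter> K (Suc i) = {})"
  proof (rule dependent_nat_choice)
    obtain K where K: "lv \<omega> K" "K \<subseteq> D" "conn G K" "lower D \<omega> (card (bd K))" using min_cut[OF D] by blast
    then have "P 0 K" unfolding P_def using lower_subset[OF K(4,2)] by simp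
    then show "\<exists>K. P 0 K" ..
  next
    fix K i assume "P i K"
    then have K: "lv \<omega> K" by (simp add: P_def)
    obtain C where C: "lv \<omega> C" "C \<inter> ball i = {}" using avoid_ball[OF w] by blast
    obtain C' where C': "lv \<omega> C'" "C' \<subseteq> K \<inter> C" "C' \<inter> \<Union>(endpoints G ` bd K) = {}"
      using avoid_finite[OF w finite_bd_endpoints[OF lv_cut[OF K]] lv_Int(1)[OF K C(1)]] by blast
    obtain K' where K': "lv \<omega> K'" "K' \<subseteq> C'" "conn G K'" "lower C' \<omega> (card (bd K'))" using min_cut[OF C'(1)] by blast
    have "P (Suc i) K'" unfolding P_def using lower_subset[OF K'(4,2)] K' by simp
    moreover have "K' \<subseteq> K" "K' \<inter> ball i = {}" "\<Union>(endpoints G ` bd K) \<inter> K' = {}" using K'(2) C' C(2) by blast+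
    ultimately show "\<exists>y. P (Suc i) y \<and> y \<subseteq> K \<and> y \<inter> ball i = {} \<and> \<Union>(endpoints G ` bd K) \<inter> y = {}" by blast
  qed
  then obtain K where K: "\<forall>i. P i (K i) \<and> (K (Suc i) \<subseteq> K i \<and> K (Suc i) \<inter> ball i = {} \<and> \<Union>(endpoints G ` bd (K i)) \<inter> K (Suc i) = {})" ..
  have "K 0 \<subseteq> D" using K unfolding P_def by blast
  with K show ?thesis unfolding P_def by (intro exI[of _ K]) simp
qed

text \<open>The finitely many end vertices of \<open>bd C\<close> lie in one ball, which some
  \<open>K i\<close> avoids; being connected, it cannot cross \<open>C\<close>.\<close>

lemma chain_converges:
  assumes K: "\<And>i. lv \<omega> (K i)" "\<And>i. conn G (K i)" "\<And>i. K (Suc i) \<inter> ball i = {}" and C: "lv \<omega> C"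
  shows "\<exists>i. K i \<subseteq> C"
proof -
  let ?Y = "\<Union>(endpoints G ` bd C)"
  have "?Y \<subseteq> verts G" using endpoints_in[OF multigraph_G] bd_edges by fast
  then have "\<forall>y\<in>?Y. \<exists>n. y \<in> ball n" using ball_exhausts by blast
  from bchoice[OF this] obtain f where f: "\<forall>y\<in>?Y. y \<in> ball (f y)" ..
  define n where "n = Max (insert 0 (f ` ?Y))"
  have fY: "finite ?Y" by (rule finite_bd_endpoints[OF lv_cut[OF C]])
  have "y \<in> ball n" if "y \<in> ?Y" for y
  proof -
    have "f y \<le> n" unfolding n_def by (rule Max_ge) (use fY that in auto)
    then show ?thesis using f that ball_mono by blast
  qed
  then have "?Y \<inter> K (Suc n) = {}" using K(3)[of n] by blast
  then have "K (Suc n) \<subseteq> C \<or> K (Suc n) \<inter> C = {}" by (rule conn_cases[OF K(2)])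
  then show ?thesis using lv_Int(2)[OF K(1) C] by blast
qed

text \<open>The outflow edges of each region are the prescribed inflow of the next, so the flows
  agree on the edges they share and unite to one flow \<open>FF\<close>. Pairing incoming with
  outgoing arcs at every vertex splits it into trails. The \<open>m\<close> trails that start at the
  sources share no edges, are eventually in every \<open>K i\<close>, and hence contain rays of
  \<omega>.\<close>

lemma many_rays:
  assumes w: "\<omega> \<in> undominated_edge_ends G" and D: "lv \<omega> D" "lower D \<omega> m"
  shows "\<exists>RR. RR \<subseteq> \<omega> \<and> card RR = m \<and> finite RR \<and> pairwise (\<lambda>R S. disjnt (edges R) (edges S)) RR"
proof -
  have wE: "\<omega> \<in> edge_ends G" using w by (simp add: undominated_iff)
  obtain K where K0: "K (0::nat) \<subseteq> D" and Kall: "\<forall>i. lv \<omega> (K i) \<and> conn G (K i) \<and> lower (K i) \<omega> (card (bd (K i))) \<and>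
     K (Suc i) \<subseteq> K i \<and> K (Suc i) \<inter> ball i = {} \<and> \<Union>(endpoints G ` bd (K i)) \<inter> K (Suc i) = {}"
    using cut_chain[OF w D(1)] by blast
  have Klv: "lv \<omega> (K i)" and Kconn: "conn G (K i)" and Klow: "lower (K i) \<omega> (card (bd (K i)))"
    and Kdec: "K (Suc i) \<subseteq> K i" and Kball: "K (Suc i) \<inter> ball i = {}"
    and Kfar: "\<Union>(endpoints G ` bd (K i)) \<inter> K (Suc i) = {}" for i using Kall by blast+
  have Kmono: "K j \<subseteq> K i" if "i \<le> j" for i j by (rule lift_Suc_antimono_le[of K, OF Kdec that])
  have Kverts: "K i \<subseteq> verts G" for i using cut_subset[OF lv_cut[OF Klv]] .
  define lk where "lk = (\<lambda>i A A' F. flow (K i) (K (Suc i)) A F \<and> arc_edge ` inflow (K i) F = A \<and>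
     arc_edge ` {a \<in> F. hd_of a \<in> K (Suc i)} = A')"
  have "\<exists>A. \<forall>i. (A i \<subseteq> bd (K i) \<and> card (A i) = m) \<and> (\<exists>F. lk i (A i) (A (Suc i)) F)"
  proof (rule dependent_nat_choice)
    have "m \<le> card (bd (K 0))" using lowerD[OF D(2) Klv K0] .
    then show "\<exists>A. A \<subseteq> bd (K 0) \<and> card A = m" using obtain_subset_with_card_n by metis
  next
    fix A i assume A: "A \<subseteq> bd (K i) \<and> card A = m"
    obtain F where "flow (K i) (K (Suc i)) A F \<and> arc_edge ` inflow (K i) F = A \<and>
     arc_edge ` {a \<in> F. hd_of a \<in> K (Suc i)} \<subseteq> bd (K (Suc i)) \<and> card (arc_edge ` {a \<in> F. hd_of a \<in> K (Suc i)}) = m"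
      using link[OF Klv Klow Klv Kdec conjunct1[OF A] conjunct2[OF A] Kfar] by blast
    then show "\<exists>A'. (A' \<subseteq> bd (K (Suc i)) \<and> card A' = m) \<and> (\<exists>F. lk i A A' F)"
      unfolding lk_def by blast
  qed
  then obtain A where A: "\<And>i. A i \<subseteq> bd (K i)" "\<And>i. card (A i) = m" "\<And>i. \<exists>F. lk i (A i) (A (Suc i)) F" by blast
  from A(3) obtain F where F: "\<And>i. lk i (A i) (A (Suc i)) (F i)" by metis
  have Ffl: "flow (K i) (K (Suc i)) (A i) (F i)" and Fin: "arc_edge ` inflow (K i) (F i) = A i"
    and Fout: "arc_edge ` {a \<in> F i. hd_of a \<in> K (Suc i)} = A (Suc i)" for i using F unfolding lk_def by blast+
  have fin: "finite (F i)" and Farc: "a \<in> F i \<Longrightarrow> a \<in> arcs (K i) (K (Suc i)) (A i)"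
    and no: "a \<in> F i \<Longrightarrow> rev_arc a \<notin> F i"
    and bal: "v \<in> K i - K (Suc i) \<Longrightarrow> card {a \<in> F i. tl_of a = v} = card {a \<in> F i. hd_of a = v}" for i a v
    using Ffl[of i] unfolding flow_def by blast+
  have Fends: "endpoints G (arc_edge a) = {tl_of a, hd_of a}" "tl_of a \<noteq> hd_of a" "tl_of a \<notin> K (Suc i)" "hd_of a \<in> K i"
    "arc_edge a \<in> A i \<or> (arc_edge a \<in> edges G \<and> tl_of a \<in> K i)" if "a \<in> F i" for a i
    using arcsD[OF Farc[OF that]] by blast+
  have Fedge: "arc_edge a \<in> edges G" if "a \<in> F i" for a i using Fends(5)[OF that] A(1) bd_edges by blast
  have same: "a = b \<or> a = rev_arc b" if ab: "a \<in> F i" "b \<in> F j" "arc_edge a = arc_edge b" for a b i j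
  proof -
    have "{tl_of a, hd_of a} = {tl_of b, hd_of b}" using Fends(1)[OF ab(1)] Fends(1)[OF ab(2)] ab(3) by simp
    then show ?thesis using ab(3) unfolding rev_arc_def by (auto simp: doubleton_eq_iff prod_eq_iff)
  qed
  \<comment> \<open>Both flows direct a shared edge into \<open>K (Suc i)\<close>, so they contain
    the same arc and not its reverse.\<close>
  have up: "a \<in> F (Suc i)" if a: "a \<in> F i" "hd_of a \<in> K (Suc i)" for a i
  proof -
    have "arc_edge a \<in> arc_edge ` inflow (K (Suc i)) (F (Suc i))" using a Fout[of i] Fin[of "Suc i"] by blast
    then obtain b where b: "b \<in> F (Suc i)" "tl_of b \<notin> K (Suc i)" "arc_edge a = arc_edge b" by blast
    have "a \<noteq> rev_arc b" using b(2) a(2) by auto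
    then show ?thesis using same[OF a(1) b(1,3)] b(1) by blast
  qed
  have down: "a \<in> F i" if a: "a \<in> F (Suc i)" "tl_of a \<notin> K (Suc i)" for a i
  proof -
    have "arc_edge a \<in> A (Suc i)" using a Fin[of "Suc i"] by blast
    then have "arc_edge a \<in> arc_edge ` {a \<in> F i. hd_of a \<in> K (Suc i)}" using Fout[of i] by blast
    then obtain b where b: "b \<in> F i" "hd_of b \<in> K (Suc i)" "arc_edge a = arc_edge b" by blast
    have "a \<noteq> rev_arc b" using b(2) a(2) by auto
    then show ?thesis using same[OF a(1) b(1,3)] b(1) by blast
  qed
  have in_level: "a \<in> F i" if "a \<in> F j" "j \<le> i" "hd_of a \<in> K i" for a i j
    using that(2,3)
  proof (induction i rule: dec_induct)
    case base then show ?case using that(1) by blast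
  next
    case (step k)
    have "hd_of a \<in> K k" using step.prems Kdec by blast
    then show ?case using up[OF step.IH step.prems] by blast
  qed
  have out_level: "a \<in> F i" if "a \<in> F j" "i \<le> j" "tl_of a \<notin> K (Suc i)" for a i j
    using that(2,1,3)
  proof (induction j arbitrary: a rule: dec_induct)
    case (step k)
    have "K (Suc k) \<subseteq> K (Suc i)" by (rule Kmono) (use step(1) in simp)
    then have "tl_of a \<notin> K (Suc k)" using step.prems(2) by blast
    then show ?case using step.IH[OF down[OF step.prems(1)]] step.prems(2) by blast
  qed
  define FF where "FF = (\<Union>i. F i)"
  have FFobt: "\<exists>i. a \<in> F i" if "a \<in> FF" for a using that by (simp add: FF_def)
  have level: "\<exists>i. v \<in> K i - K (Suc i)" if v: "v \<in> K 0" for v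
  proof (rule ccontr)
    assume n: "\<nexists>i. v \<in> K i - K (Suc i)"
    have all: "v \<in> K i" for i by (induction i) (use v n in blast)+
    obtain k where "v \<in> ball k" using ball_exhausts[of v] Kverts[of 0] v by blast
    then show False using all[of "Suc k"] Kball[of k] by blast
  qed
  \<comment> \<open>At a vertex of \<open>K i - K (Suc i)\<close> the union \<open>FF\<close> has no
    other arcs than \<open>F i\<close>, so finiteness and conservation carry over.\<close>
  have inFF: "{a \<in> FF. hd_of a = v} = {a \<in> F i. hd_of a = v}"
    and outFF: "{a \<in> FF. tl_of a = v} = {a \<in> F i. tl_of a = v}" if v: "v \<in> K i - K (Suc i)" for v i
  proof -
    have "a \<in> F i" if a: "a \<in> FF" "hd_of a = v" for a
    proof -
      obtain j where j: "a \<in> F j" using FFobt[OF a(1)] by blast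
      have "j \<le> i"
      proof (rule ccontr)
        assume "\<not> j \<le> i"
        then have "K j \<subseteq> K (Suc i)" using Kmono[of "Suc i" j] by simp
        then show False using Fends(4)[OF j] a(2) v by blast
      qed
      then show ?thesis using in_level[OF j] a(2) v by blast
    qed
    then show "{a \<in> FF. hd_of a = v} = {a \<in> F i. hd_of a = v}" unfolding FF_def by blast
    have "a \<in> F i" if a: "a \<in> FF" "tl_of a = v" for a
    proof -
      obtain j where j: "a \<in> F j" using FFobt[OF a(1)] by blast
      have "i \<le> j"
      proof (rule ccontr)
        assume "\<not> i \<le> j"
        then have "K i \<subseteq> K (Suc j)" using Kmono[of "Suc j" i] by simp
        then show False using Fends(3)[OF j] a(2) v by blast
      qed
      then show ?thesis using out_level[OF j] a(2) v by blast
    qed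
    then show "{a \<in> FF. tl_of a = v} = {a \<in> F i. tl_of a = v}" unfolding FF_def by blast
  qed
  have FFfin: "finite {a \<in> FF. hd_of a = v}" and FFout: "finite {a \<in> FF. tl_of a = v}"
    and FFcard: "card {a \<in> FF. hd_of a = v} = card {a \<in> FF. tl_of a = v}" if v: "v \<in> K 0" for v
  proof -
    obtain i where i: "v \<in> K i - K (Suc i)" using level[OF v] by blast
    show "finite {a \<in> FF. hd_of a = v}" "finite {a \<in> FF. tl_of a = v}" unfolding inFF[OF i] outFF[OF i] using fin by simp_all
    show "card {a \<in> FF. hd_of a = v} = card {a \<in> FF. tl_of a = v}" unfolding inFF[OF i] outFF[OF i] using bal[OF i] by simp
  qed
  have FFhd: "hd_of a \<in> K 0" if a: "a \<in> FF" for a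
  proof -
    obtain j where j: "a \<in> F j" using FFobt[OF a] by blast
    then show ?thesis using Fends(4)[OF j] Kmono[of 0 j] by blast
  qed
  have FFno: "rev_arc a \<notin> FF" if a: "a \<in> FF" for a
  proof
    assume "rev_arc a \<in> FF"
    then obtain j where j: "rev_arc a \<in> F j" using FFobt by blast
    obtain i where i: "a \<in> F i" using FFobt[OF a] by blast
    have ij: "\<not> i < j"
    proof
      assume "i < j"
      then have "K j \<subseteq> K (Suc i)" using Kmono[of "Suc i" j] by simp
      then show False using Fends(4)[OF j] Fends(3)[OF i] by auto
    qed
    have "\<not> j < i"
    proof
      assume "j < i"
      then have "K i \<subseteq> K (Suc j)" using Kmono[of "Suc j" i] by simp
      then show False using Fends(3)[OF j] Fends(4)[OF i] by auto
    qed
    then have "i = j" using ij by simp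
    then show False using no[OF i] j by simp
  qed
  have FFeq: "a = b" if ab: "a \<in> FF" "b \<in> FF" "arc_edge a = arc_edge b" for a b
  proof -
    obtain i j where ij: "a \<in> F i" "b \<in> F j" using FFobt[OF ab(1)] FFobt[OF ab(2)] by blast
    show ?thesis using same[OF ij ab(3)] FFno[OF ab(2)] ab(1) by blast
  qed
  have "\<exists>g. bij_betw g {a \<in> FF. hd_of a = v} {a \<in> FF. tl_of a = v}" if "v \<in> K 0" for v
    by (rule finite_same_card_bij[OF FFfin FFout FFcard]) (rule that)+
  then have "\<forall>v\<in>K 0. \<exists>g. bij_betw g {a \<in> FF. hd_of a = v} {a \<in> FF. tl_of a = v}" by blast
  from bchoice[OF this] obtain g where g: "\<forall>v\<in>K 0. bij_betw (g v) {a \<in> FF. hd_of a = v} {a \<in> FF. tl_of a = v}" ..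
  \<comment> \<open>Incoming arcs are matched bijectively with outgoing ones, so trails cannot
    merge.\<close>
  define nxt where "nxt = (\<lambda>a. g (hd_of a) a)"
  have nxt: "nxt a \<in> FF" "tl_of (nxt a) = hd_of a" if a: "a \<in> FF" for a
  proof -
    have "bij_betw (g (hd_of a)) {b \<in> FF. hd_of b = hd_of a} {b \<in> FF. tl_of b = hd_of a}" using g FFhd[OF a] by blast
    then have "nxt a \<in> {b \<in> FF. tl_of b = hd_of a}" using a unfolding nxt_def by (auto dest: bij_betwE)
    then show "nxt a \<in> FF" "tl_of (nxt a) = hd_of a" by blast+
  qed
  have nxt_inj: "a = b" if ab: "a \<in> FF" "b \<in> FF" "nxt a = nxt b" for a b
  proof -
    have hd: "hd_of a = hd_of b" using nxt(2)[OF ab(1)] nxt(2)[OF ab(2)] ab(3) by metis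
    have "bij_betw (g (hd_of a)) {b \<in> FF. hd_of b = hd_of a} {b \<in> FF. tl_of b = hd_of a}" using g FFhd[OF ab(1)] by blast
    then have "inj_on (g (hd_of a)) {b \<in> FF. hd_of b = hd_of a}" by (rule bij_betw_imp_inj_on)
    moreover have "g (hd_of a) a = g (hd_of a) b" using ab(3) hd unfolding nxt_def by simp
    ultimately show ?thesis using ab(1,2) hd by (auto dest!: inj_onD)
  qed
  define S0 where "S0 = inflow (K 0) (F 0)"
  have S0FF: "a \<in> FF" if "a \<in> S0" for a using that unfolding S0_def FF_def by blast
  have inj_edge: "inj_on arc_edge S0" by (rule inj_onI) (use FFeq S0FF in blast)
  have "card (arc_edge ` S0) = m" unfolding S0_def Fin by (rule A(2))
  then have S0: "card S0 = m" "finite S0" using card_image[OF inj_edge] fin[of 0] by (simp_all add: S0_def)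
  have src: "nxt a \<notin> S0" if "a \<in> FF" for a using nxt(2)[OF that] FFhd[OF that] unfolding S0_def by auto
  define orb where "orb = (\<lambda>a n. (nxt ^^ n) a)"
  have orb0: "orb a 0 = a" and orbS: "orb a (Suc n) = nxt (orb a n)" for a n by (simp_all add: orb_def)
  have orbFF: "orb a n \<in> FF" if "a \<in> S0" for a n
    by (induction n) (use that S0FF nxt(1) in \<open>simp_all add: orb0 orbS\<close>)
  \<comment> \<open>Walking both orbits back by injectivity of \<open>nxt\<close> leads to a source,
    and a source is no successor. Hence orbits neither meet nor repeat an arc.\<close>
  have orb_inj: "a = b \<and> i = j" if ab: "a \<in> S0" "b \<in> S0" "orb a i = orb b j" for a b i j
    using ab(3)
  proof (induction i arbitrary: j)
    case 0
    then show ?case using src[OF orbFF[OF ab(2)]] ab(1) by (cases j) (auto simp: orb0 orbS)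
  next
    case (Suc i)
    show ?case
    proof (cases j)
      case 0
      then show ?thesis using Suc.prems src[OF orbFF[OF ab(1)]] ab(2) by (auto simp: orb0 orbS)
    next
      case (Suc k)
      then have "orb a i = orb b k" using nxt_inj[OF orbFF[OF ab(1)] orbFF[OF ab(2)]] Suc.prems by (simp add: orbS)
      then show ?thesis using Suc.IH Suc by blast
    qed
  qed
  have orb_fin: "finite {n. orb a n \<in> X}" if "a \<in> S0" "finite X" for a X
  proof -
    have "inj (orb a)" using orb_inj[OF that(1,1)] by (auto intro: injI)
    then show ?thesis using finite_vimageI[OF that(2)] by (simp add: vimage_def)
  qed
  have ray: "\<exists>S. S \<in> \<omega> \<and> edges S \<subseteq> range (arc_edge \<circ> orb a) \<and> edges S \<noteq> {}" if a: "a \<in> S0" for a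
  proof -
    have "\<exists>S x e. S \<in> rays G \<and> enum S x e \<and> edges S \<subseteq> range (arc_edge \<circ> orb a) \<and> (\<forall>k. \<exists>n\<ge>k. x k = hd_of (orb a n))"
    proof (rule ray_of_trail)
      fix n
      obtain i where i: "orb a n \<in> F i" using FFobt[OF orbFF[OF a]] by blast
      show "arc_edge (orb a n) \<in> edges G" "endpoints G (arc_edge (orb a n)) = {tl_of (orb a n), hd_of (orb a n)}"
        using Fedge[OF i] Fends(1)[OF i] by blast+
      show "tl_of (orb a (Suc n)) = hd_of (orb a n)" unfolding orbS by (rule nxt(2)[OF orbFF[OF a]])
    next
      fix v
      show "finite {n. hd_of (orb a n) = v}"
      proof (cases "v \<in> K 0")
        case True
        have "{n. hd_of (orb a n) = v} \<subseteq> {n. orb a n \<in> {b \<in> FF. hd_of b = v}}" using orbFF[OF a] by blast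
        then show ?thesis using orb_fin[OF a FFfin[OF True]] finite_subset by blast
      next
        case False
        then have "{n. hd_of (orb a n) = v} = {}" using FFhd[OF orbFF[OF a]] by blast
        then show ?thesis by (metis finite.emptyI)
      qed
    qed
    then obtain S x e where S: "S \<in> rays G" "enum S x e" "edges S \<subseteq> range (arc_edge \<circ> orb a)"
      "\<forall>k. \<exists>n\<ge>k. x k = hd_of (orb a n)" by blast
    \<comment> \<open>An orbit repeats no arc, so it leaves the finitely many arcs of the flows
      \<open>F j\<close> with \<open>j < i\<close>; all other arcs have their head in
      \<open>K i\<close>.\<close>
    have evK: "\<exists>n. \<forall>k\<ge>n. x k \<in> K i" for i
    proof -
      have "hd_of b \<in> K i" if b: "b \<in> FF" "b \<notin> (\<Union>j<i. F j)" for b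
      proof -
        obtain j where j: "b \<in> F j" using FFobt[OF b(1)] by blast
        then have "i \<le> j" using b(2) by (meson UN_I lessThan_iff not_le)
        then show ?thesis using Fends(4)[OF j] Kmono by blast
      qed
      moreover have "finite {n. orb a n \<in> (\<Union>j<i. F j)}" by (rule orb_fin[OF a]) (use fin in blast)
      then obtain N where N: "\<forall>n\<in>{n. orb a n \<in> (\<Union>j<i. F j)}. n < N" using finite_nat_set_iff_bounded by blast
      ultimately have h: "hd_of (orb a n) \<in> K i" if "n \<ge> N" for n using that orbFF[OF a] by (metis leD mem_Collect_eq)
      have "x k \<in> K i" if k: "k \<ge> N" for k
      proof -
        obtain n where "n \<ge> k" "x k = hd_of (orb a n)" using S(4) by blast
        then show ?thesis using h[of n] k by simp
      qed
      then show ?thesis by blast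
    qed
    have "S \<in> \<omega>"
    proof (rule ray_in_end[OF wE S(1)])
      fix C assume "lv \<omega> C"
      then obtain i where "K i \<subseteq> C" using chain_converges[of \<omega> K, OF Klv Kconn Kball] by blast
      then show "evin S C" unfolding evin_iff[OF S(2)] using evK[of i] by blast
    qed
    moreover have "edges S \<noteq> {}" using S(2) by (auto simp: enum_def)
    ultimately show ?thesis using S(3) by blast
  qed
  then have "\<forall>a\<in>S0. \<exists>S. S \<in> \<omega> \<and> edges S \<subseteq> range (arc_edge \<circ> orb a) \<and> edges S \<noteq> {}" by blast
  from bchoice[OF this] obtain \<rho> where \<rho>: "\<forall>a\<in>S0. \<rho> a \<in> \<omega> \<and> edges (\<rho> a) \<subseteq> range (arc_edge \<circ> orb a) \<and> edges (\<rho> a) \<noteq> {}" ..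
  have dis: "disjnt (edges (\<rho> a)) (edges (\<rho> b))" if ab: "a \<in> S0" "b \<in> S0" "a \<noteq> b" for a b
    unfolding disjnt_def
  proof (rule ccontr)
    assume "edges (\<rho> a) \<inter> edges (\<rho> b) \<noteq> {}"
    then obtain z where "z \<in> edges (\<rho> a)" "z \<in> edges (\<rho> b)" by blast
    then have "z \<in> range (arc_edge \<circ> orb a)" "z \<in> range (arc_edge \<circ> orb b)" using \<rho> ab(1,2) by blast+
    then obtain i j where "z = arc_edge (orb a i)" "z = arc_edge (orb b j)" unfolding comp_def by blast
    then have "orb a i = orb b j" using FFeq[OF orbFF[OF ab(1)] orbFF[OF ab(2)]] by metis
    then show False using orb_inj[OF ab(1,2)] ab(3) by blast
  qed
  have "inj_on \<rho> S0"
  proof (rule inj_onI, rule ccontr)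
    fix a b assume ab: "a \<in> S0" "b \<in> S0" "\<rho> a = \<rho> b" "a \<noteq> b"
    then have "edges (\<rho> a) = {}" using dis[OF ab(1,2,4)] by (simp add: disjnt_def)
    then show False using \<rho> ab(1) by blast
  qed
  then have "card (\<rho> ` S0) = m" using S0 card_image by metis
  moreover have "pairwise (\<lambda>R S. disjnt (edges R) (edges S)) (\<rho> ` S0)"
    unfolding pairwise_def using dis by blast
  moreover have "\<rho> ` S0 \<subseteq> \<omega>" using \<rho> by blast
  ultimately show ?thesis using S0(2) by blast
qed

section \<open>Edge-degrees and the sizes of cuts around an end\<close>

lemma edge_degree_ge:
  assumes "\<omega> \<in> undominated_edge_ends G" "lv \<omega> D" "lower D \<omega> m"
  shows "enat m \<le> edge_degree \<omega>"
proof -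
  obtain RR where RR: "RR \<subseteq> \<omega>" "card RR = m" "finite RR" "pairwise (\<lambda>R S. disjnt (edges R) (edges S)) RR"
    using many_rays[OF assms] by blast
  then have "ecard RR = enat m" by (simp add: ecard_def)
  then show ?thesis unfolding edge_degree_def using RR by (intro Sup_upper CollectI exI[of _ RR]) simp
qed

text \<open>Otherwise \<open>Suc d\<close> would be a lower bound inside \<open>D\<close>, and there
  would be more than \<open>d\<close> edge-disjoint rays.\<close>

lemma cut_le_degree:
  assumes w: "\<omega> \<in> undominated_edge_ends G" "edge_degree \<omega> = enat d" "lv \<omega> D"
  shows "\<exists>C. lv \<omega> C \<and> C \<subseteq> D \<and> card (bd C) \<le> d"
proof (rule ccontr)
  assume "\<not> ?thesis"
  then have "lower D \<omega> (Suc d)" unfolding lower_def by (metis not_less_eq_eq)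
  then have "enat (Suc d) \<le> enat d" using edge_degree_ge[OF w(1,3)] w(2) by metis
  then show False by simp
qed

lemma ray_hits_boundary:
  assumes R: "R \<in> rays G" "enum R x e" and L: "x 0 \<notin> L" "evin R L"
  shows "\<exists>k. e k \<in> bd L"
proof -
  obtain n where n: "\<forall>k\<ge>n. x k \<in> L" using L(2) unfolding evin_iff[OF R(2)] ..
  have "\<exists>k. x k \<notin> L \<and> x (Suc k) \<in> L"
  proof (rule ccontr)
    assume c: "\<nexists>k. x k \<notin> L \<and> x (Suc k) \<in> L"
    have "x k \<notin> L" for k by (induction k) (use L(1) c in blast)+
    then show False using n by blast
  qed
  then show ?thesis using bd_iff[OF ray_edges(1,2)[OF R]] by blast
qed

text \<open>\<open>Y\<close> collects the first vertices of the rays. A ray that starts outside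
  \<open>L\<close> and is eventually inside uses an edge of \<open>bd L\<close>, and disjoint rays
  use different ones.\<close>

lemma disjoint_rays_le_boundary:
  assumes w: "\<omega> \<in> edge_ends G" and RR: "RR \<subseteq> \<omega>" "finite RR" "pairwise (\<lambda>R S. disjnt (edges R) (edges S)) RR"
  shows "\<exists>Y. finite Y \<and> (\<forall>L. lv \<omega> L \<longrightarrow> L \<inter> Y = {} \<longrightarrow> card RR \<le> card (bd L))"
proof -
  have "\<forall>R\<in>RR. \<exists>x. ray_enum R x" using end_ray_rays[OF w] RR(1) unfolding rays_def by blast
  from bchoice[OF this] obtain X where X: "\<forall>R\<in>RR. ray_enum R (X R)" ..
  let ?Y = "(\<lambda>R. X R 0) ` RR"
  have "card RR \<le> card (bd L)" if L: "lv \<omega> L" "L \<inter> ?Y = {}" for L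
  proof -
    have "\<exists>f. f \<in> edges R \<and> f \<in> bd L" if R: "R \<in> RR" for R
    proof -
      obtain e where e: "enum R (X R) e" using X R ray_enum_iff by blast
      have "X R 0 \<notin> L" using L(2) R by blast
      moreover have "evin R L" using lv_ray[OF w _ lv_cut[OF L(1)]] L(1) R RR(1) by blast
      ultimately obtain k where "e k \<in> bd L" using ray_hits_boundary[OF _ e] end_ray_rays[OF w] R RR(1) by blast
      moreover have "e k \<in> edges R" using e by (simp add: enum_def)
      ultimately show ?thesis by blast
    qed
    then have "\<forall>R\<in>RR. \<exists>f. f \<in> edges R \<and> f \<in> bd L" by blast
    from bchoice[OF this] obtain f where f: "\<forall>R\<in>RR. f R \<in> edges R \<and> f R \<in> bd L" ..
    have "inj_on f RR"
    proof (rule inj_onI, rule ccontr)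
      fix R S assume RS: "R \<in> RR" "S \<in> RR" "f R = f S" "R \<noteq> S"
      then have "disjnt (edges R) (edges S)" using RR(3) unfolding pairwise_def by blast
      then show False using f RS unfolding disjnt_def by (metis IntI empty_iff)
    qed
    moreover have "f ` RR \<subseteq> bd L" using f by blast
    ultimately show ?thesis using card_inj_on_le cut_finite[OF lv_cut[OF L(1)]] by blast
  qed
  then show ?thesis using RR(2) by (intro exI[of _ ?Y]) simp
qed

text \<open>From a vertex of \<open>C n - C (Suc n)\<close> proceed inside \<open>C n\<close> along a shortest path to \<open>C (Suc n)\<close>.\<close>

lemma chain_end:
  assumes C: "\<And>n. cut (C n)" "\<And>n. conn G (C n)" "\<And>n. C (Suc n) \<subseteq> C n" "\<And>v. \<exists>n. v \<notin> C n"
  shows "\<exists>\<omega>\<in>edge_ends G. \<forall>n. lv \<omega> (C n)"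
proof -
  have Cmono: "C j \<subseteq> C i" if "i \<le> j" for i j by (rule lift_Suc_antimono_le[of C, OF C(3) that])
  \<comment> \<open>For \<open>v \<in> C 0\<close> this is the index of the last member of the chain
    that contains \<open>v\<close>.\<close>
  define lev where "lev = (\<lambda>v. (LEAST n. v \<notin> C (Suc n)))"
  have lev1: "v \<notin> C (Suc (lev v))" for v
  proof -
    obtain n where "v \<notin> C n" using C(4) by blast
    then have "v \<notin> C (Suc n)" using C(3) by blast
    then show ?thesis unfolding lev_def by (rule LeastI)
  qed
  have lev2: "v \<in> C (lev v)" if "v \<in> C 0" for v
  proof (cases "lev v")
    case (Suc k)
    then have "k < (LEAST n. v \<notin> C (Suc n))" by (simp add: lev_def)
    then show ?thesis using not_less_Least Suc by metis
  qed (use that in simp)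
  have lev_ge: "n \<le> lev v" if "v \<in> C n" for v n
  proof (rule ccontr)
    assume "\<not> n \<le> lev v"
    then have "C n \<subseteq> C (Suc (lev v))" using Cmono[of "Suc (lev v)" n] by simp
    then show False using that lev1 by blast
  qed
  define good where "good = (\<lambda>v k. \<exists>w\<in>C (Suc (lev v)). (v, w) \<in> (adj G \<inter> C (lev v) \<times> C (lev v)) ^^ k)"
  define d where "d = (\<lambda>v. LEAST k. good v k)"
  have good: "good v (d v)" if v: "v \<in> C 0" for v
  proof -
    obtain w where w: "w \<in> C (Suc (lev v))" using C(2) conn_nonempty by blast
    then have "w \<in> C (lev v)" using C(3) by blast
    then have "(v, w) \<in> (adj G \<inter> C (lev v) \<times> C (lev v))\<^sup>*" using C(2) lev2[OF v] unfolding conn_def by blast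
    then have "\<exists>k. good v k" using rtrancl_imp_relpow w unfolding good_def by metis
    then show ?thesis unfolding d_def by (rule LeastI_ex)
  qed
  \<comment> \<open>Strict progress: the level rises, or it stays and the distance to the next
    member falls. As this order is transitive and irreflexive, the walk repeats no vertex.\<close>
  define better where "better = (\<lambda>u v. lev u < lev v \<or> (lev u = lev v \<and> d v < d u))"
  have "\<exists>w. w \<in> C 0 \<and> (v, w) \<in> adj G \<and> better v w" if v: "v \<in> C 0" for v
  proof -
    obtain z where z: "z \<in> C (Suc (lev v))" "(v, z) \<in> (adj G \<inter> C (lev v) \<times> C (lev v)) ^^ d v"
      using good[OF v] unfolding good_def by blast
    have "d v \<noteq> 0"
    proof
      assume "d v = 0"
      then have "z = v" using z(2) by simp
      then show False using z(1) lev1 by blast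
    qed
    then obtain k where k: "d v = Suc k" by (cases "d v") auto
    then obtain w where w: "(v, w) \<in> adj G \<inter> C (lev v) \<times> C (lev v)" "(w, z) \<in> (adj G \<inter> C (lev v) \<times> C (lev v)) ^^ k"
      using z(2) relpow_Suc_D2 by metis
    have w0: "w \<in> C 0" using w(1) Cmono[of 0 "lev v"] by blast
    have le: "lev v \<le> lev w" using w(1) lev_ge by blast
    have "better v w"
    proof (cases "lev v = lev w")
      case True
      then have "good w k" using z(1) w(2) unfolding good_def by auto
      then have "d w \<le> k" unfolding d_def by (rule Least_le)
      then show ?thesis using True k unfolding better_def by simp
    next
      case False
      then show ?thesis using le unfolding better_def by simp
    qed
    then show ?thesis using w0 w(1) by blast
  qed
  then have "\<forall>v\<in>C 0. \<exists>w. w \<in> C 0 \<and> (v, w) \<in> adj G \<and> better v w" by blast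
  from bchoice[OF this] obtain f where f: "\<forall>v\<in>C 0. f v \<in> C 0 \<and> (v, f v) \<in> adj G \<and> better v (f v)" ..
  obtain v0 where v0: "v0 \<in> C 0" using C(2) conn_nonempty by blast
  define x where "x = (\<lambda>n. (f ^^ n) v0)"
  have xC: "x n \<in> C 0" for n by (induction n) (use v0 f in \<open>simp_all add: x_def\<close>)
  have xs: "(x n, x (Suc n)) \<in> adj G" "better (x n) (x (Suc n))" for n using f xC[of n] by (simp_all add: x_def)
  have better_trans: "better a c" if "better a b" "better b c" for a b c using that unfolding better_def by auto
  have bi: "better (x i) (x j)" if "i < j" for i j
    using that by (induction rule: less_Suc_induct) (use xs(2) better_trans in blast)+
  have "inj x"
  proof (rule injI, rule ccontr)
    fix i j assume ij: "x i = x j" "i \<noteq> j"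
    then have "better (x i) (x i)" using bi[of i j] bi[of j i] by (metis nat_neq_iff)
    then show False by (simp add: better_def)
  qed
  \<comment> \<open>At a constant level the distance decreases, which cannot go on forever.\<close>
  have "\<exists>j>i. lev (x i) < lev (x j)" for i
  proof (induction "d (x i)" arbitrary: i rule: less_induct)
    case less
    show ?case
    proof (cases "lev (x i) < lev (x (Suc i))")
      case False
      then have e: "lev (x i) = lev (x (Suc i))" "d (x (Suc i)) < d (x i)" using xs(2)[of i] unfolding better_def by auto
      then obtain j where "j > Suc i" "lev (x (Suc i)) < lev (x j)" using less(1)[of "Suc i"] by blast
      then show ?thesis using e(1) by (intro exI[of _ j]) simp
    qed blast
  qed
  then have ex: "\<exists>i. n \<le> lev (x i)" for n
  proof (induction n)
    case (Suc n)
    then obtain i where "n \<le> lev (x i)" by blast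
    moreover obtain j where "lev (x i) < lev (x j)" using Suc(2) by blast
    ultimately show ?case by (intro exI[of _ j]) simp
  qed simp
  have ev: "\<exists>i. \<forall>k\<ge>i. x k \<in> C n" for n
  proof -
    obtain i where i: "n \<le> lev (x i)" using ex by blast
    have "x k \<in> C n" if "k \<ge> i" for k
    proof -
      have "lev (x i) \<le> lev (x k)" using bi[of i k] that unfolding better_def by (cases "i = k") auto
      then show ?thesis using lev2[OF xC[of k]] Cmono[of n "lev (x k)"] i by auto
    qed
    then show ?thesis by blast
  qed
  have "\<exists>e. e \<in> edges G \<and> endpoints G e = {x n, x (Suc n)}" for n using xs(1)[of n] unfolding adj_def by blast
  then obtain e where e: "\<And>n. e n \<in> edges G" "\<And>n. endpoints G (e n) = {x n, x (Suc n)}" by metis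
  define S where "S = \<lparr>verts = range x, edges = range e, endpoints = endpoints G\<rparr>"
  have enum: "enum S x e" unfolding enum_def S_def using \<open>inj x\<close> e by simp
  have "multigraph S" unfolding multigraph_def S_def using e by auto
  moreover have "x k \<in> verts G" for k using xC cut_subset[OF C(1)] by blast
  ultimately have "subgraph S G" unfolding subgraph_def S_def using e(1) by auto
  then have S: "S \<in> rays G" unfolding rays_def using enum ray_enum_iff by blast
  define \<omega> where "\<omega> = edge_equiv G `` {S}"
  have w: "\<omega> \<in> edge_ends G" "S \<in> \<omega>" unfolding \<omega>_def edge_ends_def
    using S equiv_class_self[OF equiv_edge_equiv S] by (auto intro: quotientI)
  have "evin S (C n)" for n unfolding evin_iff[OF enum] by (rule ev)
  then have "lv \<omega> (C n)" for n using lv_ray[OF w C(1)] by blast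
  then show ?thesis using w(1) by blast
qed

end

section \<open>Rooted trees given by a parent function\<close>

text \<open>The depth makes iterated parents reach the root and serves as the measure for inductions
  on the tree.\<close>

locale parent_tree =
  fixes N :: "'a set" and r :: 'a and par :: "'a \<Rightarrow> 'a" and dep :: "'a \<Rightarrow> nat"
  assumes root_in_N: "r \<in> N" and par_in_N: "t \<in> N \<Longrightarrow> t \<noteq> r \<Longrightarrow> par t \<in> N"
    and dep_par: "t \<in> N \<Longrightarrow> t \<noteq> r \<Longrightarrow> dep t = Suc (dep (par t))" and dep_root: "dep r = 0"
begin

definition T :: "('a, 'a set) mgraph" where
  "T = \<lparr>verts = N, edges = (\<lambda>t. {par t, t}) ` (N - {r}), endpoints = id\<rparr>"

definition ch :: "('a \<times> 'a) set" where
  "ch = {(par t, t) | t. t \<in> N \<and> t \<noteq> r}"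

definition sub :: "'a \<Rightarrow> 'a set" where
  "sub t = {s. (t, s) \<in> ch\<^sup>*}"

lemma T_simps [simp]: "verts T = N" "edges T = (\<lambda>t. {par t, t}) ` (N - {r})" "endpoints T = id"
  by (simp_all add: T_def)

lemma multigraph_T: "multigraph T"
  unfolding multigraph_def using par_in_N by fastforce

sublocale TG: multi_graph T
  by unfold_locales (rule multigraph_T)

lemma chD: "(p, s) \<in> ch \<Longrightarrow> p = par s \<and> s \<in> N \<and> s \<noteq> r \<and> p \<in> N \<and> dep s = Suc (dep p)"
  unfolding ch_def using par_in_N dep_par by blast

lemma chI: "s \<in> N \<Longrightarrow> s \<noteq> r \<Longrightarrow> (par s, s) \<in> ch"
  by (auto simp: ch_def)

lemma par_neq: "s \<in> N \<Longrightarrow> s \<noteq> r \<Longrightarrow> par s \<noteq> s"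
  using dep_par by (metis n_not_Suc_n)

lemma sub_self [simp]: "t \<in> sub t"
  by (simp add: sub_def)

lemma sub_N: "s \<in> sub t \<Longrightarrow> t \<in> N \<Longrightarrow> s \<in> N"
  unfolding sub_def mem_Collect_eq by (induction rule: rtrancl_induct) (auto dest: chD)

lemma sub_trans: "s \<in> sub t \<Longrightarrow> u \<in> sub s \<Longrightarrow> u \<in> sub t"
  unfolding sub_def by auto

lemma sub_ch: "s \<in> sub t \<Longrightarrow> (s, u) \<in> ch \<Longrightarrow> u \<in> sub t"
  unfolding sub_def by auto

lemma sub_dep: "s \<in> sub t \<Longrightarrow> s = t \<or> dep t < dep s"
  unfolding sub_def mem_Collect_eq by (induction rule: rtrancl_induct) (auto dest: chD)

lemma sub_par: assumes "s \<in> sub t" "s \<noteq> t" shows "s \<in> N" "s \<noteq> r" "par s \<in> sub t"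
proof -
  from assms obtain p where p: "(t, p) \<in> ch\<^sup>*" "(p, s) \<in> ch" unfolding sub_def by (auto elim: rtranclE)
  then show "s \<in> N" "s \<noteq> r" "par s \<in> sub t" using chD[OF p(2)] by (auto simp: sub_def)
qed

lemma sub_root: "s \<in> N \<Longrightarrow> s \<in> sub r"
proof (induction "dep s" arbitrary: s rule: less_induct)
  case less
  show ?case
  proof (cases "s = r")
    case False
    then have "par s \<in> sub r" using less(1)[of "par s"] dep_par[OF less(2) False] par_in_N[OF less(2) False] by simp
    then show ?thesis using sub_ch chI[OF less(2) False] by blast
  qed simp
qed

lemma sub_root_eq: "sub r = N"
  using sub_root sub_N root_in_N by blast

lemma root_notin_sub: "t \<in> N \<Longrightarrow> t \<noteq> r \<Longrightarrow> r \<notin> sub t"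
  using sub_par(2) by blast

lemma adj_T: "(u, v) \<in> adj T \<longleftrightarrow> (u, v) \<in> ch \<or> (v, u) \<in> ch"
  unfolding adj_def ch_def by (auto simp: doubleton_eq_iff)

lemma edge_eq: "s \<in> N - {r} \<Longrightarrow> t \<in> N - {r} \<Longrightarrow> {par s, s} = {par t, t} \<Longrightarrow> s = t"
  using dep_par[of s] dep_par[of t] by (auto simp: doubleton_eq_iff)

section \<open>Deleting an edge of the tree\<close>

definition De :: "'a \<Rightarrow> ('a, 'a set) mgraph" where
  "De t = del_edges T {{par t, t}}"

lemma De_simps [simp]: "verts (De t) = N" "endpoints (De t) = id" "edges (De t) = edges T - {{par t, t}}"
  by (simp_all add: De_def del_edges_def)

lemma multigraph_De: "multigraph (De t)"
  unfolding multigraph_def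
proof
  fix e assume "e \<in> edges (De t)"
  then have "e \<in> edges T" by simp
  then show "\<exists>u\<in>verts (De t). \<exists>v\<in>verts (De t). endpoints (De t) e = {u, v}"
    using multigraph_T unfolding multigraph_def De_simps(1,2) T_simps(1,3) by blast
qed

lemma adj_De: assumes "t \<in> N - {r}"
  shows "(u, v) \<in> adj (De t) \<longleftrightarrow> ((u, v) \<in> ch \<and> v \<noteq> t) \<or> ((v, u) \<in> ch \<and> u \<noteq> t)"
proof -
  have "(u, v) \<in> adj (De t) \<longleftrightarrow> (\<exists>s\<in>N - {r}. {par s, s} = {u, v} \<and> s \<noteq> t)"
  proof -
    have "(u, v) \<in> adj (De t) \<longleftrightarrow> (\<exists>s\<in>N - {r}. {par s, s} = {u, v} \<and> {par s, s} \<noteq> {par t, t})"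
      unfolding adj_def De_simps T_simps id_def mem_Collect_eq prod.case by blast
    moreover have "{par s, s} \<noteq> {par t, t} \<longleftrightarrow> s \<noteq> t" if "s \<in> N - {r}" for s using edge_eq[OF that assms] by blast
    ultimately show ?thesis by (metis (no_types, lifting))
  qed
  also have "\<dots> \<longleftrightarrow> ((u, v) \<in> ch \<and> v \<noteq> t) \<or> ((v, u) \<in> ch \<and> u \<noteq> t)"
    unfolding ch_def by (auto simp: doubleton_eq_iff)
  finally show ?thesis .
qed

text \<open>Stated for any graph \<open>H\<close> that keeps the edges of the subtree, so as to
  serve for \<open>T\<close>, for \<open>T\<close> minus an edge and for \<open>T\<close> minus a
  finite set of vertices.\<close>

lemma conn_sub_gen:
  assumes "t \<in> N" "\<And>p s. (p, s) \<in> ch \<Longrightarrow> s \<in> sub t \<Longrightarrow> s \<noteq> t \<Longrightarrow> (p, s) \<in> adj H"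
  shows "conn H (sub t)"
proof -
  let ?r = "adj H \<inter> sub t \<times> sub t"
  have *: "(t, s) \<in> ?r\<^sup>*" if "s \<in> sub t" for s
    using that
  proof (induction "dep s" arbitrary: s rule: less_induct)
    case less
    show ?case
    proof (cases "s = t")
      case False
      note sp = sub_par[OF less(2) False]
      have "(t, par s) \<in> ?r\<^sup>*" using less(1)[OF _ sp(3)] dep_par[OF sp(1,2)] by simp
      moreover have "(par s, s) \<in> ?r" using assms(2)[OF chI[OF sp(1,2)] less(2) False] less(2) sp(3) by blast
      ultimately show ?thesis by (rule rtrancl_into_rtrancl)
    qed simp
  qed
  have "(u, v) \<in> ?r\<^sup>*" if "u \<in> sub t" "v \<in> sub t" for u v
    using rtrancl_trans[OF adj_reach_sym[OF *[OF that(1)]] *[OF that(2)]] .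
  moreover have "sub t \<noteq> {}" using sub_self by blast
  ultimately show ?thesis unfolding conn_def by blast
qed

lemma conn_sub: "t \<in> N \<Longrightarrow> conn T (sub t)"
  by (rule conn_sub_gen) (simp_all add: adj_T)

lemma conn_De_sub: "t \<in> N - {r} \<Longrightarrow> conn (De t) (sub t)"
  by (rule conn_sub_gen) (auto simp: adj_De)

lemma conn_De_compl: assumes t: "t \<in> N - {r}" shows "conn (De t) (N - sub t)"
proof -
  let ?S = "N - sub t"
  let ?r = "adj (De t) \<inter> ?S \<times> ?S"
  have rS: "r \<in> ?S" using root_in_N root_notin_sub t by blast
  have *: "(r, s) \<in> ?r\<^sup>*" if "s \<in> ?S" for s
    using that
  proof (induction "dep s" arbitrary: s rule: less_induct)
    case less
    show ?case
    proof (cases "s = r")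
      case False
      then have sN: "s \<in> N" "s \<noteq> r" using less(2) by auto
      have p: "par s \<in> ?S" using par_in_N[OF sN] sub_ch[OF _ chI[OF sN]] less(2) by blast
      have "(r, par s) \<in> ?r\<^sup>*" using less(1)[OF _ p] dep_par[OF sN] by simp
      moreover have "s \<noteq> t" using less(2) by auto
      then have "(par s, s) \<in> ?r" using adj_De[OF t] chI[OF sN] less(2) p by blast
      ultimately show ?thesis by (rule rtrancl_into_rtrancl)
    qed simp
  qed
  have "(u, v) \<in> ?r\<^sup>*" if "u \<in> ?S" "v \<in> ?S" for u v
    using rtrancl_trans[OF adj_reach_sym[OF *[OF that(1)]] *[OF that(2)]] .
  then show ?thesis unfolding conn_def using rS by blast
qed

lemma De_closed:
  assumes t: "t \<in> N - {r}" and "(u, v) \<in> adj (De t)" shows "u \<in> sub t \<longleftrightarrow> v \<in> sub t"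
proof -
  have *: "p \<in> sub t \<longleftrightarrow> s \<in> sub t" if "(p, s) \<in> ch" "s \<noteq> t" for p s
    using that sub_ch sub_par(3) chD by metis
  show ?thesis using assms(2) unfolding adj_De[OF t] using * by blast
qed

lemma comp_De:
  assumes t: "t \<in> N - {r}" and v: "v \<in> N"
  shows "comp_in (De t) N v = (if v \<in> sub t then sub t else N - sub t)"
proof -
  have st: "sub t \<subseteq> N" using sub_N t by blast
  have cl: "w \<in> sub t \<longleftrightarrow> v \<in> sub t" if "w \<in> comp_in (De t) N v" for w
  proof -
    have "(v, w) \<in> (adj (De t) \<inter> N \<times> N)\<^sup>*" using that by (simp add: comp_in_def)
    then show ?thesis
    proof (induction rule: rtrancl_induct)
      case (step y z)
      then have "(y, z) \<in> adj (De t)" by blast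
      then show ?case using De_closed[OF t] step.IH by blast
    qed simp
  qed
  have cN: "comp_in (De t) N v \<subseteq> N" by (rule comp_in_subset[OF v])
  show ?thesis
  proof (cases "v \<in> sub t")
    case True
    then have "sub t \<subseteq> comp_in (De t) N v" by (rule conn_subset_comp_in[OF conn_De_sub[OF t] st])
    moreover have "comp_in (De t) N v \<subseteq> sub t" using cl True by blast
    ultimately show ?thesis using True by simp
  next
    case False
    then have "N - sub t \<subseteq> comp_in (De t) N v" using conn_subset_comp_in[OF conn_De_compl[OF t], of N v] v by blast
    moreover have "comp_in (De t) N v \<subseteq> N - sub t" using cl False cN by blast
    ultimately show ?thesis using False by simp
  qed
qed

text \<open>The deleted edge is the only one between \<open>sub t\<close> and its complement, and
  both sides are connected.\<close>

lemma component_De: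
  assumes t: "t \<in> N - {r}"
  shows "component K (del_edges T {{par t, t}}) \<longleftrightarrow> K = induced (De t) (sub t) \<or> K = induced (De t) (N - sub t)"
proof -
  have "component K (De t) \<longleftrightarrow> (\<exists>v\<in>N. K = induced (De t) (if v \<in> sub t then sub t else N - sub t))"
    unfolding component_iff[OF multigraph_De] using comp_De[OF t] by simp
  also have "\<dots> \<longleftrightarrow> K = induced (De t) (sub t) \<or> K = induced (De t) (N - sub t)"
  proof -
    have "t \<in> N" "t \<in> sub t" "r \<in> N" "r \<notin> sub t" using t root_in_N root_notin_sub by auto
    then have "\<exists>v\<in>N. v \<in> sub t" "\<exists>v\<in>N. v \<notin> sub t" by blast+
    then show ?thesis by (simp split: if_split) blast
  qed
  finally show ?thesis by (simp add: De_def)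
qed

text \<open>On a cycle, every edge at a vertex of maximal depth leads to its parent, so the two
  cycle edges there coincide. The cycle would be a loop, but no vertex is its own parent.\<close>

lemma tree_T: "tree T"
  unfolding tree_def
proof (intro conjI notI)
  show "multigraph T" by (rule multigraph_T)
  show "connected_graph T" unfolding connected_graph_iff[OF multigraph_T] using conn_sub[OF root_in_N] by (simp add: sub_root_eq)
  assume "\<exists>Z. subgraph Z T \<and> is_cycle Z"
  then obtain Z vs es where Z: "subgraph Z T" "vs \<noteq> []" "distinct vs" "distinct es" "length es = length vs"
    "verts Z = set vs" "edges Z = set es" "\<forall>i<length es. endpoints Z (es ! i) = {vs ! i, vs ! (Suc i mod length vs)}"
    unfolding is_cycle_def by blast
  let ?n = "length vs"
  have n0: "0 < ?n" using Z(2) by simp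
  have es: "es ! i = {vs ! i, vs ! (Suc i mod ?n)}" "\<exists>t\<in>N - {r}. es ! i = {par t, t}" if "i < ?n" for i
  proof -
    have "endpoints Z = id" using Z(1) by (simp add: subgraph_def)
    then show "es ! i = {vs ! i, vs ! (Suc i mod ?n)}" using Z(5,8) that by simp
    have "es ! i \<in> edges T" using Z(1,5,7) that nth_mem[of i es] unfolding subgraph_def by auto
    then show "\<exists>t\<in>N - {r}. es ! i = {par t, t}" by auto
  qed
  define m where "m = Max (dep ` set vs)"
  have "m \<in> dep ` set vs" unfolding m_def by (rule Max_in) (use Z(2) in auto)
  then obtain v where v: "v \<in> set vs" "dep v = m" by blast
  have mx: "dep w \<le> dep v" if "w \<in> set vs" for w unfolding v(2) m_def by (rule Max_ge) (use that in auto)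
  have par_edge: "es ! i = {par v, v}" if i: "i < ?n" "v \<in> es ! i" for i
  proof -
    obtain t where t: "t \<in> N - {r}" "es ! i = {par t, t}" using es(2)[OF i(1)] by blast
    have "es ! i \<subseteq> set vs" using es(1)[OF i(1)] i(1) n0 by auto
    then have "dep t \<le> dep v" using mx t(2) by blast
    then have "v = t" using i(2) t dep_par[of t] by auto
    then show ?thesis using t(2) by simp
  qed
  obtain i where i: "i < ?n" "v = vs ! i" using v(1) by (auto simp: in_set_conv_nth)
  define j where "j = (if i = 0 then ?n - 1 else i - 1)"
  have j: "j < ?n" "Suc j mod ?n = i" using i(1) n0 by (auto simp: j_def)
  have "v \<in> es ! i" "v \<in> es ! j" using es(1)[OF i(1)] es(1)[OF j(1)] i(2) j(2) by auto
  then have eq: "es ! i = {par v, v}" "es ! i = es ! j" using par_edge i(1) j(1) by auto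
  then have "i = j" using Z(4,5) i(1) j(1) nth_eq_iff_index_eq by metis
  then have "?n \<le> 1" using i(1) by (auto simp: j_def split: if_splits)
  then have "?n = 1" using n0 by linarith
  then have "es ! i = {v}" using es(1)[OF i(1)] i by simp
  moreover obtain t where "t \<in> N - {r}" "es ! i = {par t, t}" using es(2)[OF i(1)] by blast
  ultimately show False using par_neq[of t] by auto
qed

text \<open>The only edge between \<open>sub t\<close> and the rest joins \<open>par t\<close> and
  \<open>t\<close>. A path from the root that visits \<open>t\<close> and ends outside
  \<open>sub t\<close> would pass through \<open>par t\<close> both before and after
  \<open>t\<close>; one that ends inside must enter through \<open>t\<close>.\<close>

lemma tree_le_iff: assumes "t \<in> N" "s \<in> N" shows "tree_le T r t s \<longleftrightarrow> s \<in> sub t"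
proof
  assume "tree_le T r t s"
  then obtain P where P: "subgraph P T" "path_between P r s" "t \<in> verts P" unfolding tree_le_def by blast
  show "s \<in> sub t"
  proof (rule ccontr)
    assume s: "s \<notin> sub t"
    then have tr: "t \<in> N - {r}" using assms sub_root by blast
    obtain vs es where p: "vs \<noteq> []" "distinct vs" "length vs = Suc (length es)" "verts P = set vs" "edges P = set es"
      "hd vs = r" "last vs = s" "\<forall>i<length es. endpoints P (es ! i) = {vs ! i, vs ! Suc i}"
      using P(2) unfolding path_between_def by blast
    have step: "(vs ! i, vs ! Suc i) \<in> adj T" if "i < length es" for i
    proof -
      have "(vs ! i, vs ! Suc i) \<in> adj P" unfolding adj_def using p(5,8) that nth_mem[of i es] by blast
      then show ?thesis using subgraph_adj[OF P(1)] by blast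
    qed
    have cross: "vs ! Suc i = t \<and> vs ! i = par t" if "i < length es" "vs ! i \<notin> sub t" "vs ! Suc i \<in> sub t" for i
    proof -
      have "(vs ! i, vs ! Suc i) \<notin> adj (De t)" using De_closed[OF tr] that(2,3) by blast
      then show ?thesis using step[OF that(1)] that(2,3) chD unfolding adj_De[OF tr] adj_T by (metis sub_self)
    qed
    have cross': "vs ! i = t \<and> vs ! Suc i = par t" if "i < length es" "vs ! i \<in> sub t" "vs ! Suc i \<notin> sub t" for i
    proof -
      have "(vs ! i, vs ! Suc i) \<notin> adj (De t)" using De_closed[OF tr] that(2,3) by blast
      then show ?thesis using step[OF that(1)] that(2,3) chD unfolding adj_De[OF tr] adj_T by (metis sub_self)
    qed
    obtain k where k: "k < length vs" "vs ! k = t" using P(3) p(4) by (auto simp: in_set_conv_nth)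
    have "vs ! 0 = r" using p(1,6) by (simp add: hd_conv_nth)
    then have k0: "k \<noteq> 0" using k tr by (metis DiffD2 singletonI)
    have "vs ! (length vs - 1) = s" using p(1,7) by (simp add: last_conv_nth)
    have "\<exists>j. j < length es \<and> k \<le> j \<and> vs ! j \<in> sub t \<and> vs ! Suc j \<notin> sub t"
    proof (rule ccontr)
      assume c: "\<not> ?thesis"
      have "vs ! j \<in> sub t" if "k \<le> j" "j \<le> length es" for j
        using that by (induction j rule: dec_induct) (use k c in auto)
      then show False using s \<open>vs ! (length vs - 1) = s\<close> p(3) k(1) by fastforce
    qed
    then obtain j where j: "j < length es" "k \<le> j" "vs ! j = t" "vs ! Suc j = par t" using cross' by blast
    have "\<exists>i<k. vs ! i \<notin> sub t \<and> vs ! Suc i \<in> sub t"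
    proof (rule ccontr)
      assume c: "\<not> ?thesis"
      have "vs ! i \<notin> sub t" if "i \<le> k" for i
        using that
      proof (induction i)
        case 0
        then show ?case using \<open>vs ! 0 = r\<close> root_notin_sub tr by simp
      next
        case (Suc i)
        then have "i < k" "vs ! i \<notin> sub t" by simp_all
        then show ?case using c by blast
      qed
      then have "vs ! k \<notin> sub t" by blast
      then show False using k(2) sub_self[of t] by metis
    qed
    then obtain i where i: "i < k" "vs ! i = par t" using cross k(1) p(3) by force
    then have "i = Suc j" using j p(2,3) k(1) nth_eq_iff_index_eq[OF p(2), of i "Suc j"] by simp
    then show False using i j by simp
  qed
next
  assume s: "s \<in> sub t"
  have "(r, s) \<in> (adj T)\<^sup>*"
    using conn_sub[OF root_in_N] sub_root[OF assms(2)] sub_self[of r] unfolding conn_def sub_root_eq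
    using rtrancl_mono[of "adj T \<inter> N \<times> N" "adj T"] root_in_N assms(2) by blast
  then obtain P where P: "subgraph P T" "path_between P r s" using reach_path[OF multigraph_T] root_in_N by force
  have "t \<in> verts P"
  proof (cases "t = r")
    case True
    then show ?thesis using path_reach(2)[OF P(2)] P(2) unfolding path_between_def by (metis hd_in_set)
  next
    case False
    then have tr: "t \<in> N - {r}" using assms by blast
    have sP: "s \<in> verts P" using P(2) unfolding path_between_def by (metis last_in_set)
    have mP: "multigraph P" using P(1) by (simp add: subgraph_def)
    have "r \<notin> sub t" using root_notin_sub tr by blast
    then obtain a b where ab: "(a, b) \<in> adj P" "a \<notin> sub t" "b \<in> sub t"
      using reach_crosses[OF path_reach(1)[OF P(2) sP], of "- sub t"] s by auto
    have "(a, b) \<notin> adj (De t)" using De_closed[OF tr] ab(2,3) by blast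
    moreover have "(a, b) \<in> adj T" using ab(1) subgraph_adj[OF P(1)] by blast
    ultimately have "b = t" \<comment> \<open>\<open>t\<close> is the only entrance to \<open>sub t\<close>\<close> using ab(2,3) unfolding adj_De[OF tr] adj_T by (metis sub_self)
    then show ?thesis using adj_verts[OF mP ab(1)] by blast
  qed
  then show "tree_le T r t s" unfolding tree_le_def using P by blast
qed

subsection \<open>Rays and ends of the tree\<close>

lemma ray_adj:
  assumes "R \<in> rays T" "ray_enum R x" shows "(x n, x (Suc n)) \<in> adj T" "inj x" "x n \<in> N"
proof -
  obtain e where e: "TG.enum R x e" using assms(2) TG.ray_enum_iff by blast
  show "(x n, x (Suc n)) \<in> adj T" unfolding adj_def using TG.ray_edges(1,2)[OF assms(1) e, of n] by blast
  show "inj x" using e by (simp add: TG.enum_def)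
  show "x n \<in> N" using TG.ray_edges(3)[OF assms(1) e, of n] by simp
qed

text \<open>A step towards the root directly after a step away from it would return to the previous
  vertex, as parents are unique.\<close>

lemma ray_turn:
  assumes R: "R \<in> rays T" "ray_enum R x" and up: "(x n, x (Suc n)) \<in> ch"
  shows "(x (Suc n), x (Suc (Suc n))) \<in> ch"
proof (rule ccontr)
  assume "\<not> ?thesis"
  then have "(x (Suc (Suc n)), x (Suc n)) \<in> ch" using ray_adj(1)[OF R, of "Suc n"] adj_T by blast
  then have "x (Suc (Suc n)) = x n" using chD up by metis
  then show False using ray_adj(2)[OF R] by (auto dest: injD)
qed

lemma ray_ascends_from:
  assumes R: "R \<in> rays T" "ray_enum R x" and up: "(x n, x (Suc n)) \<in> ch" and "n \<le> m"
  shows "(x m, x (Suc m)) \<in> ch"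
  using \<open>n \<le> m\<close> by (induction m rule: dec_induct) (use up ray_turn[OF R] in blast)+

lemma ray_ascends:
  assumes R: "R \<in> rays T" "ray_enum R x"
  shows "\<exists>n. \<forall>m\<ge>n. (x m, x (Suc m)) \<in> ch"
proof -
  have "\<exists>n. (x n, x (Suc n)) \<in> ch"
  proof (rule ccontr)
    assume "\<nexists>n. (x n, x (Suc n)) \<in> ch"
    then have "(x (Suc n), x n) \<in> ch" for n using ray_adj(1)[OF R] adj_T by blast
    then have d: "dep (x n) = Suc (dep (x (Suc n)))" for n using chD by blast
    have sum: "dep (x n) + n = dep (x 0)" for n
    proof (induction n)
      case (Suc n)
      then show ?case using d[of n] by simp
    qed simp
    show False using sum[of "Suc (dep (x 0))"] by simp
  qed
  then show ?thesis using ray_ascends_from[OF R] by blast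
qed

lemma ray_from_root_ascends:
  assumes R: "R \<in> rays T" "ray_enum R x" and "x 0 = r"
  shows "(x m, x (Suc m)) \<in> ch"
proof (rule ray_ascends_from[OF R, of 0])
  show "(x 0, x (Suc 0)) \<in> ch" using ray_adj(1)[OF R, of 0] adj_T chD assms(3) by blast
qed simp

lemma ascending_sub:
  assumes "\<And>m. n \<le> m \<Longrightarrow> (x m, x (Suc m)) \<in> ch" "n \<le> i" "i \<le> j"
  shows "x j \<in> sub (x i)" "dep (x j) = dep (x i) + (j - i)"
proof -
  have "x j \<in> sub (x i) \<and> dep (x j) = dep (x i) + (j - i)"
    using \<open>i \<le> j\<close>
  proof (induction j rule: dec_induct)
    case (step k)
    then have "(x k, x (Suc k)) \<in> ch" using assms(1,2) by simp
    then show ?case using step sub_ch chD by fastforce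
  qed simp
  then show "x j \<in> sub (x i)" "dep (x j) = dep (x i) + (j - i)" by blast+
qed

lemma evin_sub_iff:
  assumes R: "R \<in> rays T" "ray_enum R x" and asc: "\<And>m. n \<le> m \<Longrightarrow> (x m, x (Suc m)) \<in> ch"
  shows "TG.evin R (sub t) \<longleftrightarrow> (\<exists>m\<ge>n. x m \<in> sub t)"
proof -
  obtain e where e: "TG.enum R x e" using R(2) TG.ray_enum_iff by blast
  show ?thesis unfolding TG.evin_iff[OF e]
  proof
    assume "\<exists>k. \<forall>m\<ge>k. x m \<in> sub t"
    then obtain k where "\<forall>m\<ge>k. x m \<in> sub t" ..
    then show "\<exists>m\<ge>n. x m \<in> sub t" by (intro exI[of _ "max k n"]) simp
  next
    assume "\<exists>m\<ge>n. x m \<in> sub t"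
    then obtain m where m: "m \<ge> n" "x m \<in> sub t" by blast
    have "x k \<in> sub t" if "k \<ge> m" for k using sub_trans[OF m(2) ascending_sub(1)[of n x, OF asc m(1) that]] .
    then show "\<exists>k. \<forall>m\<ge>k. x m \<in> sub t" by blast
  qed
qed

lemma multigraph_del_verts: "multigraph H \<Longrightarrow> multigraph (del_verts H X)"
  unfolding multigraph_def del_verts_def by (simp; fastforce)

lemma adj_del_verts: "(u, v) \<in> adj (del_verts T X) \<longleftrightarrow> (u, v) \<in> adj T \<and> u \<notin> X \<and> v \<notin> X"
  unfolding adj_def del_verts_def by auto

text \<open>Deleting \<open>t\<close> alone leaves no edge between the rest of \<open>sub t\<close>
  and its complement, so equivalent rays are on the same side. Conversely, given a finite set
  \<open>X\<close>, the subtree at a vertex of the ray deeper than all of \<open>X\<close> is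
  connected and avoids \<open>X\<close>.\<close>

lemma vertex_equiv_iff:
  assumes R: "R \<in> rays T" and S: "S \<in> rays T"
  shows "(R, S) \<in> vertex_equiv T \<longleftrightarrow> (\<forall>t\<in>N. TG.evin R (sub t) \<longleftrightarrow> TG.evin S (sub t))"
proof
  have key: "TG.evin S (sub t)" if RS: "(R, S) \<in> vertex_equiv T" and t: "t \<in> N" and Rt: "TG.evin R (sub t)"
    and R: "R \<in> rays T" and S: "S \<in> rays T" for R S t
  proof (rule ccontr)
    assume nS: "\<not> TG.evin S (sub t)"
    obtain R' S' K where K: "tail_of R' R" "tail_of S' S" "component K (del_verts T {t})" "subgraph R' K" "subgraph S' K"
      using RS t unfolding vertex_equiv_def by (auto dest!: spec[of _ "{t}"])
    obtain x e where x: "TG.enum R x e" using TG.rays_obtain[OF R] .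
    have "TG.evin R (verts R')" using K(1) by (auto simp: TG.evin_def)
    then have "verts R' \<inter> sub t \<noteq> {}" using TG.evin_not_disjoint(2)[OF R _ Rt] by blast
    then obtain a where a: "a \<in> verts R'" "a \<in> sub t" by blast
    have "\<not> verts S' \<subseteq> sub t" using nS K(2) by (auto simp: TG.evin_def)
    then obtain b where b: "b \<in> verts S'" "b \<notin> sub t" by blast
    have ab: "a \<in> verts K" "b \<in> verts K" using a b K(4,5) by (auto simp: subgraph_def)
    have sK: "subgraph K (del_verts T {t})" "connected_graph K" using K(3) by (auto simp: component_def)
    have "conn (del_verts T {t}) (verts K)" by (rule conn_subgraph[OF sK])
    then have "\<exists>c d. (c, d) \<in> adj (del_verts T {t}) \<and> c \<in> verts K \<and> d \<in> verts K \<and> c \<in> sub t \<and> d \<notin> sub t"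
      using conn_crosses[of "del_verts T {t}" "verts K" "sub t"] ab a(2) b(2) by blast
    then obtain c d where cd: "(c, d) \<in> adj T" "c \<noteq> t" "c \<in> sub t" "d \<notin> sub t" unfolding adj_del_verts by blast
    then show False using sub_ch sub_par(3)[OF cd(3,2)] chD adj_T by metis
  qed
  assume RS: "(R, S) \<in> vertex_equiv T"
  have SR: "(S, R) \<in> vertex_equiv T" using RS unfolding vertex_equiv_def by blast
  show "\<forall>t\<in>N. TG.evin R (sub t) \<longleftrightarrow> TG.evin S (sub t)" using key[OF RS _ _ R S] key[OF SR _ _ S R] by blast
next
  assume eq: "\<forall>t\<in>N. TG.evin R (sub t) \<longleftrightarrow> TG.evin S (sub t)"
  obtain x where x: "ray_enum R x" using R unfolding rays_def by blast
  obtain n where n: "\<And>m. n \<le> m \<Longrightarrow> (x m, x (Suc m)) \<in> ch" using ray_ascends[OF R x] by blast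
  have "\<exists>R' S' K. tail_of R' R \<and> tail_of S' S \<and> component K (del_verts T X) \<and> subgraph R' K \<and> subgraph S' K"
    if X: "finite X" "X \<subseteq> N" for X
  proof -
    \<comment> \<open>On the ascending part, and high enough for the depth to exceed that of every
      vertex of \<open>X\<close>; the inserted 0 covers \<open>X = {}\<close>.\<close>
    define m where "m = n + Suc (Max (insert 0 (dep ` X)))"
    have nm: "n \<le> m" by (simp add: m_def)
    let ?t = "x m"
    have tN: "?t \<in> N" by (rule ray_adj(3)[OF R x])
    have "dep ?t > Max (insert 0 (dep ` X))" using ascending_sub(2)[of n x, OF n order_refl nm] by (simp add: m_def)
    then have dX: "dep y < dep ?t" if "y \<in> X" for y
      using Max_ge[of "insert 0 (dep ` X)" "dep y"] X(1) that by fastforce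
    have disj: "sub ?t \<inter> X = {}"
    proof (rule ccontr)
      assume "sub ?t \<inter> X \<noteq> {}"
      then obtain y where "y \<in> sub ?t" "y \<in> X" by blast
      then show False using sub_dep[of y ?t] dX[of y] by auto
    qed
    have "TG.evin R (sub ?t)" using evin_sub_iff[OF R x, of n ?t] n nm sub_self by blast
    moreover from this have "TG.evin S (sub ?t)" using eq tN by blast
    ultimately obtain R' S' where t: "tail_of R' R" "verts R' \<subseteq> sub ?t" "tail_of S' S" "verts S' \<subseteq> sub ?t"
      unfolding TG.evin_def by blast
    let ?H = "del_verts T X"
    have mH: "multigraph ?H" by (rule multigraph_del_verts[OF multigraph_T])
    have vH: "verts ?H = N - X" by (simp add: del_verts_def)
    let ?C = "comp_in ?H (verts ?H) ?t"
    have tH: "?t \<in> verts ?H" using disj tN vH sub_self by blast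
    have comp: "component (induced ?H ?C) ?H" unfolding component_iff[OF mH] using tH by blast
    have "sub ?t \<subseteq> verts ?H" using disj sub_N[OF _ tN] vH by blast
    moreover have "conn ?H (sub ?t)"
    proof (rule conn_sub_gen[OF tN])
      fix p s assume ps: "(p, s) \<in> ch" "s \<in> sub ?t" "s \<noteq> ?t"
      then have "p \<in> sub ?t" using sub_par(3)[OF ps(2,3)] chD by blast
      then show "(p, s) \<in> adj ?H" using ps disj unfolding adj_del_verts adj_T by blast
    qed
    ultimately have sC: "sub ?t \<subseteq> ?C" using conn_subset_comp_in by (metis sub_self)
    have inK: "subgraph Q (induced ?H ?C)" if Q: "tail_of Q Q0" "Q0 \<in> rays T" "verts Q \<subseteq> sub ?t" for Q Q0
    proof (rule subgraph_of_induced[OF mH])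
      have "subgraph Q T" using Q(1,2) subgraph_trans unfolding tail_of_def rays_def by blast
      moreover have "endpoints Q f \<inter> X = {}" if "f \<in> edges Q" for f
        using endpoints_in[of Q f] that Q(3) disj \<open>subgraph Q T\<close> unfolding subgraph_def by blast
      moreover have "verts Q \<subseteq> N - X" using \<open>sub ?t \<subseteq> verts ?H\<close> Q(3) vH by blast
      ultimately show "subgraph Q ?H" unfolding subgraph_def del_verts_def by auto
      show "verts Q \<subseteq> ?C" using Q(3) sC by blast
    qed
    show ?thesis using inK[OF t(1) R t(2)] inK[OF t(3) S t(4)] t comp by blast
  qed
  then show "(R, S) \<in> vertex_equiv T" unfolding vertex_equiv_def using R S by simp
qed

lemma equiv_vertex_equiv: "equiv (rays T) (vertex_equiv T)"
proof (rule equivI)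
  have sub: "vertex_equiv T \<subseteq> rays T \<times> rays T" by (auto simp: vertex_equiv_def)
  then show "vertex_equiv T \<subseteq> rays T \<times> rays T" .
  show "refl_on (rays T) (vertex_equiv T)" using vertex_equiv_iff by (auto intro!: refl_onI)
  show "sym (vertex_equiv T)" using vertex_equiv_iff sub by (intro symI) blast
  show "trans (vertex_equiv T)" using vertex_equiv_iff sub
    by (intro transI) (metis (no_types, lifting) mem_Sigma_iff subsetD)
qed

lemma tree_end_obtain:
  assumes "\<eta> \<in> graph_ends T"
  obtains R where "R \<in> rays T" "R \<in> \<eta>" "\<And>t. t \<in> N \<Longrightarrow> lives_in \<eta> (sub t) \<longleftrightarrow> TG.evin R (sub t)"
proof -
  obtain R where R: "R \<in> \<eta>" using assms in_quotient_imp_non_empty[OF equiv_vertex_equiv] unfolding graph_ends_def by blast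
  have rays: "S \<in> rays T" if "S \<in> \<eta>" for S
    using assms that in_quotient_imp_subset[OF equiv_vertex_equiv] unfolding graph_ends_def by blast
  have "TG.evin S (sub t) \<longleftrightarrow> TG.evin R (sub t)" if "S \<in> \<eta>" "t \<in> N" for S t
  proof -
    have "(S, R) \<in> vertex_equiv T"
      using assms that(1) R quotient_eq_iff[OF equiv_vertex_equiv] unfolding graph_ends_def by blast
    then show ?thesis using vertex_equiv_iff[OF rays[OF that(1)] rays[OF R]] that(2) by blast
  qed
  then have "lives_in \<eta> (sub t) \<longleftrightarrow> TG.evin R (sub t)" if "t \<in> N" for t
    using that R unfolding lives_in_def TG.evin_def[symmetric] by blast
  then show thesis using that rays[OF R] R by blast
qed

lemma tree_end_ray:
  assumes "\<eta> \<in> graph_ends T" "S \<in> \<eta>" "t \<in> N"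
  shows "S \<in> rays T" "lives_in \<eta> (sub t) \<longleftrightarrow> TG.evin S (sub t)"
proof -
  obtain R where R: "R \<in> rays T" "R \<in> \<eta>" "\<And>t. t \<in> N \<Longrightarrow> lives_in \<eta> (sub t) \<longleftrightarrow> TG.evin R (sub t)"
    using tree_end_obtain[OF assms(1)] by metis
  show S: "S \<in> rays T"
    using assms in_quotient_imp_subset[OF equiv_vertex_equiv] unfolding graph_ends_def by blast
  have "(S, R) \<in> vertex_equiv T"
    using assms R(2) quotient_eq_iff[OF equiv_vertex_equiv] unfolding graph_ends_def by blast
  then show "lives_in \<eta> (sub t) \<longleftrightarrow> TG.evin S (sub t)" using vertex_equiv_iff[OF S R(1)] R(3) assms(3) by blast
qed

text \<open>Every ray of \<open>T\<close> is in \<open>sub r\<close>, so only the subtrees above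
  edges of \<open>T\<close> matter, and these are what \<open>points_to_end\<close> speaks
  about.\<close>

lemma tree_end_eqI:
  assumes "\<eta> \<in> graph_ends T" "\<theta> \<in> graph_ends T"
    "\<And>t. t \<in> N \<Longrightarrow> t \<noteq> r \<Longrightarrow> lives_in \<eta> (sub t) \<longleftrightarrow> lives_in \<theta> (sub t)"
  shows "\<eta> = \<theta>"
proof -
  obtain R where R: "R \<in> rays T" "R \<in> \<eta>" "\<And>t. t \<in> N \<Longrightarrow> lives_in \<eta> (sub t) \<longleftrightarrow> TG.evin R (sub t)"
    using tree_end_obtain[OF assms(1)] by metis
  obtain S where S: "S \<in> rays T" "S \<in> \<theta>" "\<And>t. t \<in> N \<Longrightarrow> lives_in \<theta> (sub t) \<longleftrightarrow> TG.evin S (sub t)"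
    using tree_end_obtain[OF assms(2)] by metis
  have all: "TG.evin Q (sub r)" if Q: "Q \<in> rays T" for Q
  proof -
    obtain x where x: "ray_enum Q x" using Q unfolding rays_def by blast
    obtain n where n: "\<And>m. n \<le> m \<Longrightarrow> (x m, x (Suc m)) \<in> ch" using ray_ascends[OF Q x] by blast
    have "x n \<in> sub r" using ray_adj(3)[OF Q x] by (simp add: sub_root_eq)
    then show ?thesis using evin_sub_iff[OF Q x, of n r] n by blast
  qed
  have "TG.evin R (sub t) \<longleftrightarrow> TG.evin S (sub t)" if "t \<in> N" for t
    using assms(3)[OF that] R(3)[OF that] S(3)[OF that] all[OF R(1)] all[OF S(1)] by (cases "t = r") auto
  then have "(R, S) \<in> vertex_equiv T" using vertex_equiv_iff[OF R(1) S(1)] by blast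
  then show ?thesis using quotient_eqI[OF equiv_vertex_equiv] assms(1,2) R(2) S(2) unfolding graph_ends_def by blast
qed

lemma tree_end_exists:
  assumes "\<And>n. (x n, x (Suc n)) \<in> ch"
  shows "\<exists>\<eta>\<in>graph_ends T. \<forall>t\<in>N. lives_in \<eta> (sub t) \<longleftrightarrow> (\<exists>n. x n \<in> sub t)"
proof -
  have dep: "dep (x n) = dep (x 0) + n" for n using ascending_sub(2)[of 0 x 0 n] assms by simp
  have inj: "inj x" by (rule injI) (metis dep add_left_cancel)
  define e where "e = (\<lambda>n. {x n, x (Suc n)})"
  define R where "R = \<lparr>verts = range x, edges = range e, endpoints = (id :: 'a set \<Rightarrow> 'a set)\<rparr>"
  have enum: "TG.enum R x e" unfolding TG.enum_def R_def e_def using inj by simp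
  have "multigraph R" unfolding multigraph_def R_def e_def by auto
  moreover have "x n \<in> N" for n using chD[OF assms] by blast
  moreover have "e n \<in> edges T" for n using chD[OF assms[of n]] by (auto simp: e_def)
  ultimately have "subgraph R T" unfolding subgraph_def R_def by auto
  then have R: "R \<in> rays T" "ray_enum R x" unfolding rays_def using enum TG.ray_enum_iff by blast+
  define \<eta> where "\<eta> = vertex_equiv T `` {R}"
  have \<eta>: "\<eta> \<in> graph_ends T" "R \<in> \<eta>" unfolding \<eta>_def graph_ends_def
    using R(1) equiv_class_self[OF equiv_vertex_equiv R(1)] by (auto intro: quotientI)
  have "lives_in \<eta> (sub t) \<longleftrightarrow> (\<exists>n. x n \<in> sub t)" if "t \<in> N" for t
    using tree_end_ray(2)[OF \<eta> that] evin_sub_iff[OF R, of 0 t] assms by simp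
  then show ?thesis using \<eta>(1) by blast
qed

end

section \<open>The tree of a laminar family\<close>

locale laminar_cuts = multi_graph G for G :: "('v, 'e) mgraph" +
  fixes LL :: "'v set set"
  assumes lam: "laminar LL" and pf: "point_finite LL" and LL_cut: "L \<in> LL \<Longrightarrow> cut L"
    and LL_conn: "L \<in> LL \<Longrightarrow> conn G L"
begin

definition upset :: "'v set \<Rightarrow> 'v set set" where "upset L = {M \<in> LL. L \<subset> M}"

text \<open>The proper supersets of a nonempty member share a vertex, so they are finitely many and
  form a chain; if there are any, the smallest one exists.\<close>

definition up :: "'v set \<Rightarrow> 'v set" where
  "up L = (SOME M. M \<in> upset L \<and> (\<forall>M'\<in>upset L. M \<subseteq> M'))"

text \<open>The empty list is an additional root, present even if some member of \<open>LL\<close>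
  is all of \<open>verts G\<close>.\<close>

definition nodes :: "'v set list set" where "nodes = insert [] ((\<lambda>L. [L]) ` LL)"

definition parent :: "'v set list \<Rightarrow> 'v set list" where
  "parent t = (case t of [] \<Rightarrow> [] | L # _ \<Rightarrow> if upset L = {} then [] else [up L])"

definition depth :: "'v set list \<Rightarrow> nat" where
  "depth t = (case t of [] \<Rightarrow> 0 | L # _ \<Rightarrow> Suc (card (upset L)))"

text \<open>A vertex is assigned to the smallest member containing it, or to the root if there is
  none.\<close>

definition part :: "'v set list \<Rightarrow> 'v set" where
  "part t = (case t of [] \<Rightarrow> verts G - \<Union>LL | L # _ \<Rightarrow> L - \<Union>{M \<in> LL. M \<subset> L})"

lemma LL_nonempty: "L \<in> LL \<Longrightarrow> L \<noteq> {}"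
  using LL_conn conn_nonempty by blast

lemma nested: "L \<in> LL \<Longrightarrow> M \<in> LL \<Longrightarrow> L \<inter> M \<noteq> {} \<Longrightarrow> L \<subseteq> M \<or> M \<subseteq> L"
  using laminarD[OF lam] by blast

lemma finite_containing: "finite {L \<in> LL. v \<in> L}"
  using pf by (simp add: point_finite_def)

lemma finite_meeting: "finite Y \<Longrightarrow> finite {L \<in> LL. L \<inter> Y \<noteq> {}}"
proof -
  assume "finite Y"
  then have "finite (\<Union>y\<in>Y. {L \<in> LL. y \<in> L})" using finite_containing by blast
  moreover have "{L \<in> LL. L \<inter> Y \<noteq> {}} \<subseteq> (\<Union>y\<in>Y. {L \<in> LL. y \<in> L})" by blast
  ultimately show ?thesis by (rule finite_subset[rotated])
qed

lemma finite_upset: assumes "L \<in> LL" shows "finite (upset L)"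
proof -
  obtain v where "v \<in> L" using LL_nonempty[OF assms] by blast
  then have "upset L \<subseteq> {M \<in> LL. v \<in> M}" unfolding upset_def by blast
  then show ?thesis using finite_containing finite_subset by blast
qed

lemma up_props:
  assumes L: "L \<in> LL" "upset L \<noteq> {}"
  shows "up L \<in> upset L" "\<And>M. M \<in> upset L \<Longrightarrow> up L \<subseteq> M"
proof -
  obtain M where M: "M \<in> upset L" "\<And>M'. M' \<in> upset L \<Longrightarrow> M' \<subseteq> M \<Longrightarrow> M' = M"
    using finite_has_minimal[OF finite_upset[OF L(1)] L(2)] by metis
  have "M \<subseteq> M'" if M': "M' \<in> upset L" for M'
  proof -
    have "M \<inter> M' \<noteq> {}" using M(1) M' LL_nonempty[OF L(1)] unfolding upset_def by blast
    then have "M \<subseteq> M' \<or> M' \<subseteq> M" using nested M(1) M' unfolding upset_def by blast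
    then show ?thesis using M(2)[OF M'] by blast
  qed
  then have "\<exists>M. M \<in> upset L \<and> (\<forall>M'\<in>upset L. M \<subseteq> M')" using M(1) by blast
  then have "up L \<in> upset L \<and> (\<forall>M'\<in>upset L. up L \<subseteq> M')" unfolding up_def by (rule someI_ex)
  then show "up L \<in> upset L" "\<And>M. M \<in> upset L \<Longrightarrow> up L \<subseteq> M" by blast+
qed

lemma up_LL: "L \<in> LL \<Longrightarrow> upset L \<noteq> {} \<Longrightarrow> up L \<in> LL \<and> L \<subset> up L"
  using up_props(1) unfolding upset_def by blast

lemma card_upset: assumes L: "L \<in> LL" "upset L \<noteq> {}" shows "card (upset L) = Suc (card (upset (up L)))"
proof -
  note u = up_LL[OF L]
  have "upset L = insert (up L) (upset (up L))"
  proof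
    show "upset L \<subseteq> insert (up L) (upset (up L))" using up_props(2)[OF L] unfolding upset_def by blast
    show "insert (up L) (upset (up L)) \<subseteq> upset L" using u unfolding upset_def by blast
  qed
  moreover have "up L \<notin> upset (up L)" by (simp add: upset_def)
  ultimately show ?thesis using finite_upset u by simp
qed

lemma parent_simps [simp]: "parent [] = []" "parent [L] = (if upset L = {} then [] else [up L])"
  and depth_simps [simp]: "depth [] = 0" "depth [L] = Suc (card (upset L))"
  and part_simps: "part [] = verts G - \<Union>LL" "part [L] = L - \<Union>{M \<in> LL. M \<subset> L}"
  by (simp_all add: parent_def depth_def part_def)

lemma nodes_cases:
  assumes "t \<in> nodes" obtains "t = []" | L where "L \<in> LL" "t = [L]"
  using assms unfolding nodes_def by blast

lemma node_in [simp]: "[L] \<in> nodes \<longleftrightarrow> L \<in> LL" "[] \<in> nodes"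
  by (auto simp: nodes_def)

sublocale PT: parent_tree nodes "[]" parent depth
proof
  show "[] \<in> nodes" by simp
  show "depth [] = 0" by simp
  fix t assume t: "t \<in> nodes" "t \<noteq> []"
  then obtain L where L: "L \<in> LL" "t = [L]" using nodes_cases by metis
  show "parent t \<in> nodes" using L up_LL[OF L(1)] by simp
  show "depth t = Suc (depth (parent t))" using L card_upset[OF L(1)] by simp
qed

lemma sub_node: assumes L: "L \<in> LL" shows "PT.sub [L] = (\<lambda>M. [M]) ` {M \<in> LL. M \<subseteq> L}"
proof
  show "PT.sub [L] \<subseteq> (\<lambda>M. [M]) ` {M \<in> LL. M \<subseteq> L}"
  proof
    fix s assume "s \<in> PT.sub [L]"
    then have "([L], s) \<in> PT.ch\<^sup>*" by (simp add: PT.sub_def)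
    then show "s \<in> (\<lambda>M. [M]) ` {M \<in> LL. M \<subseteq> L}"
    proof (induction rule: rtrancl_induct)
      case base then show ?case using L by blast
    next
      case (step y z)
      obtain K where K: "y = [K]" "K \<subseteq> L" using step.IH by blast
      have z: "z \<in> nodes" "z \<noteq> []" "y = parent z" using PT.chD[OF step(2)] by blast+
      then obtain M where M: "M \<in> LL" "z = [M]" using nodes_cases by metis
      then have "upset M \<noteq> {}" "up M = K" using z(3) K(1) by (auto split: if_splits)
      then have "M \<subseteq> L" using up_LL[OF M(1)] K(2) by blast
      then show ?case using M by blast
    qed
  qed
  have "[M] \<in> PT.sub [L]" if "M \<in> LL" "M \<subseteq> L" for M
    using that
  proof (induction "card (upset M)" arbitrary: M rule: less_induct)
    case less
    show ?case
    proof (cases "M = L")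
      case False
      then have LM: "L \<in> upset M" using less L unfolding upset_def by blast
      then have ne: "upset M \<noteq> {}" by blast
      have "up M \<subseteq> L" using up_props(2)[OF less(2) ne LM] .
      then have "[up M] \<in> PT.sub [L]" using less(1)[of "up M"] card_upset[OF less(2) ne] up_LL[OF less(2) ne] by simp
      moreover have "(parent [M], [M]) \<in> PT.ch" by (rule PT.chI) (use less(2) in simp_all)
      ultimately show ?thesis using PT.sub_ch ne by simp
    qed simp
  qed
  then show "(\<lambda>M. [M]) ` {M \<in> LL. M \<subseteq> L} \<subseteq> PT.sub [L]" by blast
qed

lemma node_in_sub: "L \<in> LL \<Longrightarrow> t \<in> PT.sub [L] \<longleftrightarrow> (\<exists>M\<in>LL. M \<subseteq> L \<and> t = [M])"
  using sub_node by blast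

section \<open>The decomposition and its adhesion sets\<close>

lemma part_cases:
  assumes "v \<in> part t" "t \<in> nodes" shows "(t = [] \<and> v \<in> verts G \<and> v \<notin> \<Union>LL) \<or>
    (\<exists>L\<in>LL. t = [L] \<and> v \<in> L \<and> (\<forall>M\<in>LL. M \<subset> L \<longrightarrow> v \<notin> M))"
  using assms(2) by (cases rule: nodes_cases) (use assms(1) in \<open>auto simp: part_simps\<close>)

lemma part_disjoint:
  assumes st: "s \<in> nodes" "t \<in> nodes" "v \<in> part s" "v \<in> part t" shows "s = t"
proof -
  have "L = M" if "L \<in> LL" "M \<in> LL" "v \<in> L" "v \<in> M" "\<forall>K\<in>LL. K \<subset> L \<longrightarrow> v \<notin> K" "\<forall>K\<in>LL. K \<subset> M \<longrightarrow> v \<notin> K" for L M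
    using nested[OF that(1,2)] that by blast
  then show ?thesis using part_cases[OF st(3,1)] part_cases[OF st(4,2)] by blast
qed

lemma part_exists: assumes L: "L \<in> LL" "v \<in> L" shows "\<exists>M\<in>LL. M \<subseteq> L \<and> v \<in> part [M]"
proof -
  define A where "A = {M \<in> LL. v \<in> M}"
  have "finite A" "L \<in> A" using finite_containing L by (simp_all add: A_def)
  then obtain M where M: "M \<in> A" "M \<subseteq> L" "\<forall>K\<in>A. K \<subseteq> M \<longrightarrow> M = K"
    using finite_has_minimal2[of A L] by blast
  have "v \<notin> K" if "K \<in> LL" "K \<subset> M" for K using M(3) that by (auto simp: A_def)
  then have "v \<in> part [M]" using M(1) by (auto simp: part_simps A_def)
  then show ?thesis using M(1,2) by (auto simp: A_def)
qed

text \<open>The smallest member around a vertex of \<open>L\<close> is inside \<open>L\<close>, so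
  the parts above the node \<open>[L]\<close> recover the cut \<open>L\<close> itself.\<close>

lemma parts_sub: assumes L: "L \<in> LL" shows "(\<Union>s\<in>PT.sub [L]. part s) = L"
proof
  show "(\<Union>s\<in>PT.sub [L]. part s) \<subseteq> L"
  proof
    fix v assume "v \<in> (\<Union>s\<in>PT.sub [L]. part s)"
    then obtain s where s: "s \<in> PT.sub [L]" "v \<in> part s" by blast
    then obtain M where "M \<subseteq> L" "s = [M]" using node_in_sub[OF L] by blast
    then show "v \<in> L" using s(2) by (auto simp: part_simps)
  qed
  show "L \<subseteq> (\<Union>s\<in>PT.sub [L]. part s)"
  proof
    fix v assume "v \<in> L"
    then obtain M where M: "M \<in> LL" "M \<subseteq> L" "v \<in> part [M]" using part_exists[OF L] by blast
    then have "[M] \<in> PT.sub [L]" using node_in_sub[OF L] by blast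
    then show "v \<in> (\<Union>s\<in>PT.sub [L]. part s)" using M(3) by blast
  qed
qed

lemma parts_all: "(\<Union>s\<in>nodes. part s) = verts G"
proof
  show "(\<Union>s\<in>nodes. part s) \<subseteq> verts G" using part_cases LL_cut cut_subset by blast
  show "verts G \<subseteq> (\<Union>s\<in>nodes. part s)"
  proof
    fix v assume v: "v \<in> verts G"
    show "v \<in> (\<Union>s\<in>nodes. part s)"
    proof (cases "v \<in> \<Union>LL")
      case True
      then obtain L where L: "L \<in> LL" "v \<in> L" by blast
      then obtain M where "M \<in> LL" "v \<in> part [M]" using part_exists by blast
      then show ?thesis using node_in(1) by blast
    next
      case False
      then have "v \<in> part []" using v by (simp add: part_simps)
      then show ?thesis using node_in(2) by blast
    qed
  qed
qed

lemma parts_compl: assumes L: "L \<in> LL" shows "(\<Union>s\<in>nodes - PT.sub [L]. part s) = verts G - L"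
proof
  have sN: "PT.sub [L] \<subseteq> nodes" using PT.sub_N L node_in(1) by blast
  show "(\<Union>s\<in>nodes - PT.sub [L]. part s) \<subseteq> verts G - L"
  proof
    fix v assume "v \<in> (\<Union>s\<in>nodes - PT.sub [L]. part s)"
    then obtain s where s: "s \<in> nodes" "s \<notin> PT.sub [L]" "v \<in> part s" by blast
    have "v \<in> verts G" using parts_all s by blast
    moreover have "v \<notin> L"
    proof
      assume "v \<in> L"
      then obtain t where "t \<in> PT.sub [L]" "v \<in> part t" using parts_sub[OF L] by blast
      then show False using part_disjoint[OF s(1) _ s(3)] sN s(2) by blast
    qed
    ultimately show "v \<in> verts G - L" by blast
  qed
  show "verts G - L \<subseteq> (\<Union>s\<in>nodes - PT.sub [L]. part s)"
    using parts_all parts_sub[OF L] by blast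
qed

lemma part_above_node: "L \<in> LL \<Longrightarrow> part_above PT.T [] part [L] = L"
proof -
  assume L: "L \<in> LL"
  have "{s \<in> verts PT.T. tree_le PT.T [] [L] s} = PT.sub [L]"
    using PT.tree_le_iff[of "[L]"] PT.sub_N[of _ "[L]"] L by auto
  then show ?thesis using parts_sub[OF L] by (simp add: part_above_def)
qed

lemma decomposition: "rooted_tree_cut_decomposition G PT.T [] part"
  unfolding rooted_tree_cut_decomposition_def
  using PT.tree_T parts_all part_disjoint by auto

lemma edge_obtain_node:
  assumes "e \<in> edges PT.T" obtains L where "L \<in> LL" "e = {parent [L], [L]}" "[L] \<in> nodes - {[]}"
proof -
  obtain t where t: "t \<in> nodes - {[]}" "e = {parent t, t}" using assms by auto
  then obtain L where "L \<in> LL" "t = [L]" using nodes_cases by (metis DiffE singletonI)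
  then show thesis using that t by blast
qed

text \<open>The two components of \<open>T\<close> minus the edge below \<open>[L]\<close> carry
  \<open>L\<close> and its complement, so the adhesion set is contained in
  \<open>bd L\<close>.\<close>

lemma adhesion: "finite_adhesion G PT.T part"
  unfolding finite_adhesion_def
proof
  fix e assume "e \<in> edges PT.T"
  then obtain L where L: "L \<in> LL" "e = {parent [L], [L]}" "[L] \<in> nodes - {[]}" using edge_obtain_node by metis
  have "adhesion_set G PT.T part e \<subseteq> bd L"
  proof
    fix f assume "f \<in> adhesion_set G PT.T part e"
    then obtain T1 T2 u v where f: "f \<in> edges G" "component T1 (del_edges PT.T {e})" "component T2 (del_edges PT.T {e})"
      "T1 \<noteq> T2" "endpoints G f = {u, v}" "u \<in> (\<Union>t\<in>verts T1. part t)" "v \<in> (\<Union>t\<in>verts T2. part t)"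
      unfolding adhesion_set_def by blast
    have T1: "T1 = induced (PT.De [L]) (PT.sub [L]) \<or> T1 = induced (PT.De [L]) (nodes - PT.sub [L])"
      and T2: "T2 = induced (PT.De [L]) (PT.sub [L]) \<or> T2 = induced (PT.De [L]) (nodes - PT.sub [L])"
      using f(2,3) unfolding L(2) PT.component_De[OF L(3)] by blast+
    have "(u \<in> L) \<noteq> (v \<in> L)"
      using T1 T2 f(4,6,7) parts_sub[OF L(1)] parts_compl[OF L(1)] by (elim disjE) auto
    then show "f \<in> bd L" using bd_iff[OF f(1,5)] by blast
  qed
  then show "finite (adhesion_set G PT.T part e)" using cut_finite[OF LL_cut[OF L(1)]] finite_subset by blast
qed

subsection \<open>The map from edge-ends to nodes and ends of the tree\<close>

lemma lives_iff: "\<omega> \<in> edge_ends G \<Longrightarrow> L \<in> LL \<Longrightarrow> lives_in \<omega> L \<longleftrightarrow> lv \<omega> L"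
  using LL_cut by (simp add: lv_def)

lemma lives_compl_iff: assumes "\<omega> \<in> edge_ends G" "L \<in> LL" shows "lives_in \<omega> (verts G - L) \<longleftrightarrow> \<not> lv \<omega> L"
proof -
  have "lives_in \<omega> (verts G - L) \<longleftrightarrow> lv \<omega> (verts G - L)"
    using assms LL_cut cut_Diff[OF cut_verts] by (simp add: lv_def)
  then show ?thesis using lv_cases[OF assms(1) LL_cut[OF assms(2)]] lv_Int(2)[of \<omega> L "verts G - L"] by blast
qed

lemma orients_iff:
  assumes "\<omega> \<in> edge_ends G" "L \<in> LL"
  shows "orients_towards PT.T part \<omega> {parent [L], [L]} K \<longleftrightarrow>
    (if lv \<omega> L then K = induced (PT.De [L]) (PT.sub [L]) else K = induced (PT.De [L]) (nodes - PT.sub [L]))"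
proof -
  have t: "[L] \<in> nodes - {[]}" using assms by simp
  show ?thesis unfolding orients_towards_def PT.component_De[OF t]
    using lives_iff[OF assms] lives_compl_iff[OF assms] parts_sub[OF assms(2)] parts_compl[OF assms(2)] by auto
qed

lemma edges_iff: "(\<forall>e\<in>edges PT.T. P e) \<longleftrightarrow> (\<forall>L\<in>LL. P {parent [L], [L]})"
proof
  assume "\<forall>e\<in>edges PT.T. P e"
  moreover have "{parent [L], [L]} \<in> edges PT.T" if "L \<in> LL" for L
    unfolding PT.T_simps by (rule image_eqI[of _ _ "[L]"]) (use that in simp_all)
  ultimately show "\<forall>L\<in>LL. P {parent [L], [L]}" by blast
next
  assume "\<forall>L\<in>LL. P {parent [L], [L]}"
  then show "\<forall>e\<in>edges PT.T. P e" using edge_obtain_node by metis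
qed

lemma points_to_node_iff:
  assumes "\<omega> \<in> edge_ends G"
  shows "points_to_node PT.T part \<omega> t \<longleftrightarrow> t \<in> nodes \<and> (\<forall>L\<in>LL. t \<in> PT.sub [L] \<longleftrightarrow> lv \<omega> L)"
proof -
  have "(\<exists>K. orients_towards PT.T part \<omega> {parent [L], [L]} K \<and> t \<in> verts K) \<longleftrightarrow> (t \<in> PT.sub [L] \<longleftrightarrow> lv \<omega> L)"
    if "L \<in> LL" "t \<in> nodes" for L
    unfolding orients_iff[OF assms that(1)] using that(2) by (cases "lv \<omega> L") simp_all
  then show ?thesis unfolding points_to_node_def edges_iff by (cases "t \<in> nodes") simp_all
qed

text \<open>In \<open>T\<close> a subtree is a cut with at most one boundary edge. The dichotomy for
  rays and finite cuts of multigraphs thus applies to the rays of the tree.\<close>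

lemma cut_sub: assumes t: "t \<in> nodes - {[]}" shows "PT.TG.cut (PT.sub t)"
proof -
  have "PT.TG.bd (PT.sub t) \<subseteq> {{parent t, t}}"
  proof
    fix e assume e: "e \<in> PT.TG.bd (PT.sub t)"
    then obtain u v where uv: "e \<in> edges PT.T" "endpoints PT.T e = {u, v}" "u \<in> PT.sub t" "v \<notin> PT.sub t"
      unfolding edge_boundary_def by blast
    have "(u, v) \<notin> adj (PT.De t)" using PT.De_closed[OF t] uv(3,4) by blast
    then show "e \<in> {{parent t, t}}" using uv(1,2) unfolding adj_def PT.De_simps PT.T_simps by blast
  qed
  then have "finite (PT.TG.bd (PT.sub t))" using finite_subset by blast
  then show ?thesis using PT.sub_N t unfolding PT.TG.cut_def by auto
qed

lemma end_lives_compl: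
  assumes \<eta>: "\<eta> \<in> graph_ends PT.T" and t: "t \<in> nodes - {[]}"
  shows "lives_in \<eta> (nodes - PT.sub t) \<longleftrightarrow> \<not> lives_in \<eta> (PT.sub t)"
proof -
  obtain R where R: "R \<in> \<eta>" using PT.tree_end_obtain[OF \<eta>] by metis
  have "PT.TG.evin S (nodes - PT.sub t) \<longleftrightarrow> \<not> lives_in \<eta> (PT.sub t)" if S: "S \<in> \<eta>" for S
  proof -
    have tN: "t \<in> nodes" using t by blast
    note Sr = PT.tree_end_ray[OF \<eta> S tN]
    have "PT.TG.evin S (nodes - PT.sub t) \<longleftrightarrow> \<not> PT.TG.evin S (PT.sub t)"
      using PT.TG.evin_cases[OF Sr(1) cut_sub[OF t]] PT.TG.evin_not_disjoint(2)[OF Sr(1), of "PT.sub t" "nodes - PT.sub t"]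
      by auto
    then show ?thesis using Sr(2) by blast
  qed
  then show ?thesis using R unfolding lives_in_def[of \<eta> "nodes - PT.sub t"] PT.TG.evin_def[symmetric] by blast
qed

lemma points_to_end_iff:
  assumes "\<omega> \<in> edge_ends G"
  shows "points_to_end PT.T part \<omega> \<eta> \<longleftrightarrow> \<eta> \<in> graph_ends PT.T \<and> (\<forall>L\<in>LL. lives_in \<eta> (PT.sub [L]) \<longleftrightarrow> lv \<omega> L)"
proof -
  have "(\<exists>K. orients_towards PT.T part \<omega> {parent [L], [L]} K \<and> lives_in \<eta> (verts K)) \<longleftrightarrow> (lives_in \<eta> (PT.sub [L]) \<longleftrightarrow> lv \<omega> L)"
    if "L \<in> LL" "\<eta> \<in> graph_ends PT.T" for L
    unfolding orients_iff[OF assms that(1)] using end_lives_compl[OF that(2), of "[L]"] that(1) by (cases "lv \<omega> L") simp_all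
  then show ?thesis unfolding points_to_end_def edges_iff by (cases "\<eta> \<in> graph_ends PT.T") simp_all
qed

text \<open>A chain that is closed upwards in \<open>LL\<close>. Whether it is finite decides
  whether \<omega> is sent to a node or to an end of the tree.\<close>

definition home :: "('v, 'e) mgraph set \<Rightarrow> 'v set set" where "home \<omega> = {L \<in> LL. lv \<omega> L}"

lemma home_chain: "L \<in> home \<omega> \<Longrightarrow> M \<in> home \<omega> \<Longrightarrow> L \<subseteq> M \<or> M \<subseteq> L"
  using nested[of L M] lv_Int(2)[of \<omega> L M] by (simp add: home_def)

lemma home_up: "L \<in> home \<omega> \<Longrightarrow> M \<in> LL \<Longrightarrow> L \<subseteq> M \<Longrightarrow> M \<in> home \<omega>"
  unfolding home_def using lv_mono LL_cut by blast

lemma node_unique: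
  assumes "t \<in> nodes" "t' \<in> nodes" "\<forall>L\<in>LL. t \<in> PT.sub [L] \<longleftrightarrow> t' \<in> PT.sub [L]" shows "t = t'"
proof -
  have 1: "t \<in> PT.sub t'" if t: "t \<in> nodes" "t' \<in> nodes" "\<forall>L\<in>LL. t \<in> PT.sub [L] \<longleftrightarrow> t' \<in> PT.sub [L]" for t t'
    using t(2)
  proof (cases rule: nodes_cases)
    case 1
    then show ?thesis using PT.sub_root t(1) by simp
  next
    case (2 L)
    then show ?thesis using t(3) PT.sub_self by blast
  qed
  have "t \<in> PT.sub t'" "t' \<in> PT.sub t" using 1[OF assms] 1[OF assms(2,1)] assms(3) by blast+
  then show ?thesis using PT.sub_dep[of t t'] PT.sub_dep[of t' t] by auto
qed

text \<open>A ray ascends beyond the depth of \<open>t\<close>, so some subtree contains a tail of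
  it but not \<open>t\<close>.\<close>

lemma end_not_node:
  assumes \<eta>: "\<eta> \<in> graph_ends PT.T" and t: "t \<in> nodes" and eq: "\<forall>L\<in>LL. lives_in \<eta> (PT.sub [L]) \<longleftrightarrow> t \<in> PT.sub [L]"
  shows False
proof -
  obtain R where R: "R \<in> rays PT.T" "R \<in> \<eta>" using PT.tree_end_obtain[OF \<eta>] by metis
  obtain x where x: "ray_enum R x" using R(1) unfolding rays_def by blast
  obtain n where n: "\<And>m. n \<le> m \<Longrightarrow> (x m, x (Suc m)) \<in> PT.ch" using PT.ray_ascends[OF R(1) x] by blast
  define m where "m = Suc (n + depth t)"
  have nm: "n \<le> m" by (simp add: m_def)
  have xm: "x m \<in> nodes" "x m \<noteq> []" using PT.chD[OF n[of "n + depth t"]] by (simp_all add: m_def)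
  then obtain L where L: "L \<in> LL" "x m = [L]" using nodes_cases by metis
  have "PT.TG.evin R (PT.sub (x m))" using PT.evin_sub_iff[OF R(1) x, of n "x m"] n nm PT.sub_self by blast
  then have "lives_in \<eta> (PT.sub [L])" using PT.tree_end_ray(2)[OF \<eta> R(2) xm(1)] L(2) by simp
  then have "t \<in> PT.sub (x m)" using eq L by simp
  then have "depth (x m) \<le> depth t" using PT.sub_dep by fastforce
  moreover have "depth (x m) = depth (x n) + (m - n)" by (rule PT.ascending_sub(2)[of n x, OF n order_refl nm])
  ultimately show False by (simp add: m_def)
qed

lemma upset_home: "L \<in> home \<omega> \<Longrightarrow> upset L \<subseteq> home \<omega>"
  using home_up unfolding upset_def by blast

lemma upset_inj: assumes "L \<in> home \<omega>" "M \<in> home \<omega>" "card (upset L) = card (upset M)" shows "L = M"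
proof -
  have *: "card (upset M) < card (upset L)" if "L \<in> LL" "M \<in> LL" "L \<subset> M" for L M
  proof (rule psubset_card_mono[OF finite_upset[OF that(1)]])
    show "upset M \<subset> upset L" using that unfolding upset_def by blast
  qed
  have "L \<in> LL" "M \<in> LL" using assms(1,2) by (auto simp: home_def)
  then show ?thesis using *[of L M] *[of M L] home_chain[OF assms(1,2)] assms(3) by fastforce
qed

text \<open>Distinct members of the chain have different numbers of proper supersets in
  \<open>LL\<close>, and all these supersets belong to the chain. So an infinite chain has exactly
  one member with \<open>k\<close> proper supersets, for every \<open>k\<close>, and these members
  form a ray after the root.\<close>

lemma end_of_infinite_home:
  assumes inf: "infinite (home \<omega>)"
  shows "\<exists>\<eta>\<in>graph_ends PT.T. \<forall>L\<in>LL. lives_in \<eta> (PT.sub [L]) \<longleftrightarrow> lv \<omega> L"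
proof -
  have ex: "\<exists>L\<in>home \<omega>. card (upset L) = k" for k
  proof -
    have "\<not> (\<lambda>L. card (upset L)) ` home \<omega> \<subseteq> {..<k}"
    proof
      assume "(\<lambda>L. card (upset L)) ` home \<omega> \<subseteq> {..<k}"
      then have "finite ((\<lambda>L. card (upset L)) ` home \<omega>)" using finite_subset by blast
      moreover have "inj_on (\<lambda>L. card (upset L)) (home \<omega>)" by (rule inj_onI) (rule upset_inj)
      ultimately show False using inf finite_imageD by blast
    qed
    then obtain M where M: "M \<in> home \<omega>" "k \<le> card (upset M)" by fastforce
    have "\<exists>L\<in>home \<omega>. card (upset L) = k" if "M \<in> home \<omega>" "card (upset M) = k + j" for M j
      using that
    proof (induction j arbitrary: M)
      case (Suc j)
      have M_in: "M \<in> LL" using Suc.prems(1) by (simp add: home_def)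
      have ne: "upset M \<noteq> {}" using Suc.prems(2) by auto
      have "up M \<in> home \<omega>" using upset_home[OF Suc.prems(1)] up_props(1)[OF M_in ne] by blast
      moreover have "card (upset (up M)) = k + j" using card_upset[OF M_in ne] Suc.prems(2) by simp
      ultimately show ?case by (rule Suc.IH)
    qed auto
    then show ?thesis using M le_Suc_ex by metis
  qed
  then obtain f where f: "\<And>k. f k \<in> home \<omega>" "\<And>k. card (upset (f k)) = k" by metis
  have fL: "f k \<in> LL" for k using f(1) by (simp add: home_def)
  define x where "x = (\<lambda>n. case n of 0 \<Rightarrow> [] | Suc k \<Rightarrow> [f k])"
  have "(x n, x (Suc n)) \<in> PT.ch" for n
  proof (cases n)
    case 0
    have "upset (f 0) = {}" using f(2)[of 0] finite_upset[OF fL] by simp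
    moreover have "(parent [f 0], [f 0]) \<in> PT.ch" by (rule PT.chI) (use fL in simp_all)
    ultimately show ?thesis using 0 by (simp add: x_def)
  next
    case (Suc k)
    have ne: "upset (f (Suc k)) \<noteq> {}" using f(2)[of "Suc k"] by auto
    have "up (f (Suc k)) \<in> home \<omega>" using upset_home[OF f(1)] up_props(1)[OF fL ne] by blast
    then have "up (f (Suc k)) = f k" by (rule upset_inj[OF _ f(1)]) (use card_upset[OF fL ne] f(2) in simp)
    moreover have "(parent [f (Suc k)], [f (Suc k)]) \<in> PT.ch" by (rule PT.chI) (use fL in simp_all)
    ultimately show ?thesis using Suc ne by (simp add: x_def)
  qed
  from PT.tree_end_exists[of x, OF this] obtain \<eta> where
    \<eta>: "\<eta> \<in> graph_ends PT.T" "\<forall>t\<in>nodes. lives_in \<eta> (PT.sub t) \<longleftrightarrow> (\<exists>n. x n \<in> PT.sub t)" by blast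
  have "(\<exists>n. x n \<in> PT.sub [L]) \<longleftrightarrow> lv \<omega> L" if L: "L \<in> LL" for L
  proof
    assume "\<exists>n. x n \<in> PT.sub [L]"
    then obtain n M where M: "M \<subseteq> L" "x n = [M]" using node_in_sub[OF L] by blast
    then obtain k where "M = f k" by (cases n) (auto simp: x_def)
    then show "lv \<omega> L" using home_up[OF f(1) L] M(1) by (simp add: home_def)
  next
    assume "lv \<omega> L"
    then have "L = f (card (upset L))" using upset_inj[OF _ f(1), of L] L f(2) by (simp add: home_def)
    then have "x (Suc (card (upset L))) = [L]" by (simp add: x_def)
    then show "\<exists>n. x n \<in> PT.sub [L]" using PT.sub_self by metis
  qed
  then show ?thesis using \<eta> by (metis node_in(1))
qed

lemma node_of_finite_home:
  assumes fin: "finite (home \<omega>)"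
  shows "\<exists>t\<in>nodes. \<forall>L\<in>LL. t \<in> PT.sub [L] \<longleftrightarrow> lv \<omega> L"
proof (cases "home \<omega> = {}")
  case True
  have "[] \<in> PT.sub [L] \<longleftrightarrow> lv \<omega> L" if "L \<in> LL" for L using True that node_in_sub[OF that] by (auto simp: home_def)
  then show ?thesis using node_in(2) by blast
next
  case False
  then obtain M where M: "M \<in> home \<omega>" "\<And>K. K \<in> home \<omega> \<Longrightarrow> K \<subseteq> M \<Longrightarrow> M = K"
    using finite_has_minimal[OF fin] by metis
  have M_in: "M \<in> LL" using M(1) by (simp add: home_def)
  have "[M] \<in> PT.sub [L] \<longleftrightarrow> lv \<omega> L" if L: "L \<in> LL" for L
  proof -
    have "[M] \<in> PT.sub [L] \<longleftrightarrow> M \<subseteq> L" using node_in_sub[OF L] M_in by auto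
    also have "\<dots> \<longleftrightarrow> L \<in> home \<omega>" using home_up[OF M(1) L] home_chain[OF M(1), of L] M(2)[of L] by blast
    finally show ?thesis using L by (simp add: home_def)
  qed
  then show ?thesis using M_in node_in(1) by blast
qed

text \<open>For uniqueness in the definite description: an end of \<open>T\<close> is determined by
  the subtrees in which it lives, and no node orients all edges as an end does.\<close>

lemma phi_infinite:
  assumes w: "\<omega> \<in> edge_ends G" and e: "\<eta> \<in> graph_ends PT.T" "\<forall>L\<in>LL. lives_in \<eta> (PT.sub [L]) \<longleftrightarrow> lv \<omega> L"
  shows "phi PT.T part \<omega> = Inr \<eta>"
  unfolding phi_def
proof (rule the_equality)
  show "case Inr \<eta> of Inl t \<Rightarrow> points_to_node PT.T part \<omega> t | Inr \<eta> \<Rightarrow> points_to_end PT.T part \<omega> \<eta>"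
    using e by (simp add: points_to_end_iff[OF w])
  fix z assume z: "case z of Inl t \<Rightarrow> points_to_node PT.T part \<omega> t | Inr \<eta> \<Rightarrow> points_to_end PT.T part \<omega> \<eta>"
  show "z = Inr \<eta>"
  proof (cases z)
    case (Inl t)
    then have "t \<in> nodes" "\<forall>L\<in>LL. t \<in> PT.sub [L] \<longleftrightarrow> lv \<omega> L" using z by (simp_all add: points_to_node_iff[OF w])
    then show ?thesis using end_not_node[OF e(1)] e(2) by blast
  next
    case (Inr \<theta>)
    then have th: "\<theta> \<in> graph_ends PT.T" "\<forall>L\<in>LL. lives_in \<theta> (PT.sub [L]) \<longleftrightarrow> lv \<omega> L" using z by (simp_all add: points_to_end_iff[OF w])
    have "\<theta> = \<eta>"
    proof (rule PT.tree_end_eqI[OF th(1) e(1)])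
      fix t assume "t \<in> nodes" "t \<noteq> []"
      then obtain L where "L \<in> LL" "t = [L]" using nodes_cases by metis
      then show "lives_in \<theta> (PT.sub t) \<longleftrightarrow> lives_in \<eta> (PT.sub t)" using th(2) e(2) by simp
    qed
    then show ?thesis using Inr by simp
  qed
qed

lemma phi_finite:
  assumes w: "\<omega> \<in> edge_ends G" and t: "t \<in> nodes" "\<forall>L\<in>LL. t \<in> PT.sub [L] \<longleftrightarrow> lv \<omega> L"
  shows "phi PT.T part \<omega> = Inl t"
  unfolding phi_def
proof (rule the_equality)
  show "case Inl t of Inl t \<Rightarrow> points_to_node PT.T part \<omega> t | Inr \<eta> \<Rightarrow> points_to_end PT.T part \<omega> \<eta>"
    using t by (simp add: points_to_node_iff[OF w])
  fix z assume z: "case z of Inl t \<Rightarrow> points_to_node PT.T part \<omega> t | Inr \<eta> \<Rightarrow> points_to_end PT.T part \<omega> \<eta>"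
  show "z = Inl t"
  proof (cases z)
    case (Inl s)
    then have s: "s \<in> nodes" "\<forall>L\<in>LL. s \<in> PT.sub [L] \<longleftrightarrow> lv \<omega> L" using z by (simp_all add: points_to_node_iff[OF w])
    then have "s = t" using node_unique[OF s(1) t(1)] t(2) by blast
    then show ?thesis using Inl by simp
  next
    case (Inr \<theta>)
    then have "\<theta> \<in> graph_ends PT.T" "\<forall>L\<in>LL. lives_in \<theta> (PT.sub [L]) \<longleftrightarrow> lv \<omega> L" using z by (simp_all add: points_to_end_iff[OF w])
    then show ?thesis using end_not_node[OF _ t(1)] t(2) by blast
  qed
qed

lemma phi_Inr_iff:
  assumes w: "\<omega> \<in> edge_ends G"
  shows "phi PT.T part \<omega> = Inr \<eta> \<longleftrightarrow> \<eta> \<in> graph_ends PT.T \<and> (\<forall>L\<in>LL. lives_in \<eta> (PT.sub [L]) \<longleftrightarrow> lv \<omega> L)"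
proof (cases "finite (home \<omega>)")
  case True
  obtain t where t: "t \<in> nodes" "\<forall>L\<in>LL. t \<in> PT.sub [L] \<longleftrightarrow> lv \<omega> L" using node_of_finite_home[OF True] by blast
  then show ?thesis using phi_finite[OF w t] phi_infinite[OF w] by auto
next
  case False
  obtain \<theta> where th: "\<theta> \<in> graph_ends PT.T" "\<forall>L\<in>LL. lives_in \<theta> (PT.sub [L]) \<longleftrightarrow> lv \<omega> L"
    using end_of_infinite_home[OF False] by blast
  then show ?thesis using phi_infinite[OF w th] phi_infinite[OF w, of \<eta>] by auto
qed

lemma phi_Inr_infinite:
  assumes w: "\<omega> \<in> edge_ends G" shows "phi PT.T part \<omega> \<in> Inr ` graph_ends PT.T \<longleftrightarrow> infinite (home \<omega>)"
proof
  assume "infinite (home \<omega>)"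
  then show "phi PT.T part \<omega> \<in> Inr ` graph_ends PT.T" using end_of_infinite_home phi_infinite[OF w] by blast
next
  assume "phi PT.T part \<omega> \<in> Inr ` graph_ends PT.T"
  then show "infinite (home \<omega>)" using node_of_finite_home phi_finite[OF w] by (metis Inl_Inr_False imageE)
qed

text \<open>Only finitely many members meet the end vertices of \<open>bd C\<close>, so an infinite
  \<open>home\<close> has a member avoiding them. Being connected and containing \<omega>, it lies
  inside \<open>C\<close>, and \<omega>' lives in it too.\<close>

lemma infinite_home_unique:
  assumes w: "\<omega> \<in> edge_ends G" "\<omega>' \<in> edge_ends G" and inf: "infinite (home \<omega>)" and eq: "home \<omega> = home \<omega>'"
  shows "\<omega> = \<omega>'"
proof (rule lv_unique[OF w])
  fix C assume C: "lv \<omega> C"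
  let ?Y = "\<Union>(endpoints G ` bd C)"
  have "\<not> home \<omega> \<subseteq> {L \<in> LL. L \<inter> ?Y \<noteq> {}}"
    using inf finite_meeting[OF finite_bd_endpoints[OF lv_cut[OF C]]] finite_subset by blast
  then obtain L where L: "L \<in> home \<omega>" "?Y \<inter> L = {}" unfolding home_def by blast
  then have LL: "L \<in> LL" "lv \<omega> L" "lv \<omega>' L" using eq by (auto simp: home_def)
  have "L \<subseteq> C \<or> L \<inter> C = {}" by (rule conn_cases[OF LL_conn[OF LL(1)] L(2)])
  then have "L \<subseteq> C" using lv_Int(2)[OF LL(2) C] by blast
  then show "lv \<omega>' C" using lv_mono[OF LL(3) _ lv_cut[OF C]] by blast
qed

text \<open>The nodes on a ray form a strictly descending chain of connected cuts, and by
  point-finiteness no vertex is in all of them, so \<open>chain_end\<close> applies. If its end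
  lived in a member \<open>L\<close> containing no set of the chain, then \<open>L\<close> would
  have infinitely many members above it.\<close>

lemma tree_end_attained:
  assumes \<eta>: "\<eta> \<in> graph_ends PT.T"
  shows "\<exists>\<omega>\<in>edge_ends G. \<forall>L\<in>LL. lives_in \<eta> (PT.sub [L]) \<longleftrightarrow> lv \<omega> L"
proof -
  obtain R where R: "R \<in> rays PT.T" "R \<in> \<eta>" using PT.tree_end_obtain[OF \<eta>] by metis
  obtain x where x: "ray_enum R x" using R(1) unfolding rays_def by blast
  obtain n where n: "\<And>m. n \<le> m \<Longrightarrow> (x m, x (Suc m)) \<in> PT.ch" using PT.ray_ascends[OF R(1) x] by blast
  have "\<exists>L. L \<in> LL \<and> x (Suc (n + k)) = [L]" for k
    using PT.chD[OF n[of "n + k"]] nodes_cases by (metis le_add1)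
  then obtain C where C: "\<And>k. C k \<in> LL" "\<And>k. x (Suc (n + k)) = [C k]" by metis
  have Csub: "C j \<subseteq> C i" if "i \<le> j" for i j
  proof -
    have "x (Suc (n + j)) \<in> PT.sub (x (Suc (n + i)))"
      by (rule PT.ascending_sub(1)[of n x, OF n]) (use that in simp_all)
    then show ?thesis using node_in_sub[OF C(1)] C(2) by auto
  qed
  have injx: "inj x" by (rule PT.ray_adj(2)[OF R(1) x])
  have injC: "inj C"
  proof (rule injI)
    fix i j assume "C i = C j"
    then have "x (Suc (n + i)) = x (Suc (n + j))" using C(2) by simp
    then show "i = j" using injD[OF injx] by fastforce
  qed
  have infC: "infinite (range C)" using injC finite_imageD by blast
  have ev: "\<exists>k. v \<notin> C k" for v
  proof (rule ccontr)
    assume "\<nexists>k. v \<notin> C k"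
    then have "range C \<subseteq> {L \<in> LL. v \<in> L}" using C(1) by blast
    then show False using infC finite_containing finite_subset by blast
  qed
  obtain \<omega> where w: "\<omega> \<in> edge_ends G" "\<forall>k. lv \<omega> (C k)"
    using chain_end[of C, OF LL_cut[OF C(1)] LL_conn[OF C(1)] Csub ev] by auto
  have "lives_in \<eta> (PT.sub [L]) \<longleftrightarrow> lv \<omega> L" if L: "L \<in> LL" for L
  proof -
    have "lives_in \<eta> (PT.sub [L]) \<longleftrightarrow> (\<exists>m\<ge>Suc n. x m \<in> PT.sub [L])"
      using PT.tree_end_ray(2)[OF \<eta> R(2), of "[L]"] L PT.evin_sub_iff[OF R(1) x, of "Suc n" "[L]"] n by simp
    also have "\<dots> \<longleftrightarrow> (\<exists>k. C k \<subseteq> L)"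
    proof
      assume "\<exists>m\<ge>Suc n. x m \<in> PT.sub [L]"
      then obtain m where m: "m \<ge> Suc n" "x m \<in> PT.sub [L]" by blast
      then obtain k where "m = Suc (n + k)" using le_Suc_ex by (metis add_Suc)
      then show "\<exists>k. C k \<subseteq> L" using m(2) C(2)[of k] node_in_sub[OF L] by auto
    next
      assume "\<exists>k. C k \<subseteq> L"
      then obtain k where "C k \<subseteq> L" by blast
      then have "x (Suc (n + k)) \<in> PT.sub [L]" using C node_in_sub[OF L] by blast
      then show "\<exists>m\<ge>Suc n. x m \<in> PT.sub [L]" by (intro exI[of _ "Suc (n + k)"]) simp
    qed
    also have "\<dots> \<longleftrightarrow> lv \<omega> L"
    proof
      assume "\<exists>k. C k \<subseteq> L"
      then show "lv \<omega> L" using lv_mono[OF _ _ LL_cut[OF L]] w(2) by blast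
    next
      assume wL: "lv \<omega> L"
      show "\<exists>k. C k \<subseteq> L"
      proof (rule ccontr)
        assume n: "\<nexists>k. C k \<subseteq> L"
        have "C k \<in> upset L" for k
          using n nested[OF L C(1)] lv_Int(2)[OF wL] w(2) C(1) unfolding upset_def by blast
        then have "range C \<subseteq> upset L" by blast
        then show False using infC finite_upset[OF L] finite_subset by blast
      qed
    qed
    finally show ?thesis .
  qed
  then show ?thesis using w(1) by blast
qed

lemma infinite_home_undominated:
  assumes "\<omega> \<in> edge_ends G" "infinite (home \<omega>)" shows "\<omega> \<in> undominated_edge_ends G"
  unfolding undominated_iff
proof (intro conjI ballI)
  fix v
  have "\<not> home \<omega> \<subseteq> {L \<in> LL. v \<in> L}" using assms(2) finite_containing finite_subset by blast
  then show "\<exists>C. lv \<omega> C \<and> v \<notin> C" unfolding home_def by blast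
qed (rule assms)

lemma displays_undominated:
  assumes inf: "\<And>\<omega>. \<omega> \<in> undominated_edge_ends G \<Longrightarrow> infinite (home \<omega>)"
  shows "displays G PT.T part (undominated_edge_ends G)"
proof -
  have U: "\<omega> \<in> undominated_edge_ends G \<longleftrightarrow> \<omega> \<in> edge_ends G \<and> infinite (home \<omega>)" for \<omega>
    using inf infinite_home_undominated undominated_iff by blast
  have "{\<omega> \<in> edge_ends G. phi PT.T part \<omega> \<in> Inr ` graph_ends PT.T} = undominated_edge_ends G"
    using U phi_Inr_infinite by blast
  moreover have "bij_betw (phi PT.T part) (undominated_edge_ends G) (Inr ` graph_ends PT.T)"
    unfolding bij_betw_def
  proof
    show "inj_on (phi PT.T part) (undominated_edge_ends G)"
    proof (rule inj_onI)
      fix \<omega> \<omega>' assume w: "\<omega> \<in> undominated_edge_ends G" "\<omega>' \<in> undominated_edge_ends G" "phi PT.T part \<omega> = phi PT.T part \<omega>'"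
      have E: "\<omega> \<in> edge_ends G" "\<omega>' \<in> edge_ends G" "infinite (home \<omega>)" using w U by blast+
      obtain \<eta> where \<eta>: "phi PT.T part \<omega> = Inr \<eta>" using phi_Inr_infinite[OF E(1)] E(3) by blast
      then have "\<forall>L\<in>LL. lv \<omega> L \<longleftrightarrow> lv \<omega>' L" using phi_Inr_iff[OF E(1), of \<eta>] phi_Inr_iff[OF E(2), of \<eta>] w(3) by auto
      then have "home \<omega> = home \<omega>'" unfolding home_def by blast
      then show "\<omega> = \<omega>'" by (rule infinite_home_unique[OF E])
    qed
    show "phi PT.T part ` undominated_edge_ends G = Inr ` graph_ends PT.T"
    proof
      show "phi PT.T part ` undominated_edge_ends G \<subseteq> Inr ` graph_ends PT.T" using U phi_Inr_infinite by blast
      show "Inr ` graph_ends PT.T \<subseteq> phi PT.T part ` undominated_edge_ends G"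
      proof
        fix z :: "'v set list + ('v set list, 'v set list set) mgraph set"
        assume "z \<in> Inr ` graph_ends PT.T"
        then obtain \<eta> where \<eta>: "\<eta> \<in> graph_ends PT.T" "z = Inr \<eta>" by blast
        obtain \<omega> where w: "\<omega> \<in> edge_ends G" "\<forall>L\<in>LL. lives_in \<eta> (PT.sub [L]) \<longleftrightarrow> lv \<omega> L"
          using tree_end_attained[OF \<eta>(1)] by blast
        have p: "phi PT.T part \<omega> = z" using phi_infinite[OF w(1) \<eta>(1) w(2)] \<eta>(2) by simp
        then have "\<omega> \<in> undominated_edge_ends G" using U w(1) phi_Inr_infinite[OF w(1)] \<eta> by blast
        then show "z \<in> phi PT.T part ` undominated_edge_ends G" using p by blast
      qed
    qed
  qed
  ultimately show ?thesis unfolding displays_def by blast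
qed

subsection \<open>Edge-degrees\<close>

text \<open>A ray from the root ascends from parent to child. Following parents back from a vertex
  of the ray in the subtree of \<open>[L]\<close> leads to \<open>[L]\<close> along the ray, so no
  member around \<omega> is skipped.\<close>

lemma root_ray_nodes:
  assumes w: "\<omega> \<in> edge_ends G" and p: "phi PT.T part \<omega> = Inr \<eta>" and R: "R \<in> \<eta>" "ray_enum R t" "t 0 = []"
  shows "\<exists>C. inj C \<and> range C = home \<omega> \<and> (\<forall>n. t (Suc n) = [C n])"
proof -
  have \<eta>: "\<eta> \<in> graph_ends PT.T" "\<forall>L\<in>LL. lives_in \<eta> (PT.sub [L]) \<longleftrightarrow> lv \<omega> L"
    using p phi_Inr_iff[OF w] by blast+
  have ray: "R \<in> rays PT.T" using PT.tree_end_ray(1)[OF \<eta>(1) R(1)] node_in(2) by blast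
  have asc: "(t n, t (Suc n)) \<in> PT.ch" for n by (rule PT.ray_from_root_ascends[OF ray R(2,3)])
  have "\<exists>L. L \<in> LL \<and> t (Suc n) = [L]" for n using PT.chD[OF asc[of n]] nodes_cases by metis
  then obtain C where C: "\<And>n. C n \<in> LL" "\<And>n. t (Suc n) = [C n]" by metis
  have "inj C"
  proof (rule injI)
    fix i j assume "C i = C j"
    then have "t (Suc i) = t (Suc j)" using C(2) by simp
    then show "i = j" using injD[OF PT.ray_adj(2)[OF ray R(2)]] by fastforce
  qed
  have liv: "lv \<omega> L \<longleftrightarrow> (\<exists>m. t m \<in> PT.sub [L])" if L: "L \<in> LL" for L
    using \<eta>(2) L PT.tree_end_ray(2)[OF \<eta>(1) R(1), of "[L]"] PT.evin_sub_iff[OF ray R(2), of 0 "[L]"] asc by simp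
  have "C n \<in> home \<omega>" for n
    using liv[OF C(1)] C PT.sub_self[of "[C n]"] unfolding home_def by (metis (mono_tags) mem_Collect_eq)
  moreover have "\<exists>n. C n = L" if L: "L \<in> home \<omega>" for L
  proof -
    have LL: "L \<in> LL" "lv \<omega> L" using L by (auto simp: home_def)
    have "\<exists>j. t j = [L]" if "t m \<in> PT.sub [L]" for m
      using that
    proof (induction m)
      case 0
      then show ?case using R(3) node_in_sub[OF LL(1)] by auto
    next
      case (Suc m)
      show ?case
      proof (cases "t (Suc m) = [L]")
        case False
        then have "parent (t (Suc m)) \<in> PT.sub [L]" using PT.sub_par(3) Suc.prems by blast
        then show ?thesis using Suc.IH PT.chD[OF asc[of m]] by simp
      qed blast
    qed
    then obtain j where j: "t j = [L]" using liv[OF LL(1)] LL(2) by blast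
    then obtain n where "j = Suc n" using R(3) by (cases j) auto
    then show ?thesis using C(2)[of n] j by auto
  qed
  ultimately show ?thesis using \<open>inj C\<close> C(2) by (intro exI[of _ C]) blast
qed

text \<open>All but finitely many members of the chain avoid the first vertices of finitely many
  given rays and are therefore crossed by each of them, which bounds the degree from above.
  Conversely, if the degree is \<open>d\<close>, infinitely many members have at most
  \<open>d\<close> boundary edges. Index 0 of \<open>F\<close> belongs to the root, hence the
  shift.\<close>

lemma degree_liminf:
  assumes w: "\<omega> \<in> edge_ends G" and C: "inj C" "range C = home \<omega>"
    and small: "\<And>d. edge_degree \<omega> = enat d \<Longrightarrow> infinite {L \<in> LL. lv \<omega> L \<and> card (bd L) \<le> d}"
    and F: "\<And>n. F (Suc n) = ecard (bd (C n))"
  shows "edge_degree \<omega> = liminf F"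
proof (rule antisym)
  have Ccut: "C n \<in> LL" "lv \<omega> (C n)" for n using C(2) unfolding home_def by blast+
  have Fcard: "F (Suc n) = enat (card (bd (C n)))" for n
    using F cut_finite[OF LL_cut[OF Ccut(1)]] by (simp add: ecard_def)
  have fin_le: "enat (card RR) \<le> liminf F"
    if RR: "RR \<subseteq> \<omega>" "finite RR" "pairwise (\<lambda>R S. disjnt (edges R) (edges S)) RR" for RR
  proof -
    obtain Y where Y: "finite Y" "\<forall>L. lv \<omega> L \<longrightarrow> L \<inter> Y = {} \<longrightarrow> card RR \<le> card (bd L)"
      using disjoint_rays_le_boundary[OF w RR] by blast
    have "finite (C -` {L \<in> LL. L \<inter> Y \<noteq> {}})" using finite_vimageI[OF finite_meeting[OF Y(1)] C(1)] .
    then obtain m where m: "\<forall>n\<in>C -` {L \<in> LL. L \<inter> Y \<noteq> {}}. n < m" using finite_nat_set_iff_bounded by blast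
    have "enat (card RR) \<le> F n" if n: "n \<ge> Suc m" for n
    proof -
      obtain k where k: "n = Suc k" "m \<le> k" using n by (cases n) auto
      have "k \<notin> C -` {L \<in> LL. L \<inter> Y \<noteq> {}}" using m k(2) by (meson leD)
      then have "C k \<inter> Y = {}" using Ccut(1) by simp
      then show ?thesis using Y(2) Ccut(2) Fcard k(1) by simp
    qed
    then have "eventually (\<lambda>n. enat (card RR) \<le> F n) sequentially" unfolding eventually_sequentially by blast
    then show ?thesis by (rule Liminf_bounded)
  qed
  show "edge_degree \<omega> \<le> liminf F" unfolding edge_degree_def
  proof (rule Sup_least)
    fix z assume "z \<in> {ecard \<R> |\<R>. \<R> \<subseteq> \<omega> \<and> pairwise (\<lambda>R S. disjnt (edges R) (edges S)) \<R>}"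
    then obtain RR where RR: "z = ecard RR" "RR \<subseteq> \<omega>" "pairwise (\<lambda>R S. disjnt (edges R) (edges S)) RR" by blast
    show "z \<le> liminf F"
    proof (cases "finite RR")
      case True
      then show ?thesis using fin_le[OF RR(2) _ RR(3)] RR(1) by (simp add: ecard_def)
    next
      case False
      \<comment> \<open>An infinite family is compared with boundaries through its finite
        subfamilies, which give every natural number as a bound.\<close>
      have "enat k \<le> liminf F" for k
      proof -
        obtain Q where Q: "Q \<subseteq> RR" "finite Q" "card Q = k" using infinite_arbitrarily_large[OF False] by blast
        then show ?thesis using fin_le[of Q] RR(2,3) pairwise_subset by (metis subset_trans)
      qed
      then have "liminf F = \<infinity>" by (metis Suc_ile_eq enat.exhaust less_irrefl not_infinity_eq)
      then show ?thesis by simp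
    qed
  qed
  show "liminf F \<le> edge_degree \<omega>"
  proof (cases "edge_degree \<omega>")
    case (enat d)
    show ?thesis
    proof (rule ccontr)
      assume "\<not> ?thesis"
      then have "enat d < liminf F" using enat by simp
      then have "eventually (\<lambda>n. enat d < F n) sequentially" by (rule less_LiminfD)
      then obtain m where m: "\<And>n. n \<ge> m \<Longrightarrow> enat d < F n" unfolding eventually_sequentially by blast
      have "{L \<in> LL. lv \<omega> L \<and> card (bd L) \<le> d} \<subseteq> C ` {..<m}"
      proof
        fix L assume L: "L \<in> {L \<in> LL. lv \<omega> L \<and> card (bd L) \<le> d}"
        then have "L \<in> home \<omega>" by (simp add: home_def)
        then obtain n where n: "L = C n" using C(2) by blast
        have "\<not> m \<le> Suc n" using m[of "Suc n"] L n Fcard by auto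
        then show "L \<in> C ` {..<m}" using n by simp
      qed
      then show False using small[OF enat] finite_subset by blast
    qed
  qed simp
qed

end

theorem theorem1p2:
  fixes G :: "('v, 'e) mgraph"
  assumes "multigraph G"
  shows "\<exists>(T :: 'v decomposition_tree) r V.
    rooted_tree_cut_decomposition G T r V \<and>
    finite_adhesion G T V \<and>
    displays G T V (undominated_edge_ends G) \<and>
    (\<forall>\<omega>\<in>undominated_edge_ends G. \<forall>\<eta> R t.
       phi T V \<omega> = Inr \<eta> \<and> R \<in> \<eta> \<and> ray_enum R t \<and> t 0 = r \<longrightarrow>
       edge_degree \<omega> = liminf (\<lambda>n. ecard (edge_boundary G (part_above T r V (t n)))))"
proof -
  interpret multi_graph G by unfold_locales (rule assms)
  show ?thesis
  proof (rule laminar_family)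
    fix LL assume LL: "laminar LL" "point_finite LL" "\<And>L. L \<in> LL \<Longrightarrow> cut L \<and> conn G L"
      and inf: "\<And>\<omega>. \<omega> \<in> undominated_edge_ends G \<Longrightarrow> infinite {L \<in> LL. lv \<omega> L}"
      and small: "\<And>\<omega> e. \<omega> \<in> undominated_edge_ends G \<Longrightarrow>
        (\<And>D. lv \<omega> D \<Longrightarrow> \<exists>C. lv \<omega> C \<and> C \<subseteq> D \<and> card (bd C) \<le> e) \<Longrightarrow>
        infinite {L \<in> LL. lv \<omega> L \<and> card (bd L) \<le> e}"
    interpret laminar_cuts G LL by unfold_locales (use LL in blast)+
    have "edge_degree \<omega> = liminf (\<lambda>n. ecard (bd (part_above PT.T [] part (t n))))"
      if w: "\<omega> \<in> undominated_edge_ends G" and t: "phi PT.T part \<omega> = Inr \<eta>" "R \<in> \<eta>" "ray_enum R t" "t 0 = []" for \<omega> \<eta> R t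
    proof -
      have wE: "\<omega> \<in> edge_ends G" using w undominated_iff by blast
      obtain C where C: "inj C" "range C = home \<omega>" "\<forall>n. t (Suc n) = [C n]" using root_ray_nodes[OF wE t] by blast
      have "part_above PT.T [] part (t (Suc n)) = C n" for n
        using C(2,3) part_above_node[of "C n"] unfolding home_def by auto
      \<comment> \<open>By the flow argument every cut around \<omega> contains a cut around
        \<omega> of size at most the degree; the retained layers turn this into infinitely many
        small members.\<close>
      moreover have "infinite {L \<in> LL. lv \<omega> L \<and> card (bd L) \<le> d}" if "edge_degree \<omega> = enat d" for d
        by (rule small[OF w]) (rule cut_le_degree[OF w that])
      ultimately show ?thesis by (intro degree_liminf[OF wE C(1,2)]) simp_all
    qed
    moreover have "displays G PT.T part (undominated_edge_ends G)"
      by (rule displays_undominated) (use inf in \<open>simp add: home_def\<close>)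
    ultimately show ?thesis using decomposition adhesion
      by (intro exI[of _ PT.T] exI[of _ "[]"] exI[of _ part]) blast
  qed
qed

end
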